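(* Let $f(s)=1+\sum_{n\ge1}a_ne^{-\lambda_ns}$ be a non-constant Dirichlet series as in the context, with meromorphic extension of finite order to $\mathbb{C}$ and convergence exponent $d\ge1$, and let $\sigma\in\mathbb{C}$. Then, as distributions on $\mathbb{R}$, $$\widehat W_\sigma(f)=2\sum_{0\le l\le\frac{g-1}{2}}c_{2l}(\sigma)\,\delta_0^{(2l)}+\sum_{\mathbf{k}\in\Lambda\cup(-\Lambda)}\langle\boldsymbol\lambda,|\mathbf{k}|\rangle\,b_{|\mathbf{k}|}\,\delta_{\langle\boldsymbol\lambda,\mathbf{k}\rangle},$$ where $|\mathbf{k}|=\mathbf{k}$ for $\mathbf{k}\in\Lambda$ and $|\mathbf{k}|=-\mathbf{k}$ for $\mathbf{k}\in-\Lambda$.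
   Context: Dirichlet series: $a_n\in\mathbb{C}$, $0<\lambda_1<\lambda_2<\cdots$, finitely many terms or $\lambda_n\to\infty$, absolutely convergent in some half-plane. $\Lambda$: sequences $\mathbf{k}=(k_n)$ of non-negative integers, finitely many non-zero, $\|\mathbf{k}\|=\sum k_n\ge1$; $\langle\boldsymbol\lambda,\mathbf{k}\rangle=\sum\lambda_nk_n$; $b_{\mathbf{k}}$ defined by $-\log f(s)=\sum_{\mathbf{k}\in\Lambda}b_{\mathbf{k}}e^{-\langle\boldsymbol\lambda,\mathbf{k}\rangle s}$ for $\Re s$ large, i.e. $b_{\mathbf{k}}=\frac{(-1)^{\|\mathbf{k}\|}}{\|\mathbf{k}\|}\frac{\|\mathbf{k}\|!}{\prod_jk_j!}\prod_ja_j^{k_j}$. $n_\rho$: multiplicity of $\rho$ as zero of $f$ (negative for poles); $d$ the least integer with $\sum_{\rho\ne0}|n_\rho||\rho|^{-d}<\infty$. $K_{d,\sigma}(t)=\big(n_\sigma\tfrac{t^d}{d!}+\sum_{\rho\ne\sigma}\tfrac{n_\rho}{(\rho-\sigma)^d}e^{(\rho-\sigma)t}\big)\mathbf{1}_{\mathbb{R}_+}(t)$, $W_\sigma(f)=e^{\sigma t}\frac{D^d}{Dt^d}\big((K_{d,\sigma}(t)-K_{d,\sigma}(0))\mathbf{1}_{\mathbb{R}_+}\big)$, and $\widehat W_\sigma(f)=W_\sigma(f)(t)+W_\sigma(f)(-t)$. With $m=d-1$, $E_m(z)=(1-z)\exp(z+\dots+z^m/m)$ and Hadamard factorization $f(s)=(s-\sigma)^{n_\sigma}e^{Q_{f,\sigma}(s)}\prod_{\rho\ne\sigma}E_m(\frac{s-\sigma}{\rho-\sigma})^{n_\rho}$: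 genus $g=\max(\deg Q_{f,\sigma},m)$, $-Q'_{f,\sigma}(s)=\sum_{j=0}^{g-1}c_j(\sigma)s^j$. *)

theory Defs
  imports "HOL-Complex_Analysis.Complex_Analysis"
begin

section \<open>Distributions on the real line\<close>

definition vderiv :: "(real \<Rightarrow> complex) \<Rightarrow> real \<Rightarrow> complex" where
  "vderiv \<phi> = (\<lambda>t. vector_derivative \<phi> (at t))"

definition test_function :: "(real \<Rightarrow> complex) \<Rightarrow> bool" where
  "test_function \<phi> \<longleftrightarrow>
     (\<forall>n t. (vderiv ^^ n) \<phi> differentiable (at t)) \<and> compact (closure {t. \<phi> t \<noteq> 0})"

text \<open>
  Distributions are represented by the functionals they induce. Only the values on test functions
  are meaningful, so equality of distributions is \<^term>\<open>test_function\<close>-wise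
  equality, see \<open>distr_eq\<close> below, and not HOL equality of functionals.
\<close>
type_synonym distr = "(real \<Rightarrow> complex) \<Rightarrow> complex"

definition distr_eq :: "distr \<Rightarrow> distr \<Rightarrow> bool" where
  "distr_eq S T \<longleftrightarrow> (\<forall>\<phi>. test_function \<phi> \<longrightarrow> S \<phi> = T \<phi>)"

definition distr_of_fun :: "(real \<Rightarrow> complex) \<Rightarrow> distr" where
  "distr_of_fun u = (\<lambda>\<phi>. LBINT t. u t * \<phi> t)"

definition distr_deriv :: "distr \<Rightarrow> distr" where
  "distr_deriv T = (\<lambda>\<phi>. - T (vderiv \<phi>))"

text \<open>Product with a smooth function.\<close>
definition distr_mult :: "(real \<Rightarrow> complex) \<Rightarrow> distr \<Rightarrow> distr" where
  "distr_mult g T = (\<lambda>\<phi>. T (\<lambda>t. g t * \<phi> t))"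

text \<open>The distribution usually written \<open>T(-t)\<close>.\<close>
definition distr_reflect :: "distr \<Rightarrow> distr" where
  "distr_reflect T = (\<lambda>\<phi>. T (\<lambda>t. \<phi> (- t)))"

definition dirac :: "real \<Rightarrow> distr" where
  "dirac a = (\<lambda>\<phi>. \<phi> a)"


section \<open>Dirichlet series\<close>

text \<open>
  The terms of the series are indexed by \<open>I\<close>, which is either \<open>{1..N}\<close>
  (finitely many terms) or \<open>{1..}\<close>.
\<close>
definition dirichlet_sum :: "nat set \<Rightarrow> (nat \<Rightarrow> complex) \<Rightarrow> (nat \<Rightarrow> real) \<Rightarrow> complex \<Rightarrow> complex" where
  "dirichlet_sum I a lam s = 1 + (\<Sum>\<^sub>\<infinity>n\<in>I. a n * exp (- (of_real (lam n) * s)))"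

definition dirichlet_data :: "nat set \<Rightarrow> (nat \<Rightarrow> complex) \<Rightarrow> (nat \<Rightarrow> real) \<Rightarrow> bool" where
  "dirichlet_data I a lam \<longleftrightarrow>
     ((\<exists>N. I = {1..N}) \<or> (I = {1..} \<and> filterlim lam at_top sequentially)) \<and>
     (\<forall>n\<in>I. 0 < lam n) \<and> strict_mono_on I lam \<and>
     (\<exists>c::real. \<forall>s. Re s > c \<longrightarrow>
        (\<lambda>n. norm (a n * exp (- (of_real (lam n) * s)))) summable_on I)"

text \<open>
  \<open>F\<close> is a meromorphic function on the whole plane which coincides with the series on
  some half-plane. ``Nicely'' fixes the representative: removable singularities are removed, and
  \<open>F\<close> takes the dummy value 0 at its poles.
\<close>
definition meromorphic_extension ::
    "nat set \<Rightarrow> (nat \<Rightarrow> complex) \<Rightarrow> (nat \<Rightarrow> real) \<Rightarrow> (complex \<Rightarrow> complex) \<Rightarrow> bool" where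
  "meromorphic_extension I a lam F \<longleftrightarrow>
     F nicely_meromorphic_on UNIV \<and>
     (\<exists>c::real. \<forall>s. Re s > c \<longrightarrow> F s = dirichlet_sum I a lam s)"


section \<open>Order of a meromorphic function\<close>

text \<open>Nevanlinna's proximity, counting and characteristic functions.\<close>

definition nev_m :: "(complex \<Rightarrow> complex) \<Rightarrow> real \<Rightarrow> real" where
  "nev_m F r = (1 / (2 * pi)) *
     (LBINT \<theta>:{0..2 * pi}. ln (max 1 (norm (F (of_real r * cis \<theta>)))))"

definition nev_n :: "(complex \<Rightarrow> complex) \<Rightarrow> real \<Rightarrow> real" where
  "nev_n F t = (\<Sum>z\<in>{z. is_pole F z \<and> norm z \<le> t}. of_int (- zorder F z))"

definition nev_N :: "(complex \<Rightarrow> complex) \<Rightarrow> real \<Rightarrow> real" where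
  "nev_N F r = (LBINT t:{0<..r}. (nev_n F t - nev_n F 0) / t) + nev_n F 0 * ln r"

definition nev_T :: "(complex \<Rightarrow> complex) \<Rightarrow> real \<Rightarrow> real" where
  "nev_T F r = nev_m F r + nev_N F r"

definition meromorphic_order :: "(complex \<Rightarrow> complex) \<Rightarrow> ereal" where
  "meromorphic_order F = Limsup at_top (\<lambda>r. ereal (ln (max 1 (nev_T F r)) / ln r))"

definition finite_order :: "(complex \<Rightarrow> complex) \<Rightarrow> bool" where
  "finite_order F \<longleftrightarrow> meromorphic_order F < \<infinity>"


section \<open>Divisor, convergence exponent and Hadamard factorization\<close>

text \<open>
  For a meromorphic function which does not vanish identically, \<^term>\<open>zorder F \<rho>\<close> is the
  multiplicity of \<open>\<rho>\<close> as a zero, negative at a pole, and 0 elsewhere.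
\<close>
definition divisor :: "(complex \<Rightarrow> complex) \<Rightarrow> complex set" where
  "divisor F = {\<rho>. zorder F \<rho> \<noteq> 0}"

definition divisor_summable :: "(complex \<Rightarrow> complex) \<Rightarrow> nat \<Rightarrow> bool" where
  "divisor_summable F d \<longleftrightarrow>
     (\<lambda>\<rho>. of_int \<bar>zorder F \<rho>\<bar> / norm \<rho> ^ d :: real) summable_on (divisor F - {0})"

definition convergence_exponent :: "(complex \<Rightarrow> complex) \<Rightarrow> nat \<Rightarrow> bool" where
  "convergence_exponent F d \<longleftrightarrow>
     divisor_summable F d \<and> (\<forall>e<d. \<not> divisor_summable F e)"

text \<open>
  The product over the divisor is unconditional: it is the limit over the finite partial products.
  The constant factors are included in the partial products. Poles of \<open>F\<close> are excluded because
  neither side is defined there.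
\<close>
definition hadamard_factorization ::
    "(complex \<Rightarrow> complex) \<Rightarrow> complex \<Rightarrow> nat \<Rightarrow> complex poly \<Rightarrow> bool" where
  "hadamard_factorization F \<sigma> m Q \<longleftrightarrow>
     (\<forall>s. \<not> is_pole F s \<longrightarrow>
        ((\<lambda>X. (s - \<sigma>) powi zorder F \<sigma> * exp (poly Q s) *
                (\<Prod>\<rho>\<in>X. weierstrass_factor m ((s - \<sigma>) / (\<rho> - \<sigma>)) powi zorder F \<rho>))
          \<longlongrightarrow> F s) (finite_subsets_at_top (divisor F - {\<sigma>})))"

text \<open>
  The factorization determines \<open>Q\<close> up to an additive constant in \<open>2 \<pi> i \<int>\<close>, so the
  genus and the coefficients of \<open>Q'\<close> below do not depend on the choice.
\<close>
definition hadamard_poly :: "(complex \<Rightarrow> complex) \<Rightarrow> complex \<Rightarrow> nat \<Rightarrow> complex poly" where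
  "hadamard_poly F \<sigma> d = (SOME Q. hadamard_factorization F \<sigma> (d - 1) Q)"

definition genus :: "(complex \<Rightarrow> complex) \<Rightarrow> complex \<Rightarrow> nat \<Rightarrow> nat" where
  "genus F \<sigma> d = max (degree (hadamard_poly F \<sigma> d)) (d - 1)"

definition hadamard_coeff :: "(complex \<Rightarrow> complex) \<Rightarrow> complex \<Rightarrow> nat \<Rightarrow> nat \<Rightarrow> complex" where
  "hadamard_coeff F \<sigma> d j = coeff (- pderiv (hadamard_poly F \<sigma> d)) j"


section \<open>The Newton-Cramer distribution\<close>

definition newton_K :: "(complex \<Rightarrow> complex) \<Rightarrow> nat \<Rightarrow> complex \<Rightarrow> real \<Rightarrow> complex" where
  "newton_K F d \<sigma> t =
     (of_int (zorder F \<sigma>) * of_real t ^ d / fact d +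
      (\<Sum>\<^sub>\<infinity>\<rho>\<in>divisor F - {\<sigma>}.
         of_int (zorder F \<rho>) / (\<rho> - \<sigma>) ^ d * exp ((\<rho> - \<sigma>) * of_real t)))
     * indicator {0..} t"

definition newton_W :: "(complex \<Rightarrow> complex) \<Rightarrow> nat \<Rightarrow> complex \<Rightarrow> distr" where
  "newton_W F d \<sigma> =
     distr_mult (\<lambda>t. exp (\<sigma> * of_real t))
       ((distr_deriv ^^ d)
          (distr_of_fun (\<lambda>t. (newton_K F d \<sigma> t - newton_K F d \<sigma> 0) * indicator {0..} t)))"

definition newton_W_sym :: "(complex \<Rightarrow> complex) \<Rightarrow> nat \<Rightarrow> complex \<Rightarrow> distr" where
  "newton_W_sym F d \<sigma> = (\<lambda>\<phi>. newton_W F d \<sigma> \<phi> + distr_reflect (newton_W F d \<sigma>) \<phi>)"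


section \<open>Multi-indices and frequencies\<close>

text \<open>
  Multi-indices are integer-valued so that the negatives of those in \<open>\<Lambda>\<close> live in the same
  type; they vanish outside the index set of the series.
\<close>

definition mi_support :: "(nat \<Rightarrow> int) \<Rightarrow> nat set" where
  "mi_support k = {n. k n \<noteq> 0}"

definition mi_norm :: "(nat \<Rightarrow> int) \<Rightarrow> int" where
  "mi_norm k = (\<Sum>n\<in>mi_support k. k n)"

definition Lam :: "nat set \<Rightarrow> (nat \<Rightarrow> int) set" where
  "Lam I = {k. (\<forall>n. 0 \<le> k n) \<and> finite (mi_support k) \<and> mi_support k \<subseteq> I \<and> 1 \<le> mi_norm k}"

definition mi_neg :: "(nat \<Rightarrow> int) \<Rightarrow> (nat \<Rightarrow> int)" where
  "mi_neg k = (\<lambda>n. - k n)"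

definition mi_abs :: "nat set \<Rightarrow> (nat \<Rightarrow> int) \<Rightarrow> (nat \<Rightarrow> int)" where
  "mi_abs I k = (if k \<in> Lam I then k else mi_neg k)"

definition mi_freq :: "(nat \<Rightarrow> real) \<Rightarrow> (nat \<Rightarrow> int) \<Rightarrow> real" where
  "mi_freq lam k = (\<Sum>n\<in>mi_support k. lam n * of_int (k n))"

text \<open>
  The coefficient at \<open>k\<close> in the formal expansion of
  \<open>- log (1 + \<Sum> a\<^sub>n exp (- \<lambda>\<^sub>n s))\<close>. Distinct \<open>k\<close> may have equal frequencies, so the
  expansion as a function of \<open>s\<close> would not determine it.
\<close>
definition log_coeff :: "(nat \<Rightarrow> complex) \<Rightarrow> (nat \<Rightarrow> int) \<Rightarrow> complex" where
  "log_coeff a k =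
     (-1) ^ nat (mi_norm k) / of_int (mi_norm k) *
     (fact (nat (mi_norm k)) / (\<Prod>j\<in>mi_support k. fact (nat (k j)))) *
     (\<Prod>j\<in>mi_support k. a j ^ nat (k j))"

text \<open>
  On a test function only finitely many terms are non-zero, because only finitely many \<open>k\<close> have
  their frequency in a given compact set.
\<close>
definition frequency_distr :: "nat set \<Rightarrow> (nat \<Rightarrow> complex) \<Rightarrow> (nat \<Rightarrow> real) \<Rightarrow> distr" where
  "frequency_distr I a lam = (\<lambda>\<phi>.
     \<Sum>\<^sub>\<infinity>k\<in>Lam I \<union> mi_neg ` Lam I.
       of_real (mi_freq lam (mi_abs I k)) * log_coeff a (mi_abs I k) * dirac (mi_freq lam k) \<phi>)"

end

theory Submission
  imports Defs "HOL-Combinatorics.Multiset_Permutations"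
begin

text \<open>
  For \<open>Re s\<close> large, the logarithmic derivative of \<open>f\<close> can be computed in two ways. The Dirichlet series
  gives \<open>\<Sum>\<^bsub>k\<in>\<Lambda>\<^esub> \<langle>\<lambda>,k\<rangle> b\<^sub>k exp (-\<langle>\<lambda>,k\<rangle> s)\<close>; the Hadamard factorization gives
  \<open>Q'(s) + n\<^sub>\<sigma> / (s - \<sigma>) + \<Sum> n\<^sub>\<rho> (s - \<sigma>)\<^bsup>d-1\<^esup> / ((s - \<rho>) (\<rho> - \<sigma>)\<^bsup>d-1\<^esup>)\<close>, and all but the first term is
  \<open>(s - \<sigma>)\<^sup>d\<close> times the Laplace transform of \<open>K - K(0)\<close> at \<open>s - \<sigma>\<close>. So \<open>W\<^sub>\<sigma>(f)\<close> and
  \<open>-Q'(D) \<delta>\<^sub>0 + \<Sum> \<langle>\<lambda>,k\<rangle> b\<^sub>k \<delta>\<^bsub>\<langle>\<lambda>,k\<rangle>\<^esub>\<close> agree on the exponentials \<open>exp (-s t)\<close>. By the Weierstrass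
  theorem in the variable \<open>exp (-t)\<close>, combinations of exponentials approximate every test function on
  \<open>[0, \<infinity>)\<close>, with derivatives and with an exponential weight for which both sides are continuous. Adding
  the reflected identity cancels the odd derivatives of \<open>\<delta>\<^sub>0\<close>.

  The factorization itself exists because \<open>f\<close> divided by its canonical product is \<open>exp h\<close> with \<open>h\<close> entire,
  and on circles avoiding the divisor \<open>Re h\<close> is bounded in the mean by the proximity function of
  \<open>f\<close> plus a power of the radius, so \<open>h\<close> is a polynomial.
\<close>

section \<open>Smooth functions and exponential sums\<close>

text \<open>Two obstacles shape the proof. The derivatives of \<delta> at 0 see the end point of the
  half-line, where test functions need not vanish. So the approximation by exponentials has to hold
  up to 0, derivatives included: it is made for the highest derivative that occurs and integrated
  from infinity, which needs no condition at 0. Moreover, finite order is expressed by Nevanlinna's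
  characteristic, which controls the logarithm of the modulus in the mean over circles but not
  pointwise. Hence Fourier coefficients take the place of a pointwise Borel-Caratheodory estimate.
  The exponents in the growth bounds are not optimized, because any power of the radius suffices to
  make \<open>h\<close> a polynomial.

  The subtraction of \<open>K(0)\<close> is what makes the two logarithmic derivatives match: its
  Laplace transform is the term \<open>1 / q\<close> that lowers the order \<open>d\<close> of the
  coefficients of \<open>K\<close> to the order \<open>d - 1\<close> of the Weierstrass factors.
  Without it a further term of order \<open>d - 1\<close> supported at 0 would remain.\<close>

definition smooth_fun :: "(real \<Rightarrow> complex) \<Rightarrow> bool" where
  "smooth_fun \<phi> \<longleftrightarrow> (\<forall>n t. (vderiv ^^ n) \<phi> differentiable (at t))"

lemma vderiv_eqI:
  assumes "\<And>t. (\<phi> has_vector_derivative \<phi>' t) (at t)"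
  shows "vderiv \<phi> = \<phi>'"
  unfolding vderiv_def using vector_derivative_at[OF assms] by auto

lemma smooth_funD:
  assumes "smooth_fun \<phi>"
  shows "((vderiv ^^ n) \<phi> has_vector_derivative (vderiv ^^ Suc n) \<phi> t) (at t)"
  using assms unfolding smooth_fun_def by (simp add: vderiv_def vector_derivative_works)

lemma smooth_fun_continuous:
  assumes "smooth_fun \<phi>"
  shows "continuous_on A ((vderiv ^^ n) \<phi>)"
  using smooth_funD[OF assms] has_vector_derivative_continuous
  by (blast intro: continuous_at_imp_continuous_on)

lemma smooth_fun_vderiv:
  assumes "smooth_fun \<phi>"
  shows "smooth_fun (vderiv \<phi>)"
proof -
  have "(vderiv ^^ n) (vderiv \<phi>) = (vderiv ^^ Suc n) \<phi>" for n
    by (simp only: funpow_Suc_right o_def)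
  with assms show ?thesis unfolding smooth_fun_def by metis
qed

lemma vderiv_lincomb:
  assumes "smooth_fun \<phi>" "smooth_fun \<psi>"
  shows "(vderiv ^^ n) (\<lambda>t. a * \<phi> t + b * \<psi> t) = (\<lambda>t. a * (vderiv ^^ n) \<phi> t + b * (vderiv ^^ n) \<psi> t)"
proof (induction n)
  case (Suc n)
  have "vderiv (\<lambda>t. a * (vderiv ^^ n) \<phi> t + b * (vderiv ^^ n) \<psi> t) =
      (\<lambda>t. a * (vderiv ^^ Suc n) \<phi> t + b * (vderiv ^^ Suc n) \<psi> t)"
    by (intro vderiv_eqI has_vector_derivative_add has_vector_derivative_mult_right smooth_funD assms)
  with Suc show ?case by simp
qed simp

lemma smooth_fun_lincomb:
  assumes "smooth_fun \<phi>" "smooth_fun \<psi>"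
  shows "smooth_fun (\<lambda>t. a * \<phi> t + b * \<psi> t)"
  unfolding smooth_fun_def vderiv_lincomb[OF assms]
  using assms by (auto simp: smooth_fun_def intro!: differentiable_add differentiable_mult)

lemma vderiv_diff:
  assumes "smooth_fun \<phi>" "smooth_fun \<psi>"
  shows "(vderiv ^^ n) (\<lambda>t. \<phi> t - \<psi> t) = (\<lambda>t. (vderiv ^^ n) \<phi> t - (vderiv ^^ n) \<psi> t)"
  using vderiv_lincomb[OF assms, of n 1 "-1"] by simp

lemma has_vector_derivative_exp_of_real:
  "((\<lambda>t. exp (\<sigma> * of_real t)) has_vector_derivative \<sigma> * exp (\<sigma> * of_real t)) (at t within S)"
  for \<sigma> :: complex
proof -
  have "((\<lambda>z. exp (\<sigma> * z)) has_field_derivative \<sigma> * exp (\<sigma> * of_real t)) (at (of_real t))"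
    by (auto intro!: derivative_eq_intros)
  from has_vector_derivative_real_field[OF this] show ?thesis .
qed

lemma vderiv_exp_mult:
  assumes "smooth_fun \<phi>"
  shows "vderiv (\<lambda>t. exp (\<sigma> * of_real t) * \<phi> t) = (\<lambda>t. exp (\<sigma> * of_real t) * (\<sigma> * \<phi> t + vderiv \<phi> t))"
proof (rule vderiv_eqI)
  fix t
  have "(\<phi> has_vector_derivative vderiv \<phi> t) (at t)"
    using smooth_funD[OF assms, of 0] by simp
  then show "((\<lambda>t. exp (\<sigma> * of_real t) * \<phi> t) has_vector_derivative
      exp (\<sigma> * of_real t) * (\<sigma> * \<phi> t + vderiv \<phi> t)) (at t)"
    using has_vector_derivative_mult[OF has_vector_derivative_exp_of_real[of \<sigma> t UNIV] \<open>(\<phi> has_vector_derivative vderiv \<phi> t) (at t)\<close>]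
    by (simp add: algebra_simps)
qed

text \<open>The derivative of such a product is again a product of the exponential with a smooth
  function, so the induction on the order has to generalize over the second factor.\<close>

lemma smooth_fun_exp_mult:
  assumes "smooth_fun \<phi>"
  shows "smooth_fun (\<lambda>t. exp (\<sigma> * of_real t) * \<phi> t)"
proof -
  have "(vderiv ^^ n) (\<lambda>t. exp (\<sigma> * of_real t) * \<phi> t) differentiable (at t)"
    if "smooth_fun \<phi>" for n t \<phi>
    using that
  proof (induction n arbitrary: \<phi>)
    case 0
    have "(\<phi> has_vector_derivative vderiv \<phi> t) (at t)"
      using smooth_funD[OF 0, of 0] by simp
    from has_vector_derivative_mult[OF has_vector_derivative_exp_of_real[of \<sigma> t UNIV] this]
    show ?case using differentiableI_vector by fastforce
  next
    case (Suc n)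
    have "smooth_fun (\<lambda>t. \<sigma> * \<phi> t + 1 * vderiv \<phi> t)"
      by (intro smooth_fun_lincomb smooth_fun_vderiv Suc.prems)
    from Suc.IH[OF this] show ?case
      by (simp only: funpow_Suc_right o_def vderiv_exp_mult[OF Suc.prems] mult_1)
  qed
  with assms show ?thesis unfolding smooth_fun_def by blast
qed

text \<open>The functional \<open>poly_jet p\<close> is the distribution \<open>p(D) \<delta>\<^sub>0\<close>.\<close>

definition poly_jet :: "complex poly \<Rightarrow> (real \<Rightarrow> complex) \<Rightarrow> complex" where
  "poly_jet p \<phi> = (\<Sum>j\<le>degree p. coeff p j * (-1) ^ j * (vderiv ^^ j) \<phi> 0)"

lemma poly_jet_altdef:
  assumes "degree p \<le> n"
  shows "poly_jet p \<phi> = (\<Sum>j\<le>n. coeff p j * (-1) ^ j * (vderiv ^^ j) \<phi> 0)"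
  unfolding poly_jet_def using assms
  by (intro sum.mono_neutral_left) (auto simp: coeff_eq_0)

text \<open>Multiplying the polynomial by its variable differentiates the distribution once more,
  which moves a derivative and a sign to the test function. This recursion carries the induction in
  \<open>poly_jet_exp_shift\<close>.\<close>

lemma poly_jet_pCons: "poly_jet (pCons c p) \<phi> = c * \<phi> 0 - poly_jet p (vderiv \<phi>)"
proof -
  have "poly_jet (pCons c p) \<phi> = (\<Sum>j\<le>Suc (degree p). coeff (pCons c p) j * (-1) ^ j * (vderiv ^^ j) \<phi> 0)"
    by (rule poly_jet_altdef) (simp add: degree_pCons_le)
  also have "\<dots> = c * \<phi> 0 + (\<Sum>j\<le>degree p. - (coeff p j * (-1) ^ j * (vderiv ^^ j) (vderiv \<phi>) 0))"
    by (subst sum.atMost_Suc_shift) (simp add: funpow_Suc_right del: funpow.simps)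
  finally show ?thesis by (simp add: poly_jet_def sum_negf)
qed

lemma poly_jet_0 [simp]: "poly_jet 0 \<phi> = 0" by (simp add: poly_jet_def)

lemma poly_jet_add: "poly_jet (p + q) \<phi> = poly_jet p \<phi> + poly_jet q \<phi>"
proof -
  define n where "n = max (degree p) (degree q)"
  have "degree (p + q) \<le> n" "degree p \<le> n" "degree q \<le> n"
    unfolding n_def by (auto simp: degree_add_le_max)
  then show ?thesis
    by (simp add: poly_jet_altdef[of _ n] algebra_simps flip: sum.distrib)
qed

lemma poly_jet_smult: "poly_jet (smult c p) \<phi> = c * poly_jet p \<phi>"
  by (simp add: poly_jet_altdef[of _ "degree p"] degree_smult_le sum_distrib_left algebra_simps)

lemma poly_jet_lincomb:
  assumes "smooth_fun \<phi>" "smooth_fun \<psi>"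
  shows "poly_jet p (\<lambda>t. a * \<phi> t + b * \<psi> t) = a * poly_jet p \<phi> + b * poly_jet p \<psi>"
  unfolding poly_jet_def vderiv_lincomb[OF assms]
  by (simp add: algebra_simps sum.distrib sum_distrib_left)

text \<open>Conjugation with \<open>exp (\<sigma> t)\<close> turns \<open>D\<close> into
  \<open>D + \<sigma>\<close>. It is needed because \<open>Q\<close> is a polynomial in
  \<open>s\<close>, while the Laplace transforms are taken in the variable
  \<open>s - \<sigma>\<close>.\<close>

lemma poly_jet_exp_shift:
  assumes "smooth_fun \<phi>"
  shows "poly_jet (p \<circ>\<^sub>p [:\<sigma>, 1:]) (\<lambda>t. exp (\<sigma> * of_real t) * \<phi> t) = poly_jet p \<phi>"
  using assms
proof (induction p arbitrary: \<phi>)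
  case (pCons c p)
  let ?q = "p \<circ>\<^sub>p [:\<sigma>, 1:]" and ?e = "\<lambda>\<phi> t. exp (\<sigma> * of_real t) * \<phi> t :: complex"
  have eq: "pCons c p \<circ>\<^sub>p [:\<sigma>, 1:] = [:c:] + smult \<sigma> ?q + pCons 0 ?q"
    by (simp add: pcompose_pCons algebra_simps)
  note sm = pCons.prems smooth_fun_vderiv[OF pCons.prems]
  have d: "vderiv (?e \<phi>) = (\<lambda>t. \<sigma> * ?e \<phi> t + 1 * ?e (vderiv \<phi>) t)"
    by (subst vderiv_exp_mult[OF pCons.prems]) (simp add: algebra_simps)
  show ?case
    unfolding eq poly_jet_add poly_jet_smult poly_jet_pCons d
      poly_jet_lincomb[OF smooth_fun_exp_mult[OF sm(1)] smooth_fun_exp_mult[OF sm(2)]]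
    using pCons.IH[OF sm(2)] by simp
qed simp

lemma norm_poly_jet_le:
  assumes "\<And>i. i \<le> degree p \<Longrightarrow> norm ((vderiv ^^ i) \<phi> 0) \<le> \<eta>"
  shows "norm (poly_jet p \<phi>) \<le> (\<Sum>j\<le>degree p. norm (coeff p j)) * \<eta>"
  unfolding poly_jet_def sum_distrib_right
  by (intro sum_norm_le) (auto simp: norm_mult norm_power intro!: mult_left_mono assms)

lemma has_vector_derivative_reflect:
  assumes "smooth_fun \<phi>"
  shows "((\<lambda>t. (vderiv ^^ n) \<phi> (- t)) has_vector_derivative - (vderiv ^^ Suc n) \<phi> (- t)) (at t)"
proof -
  have "(uminus has_vector_derivative - 1) (at t)"
    by (auto intro!: derivative_eq_intros)
  from vector_diff_chain_at[OF this smooth_funD[OF assms]] show ?thesis by (simp add: o_def)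
qed

lemma vderiv_reflect:
  assumes "smooth_fun \<phi>"
  shows "(vderiv ^^ n) (\<lambda>t. \<phi> (- t)) = (\<lambda>t. (-1) ^ n * (vderiv ^^ n) \<phi> (- t))"
proof (induction n)
  case (Suc n)
  have "vderiv (\<lambda>t. (-1) ^ n * (vderiv ^^ n) \<phi> (- t)) = (\<lambda>t. (-1) ^ Suc n * (vderiv ^^ Suc n) \<phi> (- t))"
  proof (rule vderiv_eqI)
    fix t :: real
    have "((\<lambda>t. (vderiv ^^ n) \<phi> (- t)) has_vector_derivative - (vderiv ^^ Suc n) \<phi> (- t)) (at t)"
      by (rule has_vector_derivative_reflect[OF assms])
    from has_vector_derivative_mult_right[OF this, of "(-1) ^ n"]
    show "((\<lambda>t. (-1) ^ n * (vderiv ^^ n) \<phi> (- t)) has_vector_derivative (-1) ^ Suc n * (vderiv ^^ Suc n) \<phi> (- t)) (at t)"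
      by simp
  qed
  with Suc show ?case by simp
qed simp

lemma smooth_fun_reflect:
  assumes "smooth_fun \<phi>"
  shows "smooth_fun (\<lambda>t. \<phi> (- t))"
proof -
  have "(\<lambda>t. (vderiv ^^ n) \<phi> (- t)) differentiable (at t)" for n t
    using has_vector_derivative_reflect[OF assms] by (rule differentiableI_vector)
  then show ?thesis unfolding smooth_fun_def vderiv_reflect[OF assms]
    by (auto intro!: differentiable_mult)
qed

lemma distr_deriv_funpow: "(distr_deriv ^^ n) T \<phi> = (-1) ^ n * T ((vderiv ^^ n) \<phi>)"
proof (induction n arbitrary: \<phi>)
  case (Suc n)
  have "(distr_deriv ^^ Suc n) T \<phi> = - (distr_deriv ^^ n) T (vderiv \<phi>)"
    by (simp add: distr_deriv_def)
  then show ?case by (simp add: Suc funpow_swap1)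
qed simp

lemma vderiv_vanish:
  assumes "\<And>t. t > M \<Longrightarrow> \<phi> t = 0" "t > M"
  shows "(vderiv ^^ n) \<phi> t = 0"
  using assms(2)
proof (induction n arbitrary: t)
  case (Suc n)
  have "((vderiv ^^ n) \<phi> has_vector_derivative 0) (at t)"
    by (rule has_vector_derivative_transform_within_open[of "\<lambda>_. 0" 0 t "{M<..}"]) (use Suc in auto)
  then show ?case using vector_derivative_at by (simp add: vderiv_def[of "(vderiv ^^ n) \<phi>"])
qed (use assms in auto)

section \<open>Density of exponential sums on the half-line\<close>

definition exp_sum :: "nat \<Rightarrow> (nat \<Rightarrow> complex) \<Rightarrow> (nat \<Rightarrow> complex) \<Rightarrow> real \<Rightarrow> complex" where
  "exp_sum n c w t = (\<Sum>j\<le>n. c j * exp (- w j * of_real t))"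

lemma vderiv_exp_sum: "(vderiv ^^ i) (exp_sum n c w) = exp_sum n (\<lambda>j. c j * (- w j) ^ i) w"
proof (induction i)
  case (Suc i)
  have "vderiv (exp_sum n (\<lambda>j. c j * (- w j) ^ i) w) = exp_sum n (\<lambda>j. c j * (- w j) ^ Suc i) w"
  proof (rule vderiv_eqI)
    fix t
    have "((\<lambda>t. \<Sum>j\<le>n. c j * (- w j) ^ i * exp (- w j * of_real t)) has_vector_derivative
       (\<Sum>j\<le>n. c j * (- w j) ^ i * (- w j * exp (- w j * of_real t)))) (at t)"
      by (intro has_vector_derivative_sum has_vector_derivative_mult_right has_vector_derivative_exp_of_real)
    then show "(exp_sum n (\<lambda>j. c j * (- w j) ^ i) w has_vector_derivative exp_sum n (\<lambda>j. c j * (- w j) ^ Suc i) w t) (at t)"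
      unfolding exp_sum_def[abs_def] by (simp add: algebra_simps)
  qed
  with Suc show ?case by simp
qed simp

lemma smooth_fun_exp_sum: "smooth_fun (exp_sum n c w)"
  unfolding smooth_fun_def vderiv_exp_sum
  unfolding exp_sum_def[abs_def]
proof (intro allI differentiable_sum finite_atMost ballI differentiable_mult differentiable_const)
  show "(\<lambda>t. exp (- w j * complex_of_real t)) differentiable at t" for j t
    by (rule differentiableI_vector, rule has_vector_derivative_exp_of_real)
qed

text \<open>Integrating the bound on the derivative from \<open>t\<close> to infinity gives a factor
  \<open>1 / B\<close>, which \<open>B \<ge> 1\<close> absorbs. The constant \<epsilon> therefore
  survives any number of integrations.\<close>

lemma decay_from_derivative_decay:
  fixes u :: "real \<Rightarrow> complex"
  assumes u: "\<And>t. (u has_vector_derivative u' t) (at t)"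
    and bd: "\<And>t. t \<ge> 0 \<Longrightarrow> norm (u' t) \<le> \<epsilon> * exp (- B * t)"
    and lim: "(u \<longlongrightarrow> 0) at_top" and B: "B \<ge> 1" and \<epsilon>: "\<epsilon> \<ge> 0" and t: "t \<ge> 0"
  shows "norm (u t) \<le> \<epsilon> * exp (- B * t)"
proof -
  have le: "norm (u T - u t) \<le> \<epsilon> * exp (- B * t)" if T: "T > t" for T
  proof -
    have "norm (u T - u t) \<le> (- \<epsilon> / B * exp (- B * T)) - (- \<epsilon> / B * exp (- B * t))"
    proof (rule differentiable_bound_general[OF T])
      show "continuous_on {t..T} u"
        using u has_vector_derivative_continuous by (blast intro: continuous_at_imp_continuous_on)
      show "((\<lambda>t. - \<epsilon> / B * exp (- B * t)) has_vector_derivative \<epsilon> * exp (- B * x)) (at x)" for x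
        using B by (auto intro!: derivative_eq_intros simp flip: has_real_derivative_iff_has_vector_derivative)
    qed (use u bd t B in \<open>auto intro!: continuous_intros\<close>)
    also have "\<dots> \<le> \<epsilon> / B * exp (- B * t)" using \<epsilon> B by simp
    also have "\<dots> \<le> \<epsilon> * exp (- B * t)" using \<epsilon> B mult_left_mono[of 1 B \<epsilon>] by (intro mult_right_mono) (auto simp: divide_le_eq)
    finally show ?thesis .
  qed
  have "((\<lambda>T. norm (u T - u t)) \<longlongrightarrow> norm (0 - u t)) at_top"
    by (intro tendsto_intros lim)
  then have "norm (0 - u t) \<le> \<epsilon> * exp (- B * t)"
    by (rule tendsto_upperbound) (use le in \<open>auto intro: eventually_mono[OF eventually_gt_at_top[of t]]\<close>)
  then show ?thesis by simp
qed

lemma complex_Weierstrass: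
  fixes g :: "real \<Rightarrow> complex"
  assumes "continuous_on {0..1} g" "\<epsilon> > 0"
  obtains n c where "\<And>x. x \<in> {0..1} \<Longrightarrow> norm (g x - (\<Sum>j\<le>n. c j * of_real x ^ j)) \<le> \<epsilon>"
proof -
  obtain p where p: "polynomial_function p" "\<And>x. x \<in> {0..1} \<Longrightarrow> norm (g x - p x) < \<epsilon>"
    using Stone_Weierstrass_polynomial_function[OF compact_Icc assms] by blast
  have "real_polynomial_function (Re \<circ> p)" "real_polynomial_function (Im \<circ> p)"
    using p(1) bounded_linear_Re bounded_linear_Im unfolding polynomial_function_def by blast+
  then obtain a m b k where ab: "Re \<circ> p = (\<lambda>x. \<Sum>i\<le>m. a i * x ^ i)" "Im \<circ> p = (\<lambda>x. \<Sum>i\<le>k. b i * x ^ i)"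
    unfolding real_polynomial_function_iff_sum by blast
  define n where "n = max m k"
  \<comment> \<open>The two parts may have different degrees, so their coefficients are padded with
    zeros up to the larger one.\<close>
  define c where "c = (\<lambda>j. Complex (if j \<le> m then a j else 0) (if j \<le> k then b j else 0))"
  have "p x = (\<Sum>j\<le>n. c j * of_real x ^ j)" for x
  proof (rule complex_eqI)
    have "Re (p x) = (\<Sum>i\<le>m. a i * x ^ i)" using fun_cong[OF ab(1), of x] by simp
    also have "\<dots> = (\<Sum>i\<le>n. (if i \<le> m then a i else 0) * x ^ i)"
      by (intro sum.mono_neutral_cong_left) (auto simp: n_def)
    finally show "Re (p x) = Re (\<Sum>j\<le>n. c j * of_real x ^ j)"
      by (simp add: c_def flip: of_real_power)
    have "Im (p x) = (\<Sum>i\<le>k. b i * x ^ i)" using fun_cong[OF ab(2), of x] by simp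
    also have "\<dots> = (\<Sum>i\<le>n. (if i \<le> k then b i else 0) * x ^ i)"
      by (intro sum.mono_neutral_cong_left) (auto simp: n_def)
    finally show "Im (p x) = Im (\<Sum>j\<le>n. c j * of_real x ^ j)"
      by (simp add: c_def flip: of_real_power)
  qed
  with p(2) that show ?thesis by (metis less_imp_le)
qed

lemma exp_sum_tendsto_0:
  assumes "\<And>j. j \<le> n \<Longrightarrow> Re (w j) > 0"
  shows "(exp_sum n c w \<longlongrightarrow> 0) at_top"
  unfolding exp_sum_def[abs_def]
proof (intro tendsto_null_sum tendsto_mult_right_zero)
  fix j assume "j \<in> {..n}"
  then have "filterlim (\<lambda>t. - Re (w j) * t) at_bot at_top"
    using assms by (intro filterlim_tendsto_neg_mult_at_bot[OF tendsto_const _ filterlim_ident]) auto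
  then have "((\<lambda>t. exp (- Re (w j) * t)) \<longlongrightarrow> 0) at_top"
    by (rule filterlim_compose[OF exp_at_bot])
  moreover have "(\<lambda>t. norm (exp (- w j * complex_of_real t))) = (\<lambda>t. exp (- Re (w j) * t))"
    by (simp add: norm_exp_eq_Re)
  ultimately have "((\<lambda>t. norm (exp (- w j * complex_of_real t))) \<longlongrightarrow> 0) at_top"
    by simp
  then show "((\<lambda>t. exp (- w j * complex_of_real t)) \<longlongrightarrow> 0) at_top"
    by (rule tendsto_norm_zero_cancel)
qed

text \<open>In the variable \<open>x = exp (- t)\<close> the exponentials become
  \<open>x powr B * x ^ j\<close>. Approximating the \<open>N\<close>-th derivative divided by
  \<open>x powr B\<close> by polynomials on \<open>[0, 1]\<close> therefore gives the weighted
  estimate for that derivative, and the lower ones follow by integration from infinity.\<close>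

lemma exp_sum_dense:
  assumes "smooth_fun \<psi>" and van: "\<And>t. t > M \<Longrightarrow> \<psi> t = 0" and B: "B \<ge> 1" and "\<epsilon> > 0"
  obtains n c where "\<And>i t. i \<le> N \<Longrightarrow> t \<ge> 0 \<Longrightarrow>
     norm ((vderiv ^^ i) \<psi> t - (vderiv ^^ i) (exp_sum n c (\<lambda>j. of_real (B + real j))) t) \<le> \<epsilon> * exp (- B * t)"
proof -
  define \<psi>N where "\<psi>N = (vderiv ^^ N) \<psi>"
  \<comment> \<open>The value 0 for \<open>x \<le> 0\<close> is the continuous extension, since
    \<open>\<psi>\<close> vanishes for large \<open>t\<close>, that is, for \<open>x\<close> close
    to 0.\<close>
  define g where "g = (\<lambda>x. if x \<le> 0 then 0 else \<psi>N (- ln x) * of_real (x powr (- B)))"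
  \<comment> \<open>For \<open>0 < x < \<delta>\<close> one has \<open>- ln x > M\<close>, so
    \<open>g\<close> vanishes there.\<close>
  define \<delta> where "\<delta> = exp (- (max M 0) - 1)"
  have \<delta>: "\<delta> > 0" "\<delta> \<le> 1" unfolding \<delta>_def by auto
  have g0: "g x = 0" if "x < \<delta> " for x
  proof (cases "x \<le> 0")
    case False
    then have "ln x < ln \<delta>" using that \<delta> by simp
    then have "- ln x > M" unfolding \<delta>_def by auto
    then show ?thesis unfolding g_def \<psi>N_def using vderiv_vanish[of M \<psi> "- ln x" N] van by simp
  qed (auto simp: g_def)
  have cont: "isCont g x" for x
  proof (cases "x < \<delta>")
    case True
    have "eventually (\<lambda>y. g y = 0) (nhds x)"
      by (rule eventually_mono[OF eventually_nhds_in_open[of "{..<\<delta>}" x]]) (use True g0 in auto)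
    then show ?thesis by (subst isCont_cong[where g="\<lambda>_. 0"]) auto
  next
    case False
    then have x: "x > 0" using \<delta> by auto
    have "isCont \<psi>N y" for y
      unfolding \<psi>N_def using smooth_funD[OF assms(1)] has_vector_derivative_continuous by blast
    moreover have "isCont (\<lambda>x. - ln x) x" "isCont (\<lambda>x. complex_of_real (x powr (- B))) x"
      using x by (auto intro!: continuous_intros)
    ultimately have "isCont (\<lambda>x. \<psi>N (- ln x) * of_real (x powr (- B))) x"
      by (intro isCont_mult isCont_o2[of x "\<lambda>x. - ln x" \<psi>N])
    moreover have "eventually (\<lambda>y. g y = \<psi>N (- ln y) * of_real (y powr (- B))) (nhds x)"
      by (rule eventually_mono[OF eventually_nhds_in_open[of "{0<..}" x]]) (use x in \<open>auto simp: g_def\<close>)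
    ultimately show ?thesis by (subst isCont_cong)
  qed
  obtain n c where c: "\<And>x. x \<in> {0..1} \<Longrightarrow> norm (g x - (\<Sum>j\<le>n. c j * of_real x ^ j)) \<le> \<epsilon>"
    using complex_Weierstrass[OF continuous_at_imp_continuous_on \<open>\<epsilon> > 0\<close>, of g] cont by metis
  define w where "w = (\<lambda>j::nat. complex_of_real (B + real j))"
  have w: "w j \<noteq> 0" "Re (w j) > 0" for j
    using B unfolding w_def by (auto simp: complex_eq_iff)
  \<comment> \<open>The division by \<open>(- w j) ^ N\<close> undoes \<open>N\<close>
    differentiations; \<open>B \<ge> 1\<close> keeps all \<open>w j\<close> away from 0.\<close>
  define E where "E = exp_sum n (\<lambda>j. c j / (- w j) ^ N) w"
  have EN: "(vderiv ^^ N) E t = of_real (exp (- B * t)) * (\<Sum>j\<le>n. c j * of_real (exp (- t)) ^ j)" for t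
    unfolding E_def vderiv_exp_sum unfolding exp_sum_def sum_distrib_left
  proof (rule sum.cong)
    fix j assume "j \<in> {..n}"
    have "exp (- w j * of_real t) = of_real (exp (- B * t)) * of_real (exp (- t)) ^ j"
      by (simp add: w_def exp_of_real[symmetric] exp_of_nat_mult[symmetric] exp_add[symmetric] algebra_simps)
    then show "c j / (- w j) ^ N * (- w j) ^ N * exp (- w j * complex_of_real t) =
         complex_of_real (exp (- B * t)) * (c j * complex_of_real (exp (- t)) ^ j)"
      using w(1)[of j] by simp
  qed simp
  have smE: "smooth_fun E" unfolding E_def by (rule smooth_fun_exp_sum)
  have top: "norm ((vderiv ^^ N) \<psi> t - (vderiv ^^ N) E t) \<le> \<epsilon> * exp (- B * t)" if "t \<ge> 0" for t
  proof -
    have x: "exp (- t) \<in> {0..1}" using that by auto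
    have "g (exp (- t)) = \<psi>N t * of_real (exp (B * t))"
      unfolding g_def by (simp add: powr_def)
    then have "\<psi>N t = of_real (exp (- B * t)) * g (exp (- t))"
      by (simp add: exp_minus)
    then have "(vderiv ^^ N) \<psi> t - (vderiv ^^ N) E t =
        of_real (exp (- B * t)) * (g (exp (- t)) - (\<Sum>j\<le>n. c j * of_real (exp (- t)) ^ j))"
      unfolding EN \<psi>N_def[symmetric] by (simp add: algebra_simps)
    then show ?thesis using c[OF x] by (simp add: norm_mult mult.commute)
  qed
  \<comment> \<open>The induction descends from \<open>N\<close>; each step integrates once, and
    both functions tend to 0 at infinity, so no constant of integration appears.\<close>
  have "\<forall>t\<ge>0. norm ((vderiv ^^ i) \<psi> t - (vderiv ^^ i) E t) \<le> \<epsilon> * exp (- B * t)" if "i \<le> N" for i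
    using that
  proof (induction rule: inc_induct)
    case (step i)
    show ?case
    proof (intro allI impI decay_from_derivative_decay[where u="\<lambda>t. (vderiv ^^ i) \<psi> t - (vderiv ^^ i) E t"
            and u'="\<lambda>t. (vderiv ^^ Suc i) \<psi> t - (vderiv ^^ Suc i) E t"])
      show "((\<lambda>t. (vderiv ^^ i) \<psi> t - (vderiv ^^ i) E t) has_vector_derivative
            (vderiv ^^ Suc i) \<psi> t - (vderiv ^^ Suc i) E t) (at t)" for t
        by (intro has_vector_derivative_diff smooth_funD assms smE)
      have "eventually (\<lambda>t. (vderiv ^^ i) \<psi> t = 0) at_top"
        by (rule eventually_mono[OF eventually_gt_at_top[of M]]) (rule vderiv_vanish[OF van])
      then have "((vderiv ^^ i) \<psi> \<longlongrightarrow> 0) at_top" by (rule tendsto_eventually)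
      moreover have "((vderiv ^^ i) E \<longlongrightarrow> 0) at_top"
        unfolding E_def vderiv_exp_sum using w by (intro exp_sum_tendsto_0) auto
      ultimately show "((\<lambda>t. (vderiv ^^ i) \<psi> t - (vderiv ^^ i) E t) \<longlongrightarrow> 0) at_top"
        using tendsto_diff by fastforce
    qed (use step B \<open>\<epsilon> > 0\<close> in auto)
  qed (use top in auto)
  then show ?thesis using that[of n "\<lambda>j. c j / (- w j) ^ N"] unfolding E_def w_def by blast
qed


section \<open>Laplace transforms\<close>

lemma set_integrable_exp_decay:
  assumes "r > 0"
  shows "set_integrable lborel {0..} (\<lambda>t::real. exp (- (r * t)))"
    and "(LBINT t:{0..}. exp (- (r * t))) = 1 / r"
proof -
  have "((\<lambda>t. exp (- r * t)) has_integral exp (- r * 0) / r) {0..}"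
    by (rule has_integral_exp_minus_to_infinity[OF assms])
  then have hi: "((\<lambda>t. exp (- (r * t))) has_integral 1 / r) {0..}" by simp
  then have "(\<lambda>t. exp (- (r * t))) absolutely_integrable_on {0..}"
    by (intro nonnegative_absolutely_integrable_1) auto
  then show si: "set_integrable lborel {0..} (\<lambda>t::real. exp (- (r * t)))"
    unfolding set_integrable_def by (subst (asm) integrable_completion) (auto intro!: borel_measurable_indicator measurable_If)
  show "(LBINT t:{0..}. exp (- (r * t))) = 1 / r"
    using set_borel_integral_eq_integral(2)[OF si] integral_unique[OF hi] by simp
qed

lemma exp_decay_integral:
  fixes f :: "real \<Rightarrow> complex"
  assumes cont: "continuous_on {0..} f" and r: "r > 0" and bd: "\<And>t. t \<ge> 0 \<Longrightarrow> norm (f t) \<le> C * exp (- (r * t))"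
  shows "set_integrable lborel {0..} f" and "norm (LBINT t:{0..}. f t) \<le> C / r"
proof -
  have ci: "set_integrable lborel {0..} (\<lambda>t. C * exp (- (r * t)))"
    by (rule set_integrable_mult_right) (use set_integrable_exp_decay[OF r] in simp)
  show si: "set_integrable lborel {0..} f"
  proof (rule set_integrable_bound[OF ci])
    show "set_borel_measurable lborel {0..} f"
      using set_measurable_continuous_on[OF _ cont] unfolding set_borel_measurable_def by simp
    have "C * exp (- (r * t)) \<le> norm (C * exp (- (r * t)))" for t by simp
    then show "AE x in lborel. x \<in> {0..} \<longrightarrow> norm (f x) \<le> norm (C * exp (- (r * x)))"
      using bd by (intro AE_I2 impI) (meson atLeast_iff order_trans)
  qed
  have "norm (LBINT t:{0..}. f t) \<le> (LBINT t:{0..}. norm (f t))"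
    by (rule set_integral_norm_bound[OF si])
  also have "\<dots> \<le> (LBINT t:{0..}. C * exp (- (r * t)))"
    by (rule set_integral_mono[OF set_integrable_norm[OF si] ci]) (use bd in auto)
  also have "\<dots> = C / r" using set_integrable_exp_decay(2)[OF r] by simp
  finally show "norm (LBINT t:{0..}. f t) \<le> C / r" .
qed

lemma integral_FTC_at_top:
  fixes A :: "real \<Rightarrow> complex"
  assumes d: "\<And>t. (A has_vector_derivative f t) (at t)" and f: "continuous_on UNIV f"
    and si: "set_integrable lborel {0..} f" and lim: "(A \<longlongrightarrow> 0) at_top"
  shows "(LBINT t:{0..}. f t) = - A 0"
proof -
  have "((\<lambda>b. LBINT t:{0..b}. f t) \<longlongrightarrow> (LBINT t:{0..}. f t)) at_top"
    by (rule tendsto_set_lebesgue_integral_at_top[OF _ si]) auto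
  moreover have "((\<lambda>b. LBINT t:{0..b}. f t) \<longlongrightarrow> 0 - A 0) at_top"
  proof (rule Lim_transform_eventually)
    show "((\<lambda>b. A b - A 0) \<longlongrightarrow> 0 - A 0) at_top" by (intro tendsto_intros lim)
    show "eventually (\<lambda>b. A b - A 0 = (LBINT t:{0..b}. f t)) at_top"
      using eventually_ge_at_top[of 0]
    proof eventually_elim
      case (elim b)
      have "integral\<^sup>L lborel (\<lambda>x. indicator {0..b} x *\<^sub>R f x) = A b - A 0"
        by (rule integral_FTC_atLeastAtMost[OF elim])
           (use d f in \<open>auto intro: has_vector_derivative_at_within continuous_on_subset\<close>)
      then show ?case by (simp add: set_lebesgue_integral_def)
    qed
  qed
  ultimately show ?thesis using tendsto_unique trivial_limit_at_top_linorder by fastforce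
qed

lemma power_le_exp:
  fixes t :: real
  assumes "t \<ge> 0"
  shows "t ^ n / fact n \<le> exp t"
proof -
  have "(\<Sum>k\<in>{n}. t ^ k /\<^sub>R fact k) \<le> (\<Sum>k. t ^ k /\<^sub>R fact k)"
    by (rule sum_le_suminf[OF summable_exp_generic]) (use assms in auto)
  then show ?thesis by (simp add: exp_def field_simps)
qed

lemma set_integral_sum:
  fixes f :: "'a \<Rightarrow> 'b \<Rightarrow> complex"
  assumes "finite X" "\<And>x. x \<in> X \<Longrightarrow> set_integrable M A (f x)"
  shows "set_integrable M A (\<lambda>t. \<Sum>x\<in>X. f x t)" (is ?A)
    and "(LINT t:A|M. \<Sum>x\<in>X. f x t) = (\<Sum>x\<in>X. LINT t:A|M. f x t)" (is ?B)
proof -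
  have "?A \<and> ?B"
    using assms
  proof (induction rule: finite_induct)
    case empty
    then show ?case by (simp add: set_integrable_def set_lebesgue_integral_def)
  next
    case (insert x X)
    then show ?case by (simp add: set_integral_add)
  qed
  then show ?A ?B by auto
qed

lemma exp_decay_tendsto_0:
  fixes f :: "real \<Rightarrow> complex"
  assumes "\<And>t. t \<ge> 0 \<Longrightarrow> norm (f t) \<le> C * exp (- (r * t))" "r > 0"
  shows "(f \<longlongrightarrow> 0) at_top"
proof (rule Lim_null_comparison)
  show "eventually (\<lambda>t. norm (f t) \<le> C * exp (- (r * t))) at_top"
    by (rule eventually_mono[OF eventually_ge_at_top[of 0]]) (rule assms(1))
  have "filterlim (\<lambda>t. - r * t) at_bot at_top"
    using assms by (intro filterlim_tendsto_neg_mult_at_bot[OF tendsto_const _ filterlim_ident]) auto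
  then have "((\<lambda>t. exp (- r * t)) \<longlongrightarrow> 0) at_top"
    by (rule filterlim_compose[OF exp_at_bot])
  then show "((\<lambda>t. C * exp (- (r * t))) \<longlongrightarrow> 0) at_top"
    by (intro tendsto_mult_right_zero) simp
qed

text \<open>Half of the decay rate pays for the power of \<open>t\<close>, by
  \<open>power_le_exp\<close> at \<open>Re q / 2 * t\<close>; the other half is left for
  integrability.\<close>

lemma norm_power_exp_le:
  assumes "Re q > 0" "t \<ge> 0"
  shows "norm (of_real t ^ n / fact n * exp (- (q * of_real t))) \<le> (2 / Re q) ^ n * exp (- (Re q / 2 * t))"
proof -
  define r where "r = Re q"
  have r: "r > 0" using assms by (simp add: r_def)
  have "t ^ n / fact n = (2 / r) ^ n * ((r / 2 * t) ^ n / fact n)"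
    using r by (simp flip: power_mult_distrib)
  also have "\<dots> \<le> (2 / r) ^ n * exp (r / 2 * t)"
    using r assms by (intro mult_left_mono power_le_exp) auto
  finally have "t ^ n / fact n * exp (- (r * t)) \<le> (2 / r) ^ n * exp (r / 2 * t) * exp (- (r * t))"
    by (rule mult_right_mono) auto
  also have "\<dots> = (2 / r) ^ n * exp (- (r / 2 * t))"
    by (simp add: mult.assoc field_simps flip: exp_add)
  finally show ?thesis using assms(2)
    by (simp add: norm_mult norm_divide norm_power norm_exp_eq_Re r_def)
qed

lemma continuous_on_power_exp:
  "continuous_on A (\<lambda>t. of_real t ^ n / fact n * exp (- (q * of_real t)) :: complex)"
  by (intro continuous_intros) auto

lemma set_integrable_power_exp:
  assumes "Re q > 0"
  shows "set_integrable lborel {0..} (\<lambda>t. of_real t ^ n / fact n * exp (- (q * of_real t)))"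
  by (rule exp_decay_integral(1)[OF continuous_on_power_exp _ norm_power_exp_le]) (use assms in auto)

lemma laplace_power:
  assumes "Re q > 0"
  shows "(LBINT t:{0..}. of_real t ^ n / fact n * exp (- (q * of_real t))) = 1 / q ^ Suc n"
proof -
  have q: "q \<noteq> 0" using assms by auto
  have d: "((\<lambda>t. exp (- (q * of_real t))) has_vector_derivative - q * exp (- (q * of_real t))) (at t)" for t
    using has_vector_derivative_exp_of_real[of "- q" t UNIV] by simp
  have lim: "((\<lambda>t. of_real t ^ n / fact n * exp (- (q * of_real t))) \<longlongrightarrow> 0) at_top" for n
    by (rule exp_decay_tendsto_0[OF norm_power_exp_le]) (use assms in auto)
  show ?thesis
  proof (induction n)
    case 0
    have "(LBINT t:{0..}. - q * (of_real t ^ 0 / fact 0 * exp (- (q * of_real t)))) = - exp (- (q * of_real 0))"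
    proof (rule integral_FTC_at_top)
      show "((\<lambda>t. exp (- (q * of_real t))) has_vector_derivative - q * (of_real t ^ 0 / fact 0 * exp (- (q * of_real t)))) (at t)" for t
        using d[of t] by simp
      show "set_integrable lborel {0..} (\<lambda>t. - q * (of_real t ^ 0 / fact 0 * exp (- (q * of_real t))))"
        by (intro set_integrable_mult_right set_integrable_power_exp assms)
    qed (use lim[of 0] in \<open>auto intro!: continuous_intros\<close>)
    then have "- q * (LBINT t:{0..}. of_real t ^ 0 / fact 0 * exp (- (q * of_real t))) = - exp (- (q * of_real 0))"
      by (simp only: set_integral_mult_right)
    then show ?case using q by (simp add: field_simps)
  next
    case (Suc n)
    let ?p = "\<lambda>n t. of_real t ^ n / fact n * exp (- (q * of_real t))"
    \<comment> \<open>Integration by parts: the integrand is the derivative of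
      \<open>?p (Suc n)\<close>, which vanishes both at 0 and at infinity.\<close>
    have "(LBINT t:{0..}. ?p n t - q * ?p (Suc n) t) = - ?p (Suc n) 0"
    proof (rule integral_FTC_at_top)
      show "((\<lambda>t. ?p (Suc n) t) has_vector_derivative ?p n t - q * ?p (Suc n) t) (at t)" for t
      proof -
        have "((\<lambda>z. z ^ Suc n / fact (Suc n) :: complex) has_field_derivative of_real t ^ n / fact n) (at (of_real t))"
        proof -
          have "((\<lambda>z. z ^ Suc n / fact (Suc n) :: complex) has_field_derivative
              of_nat (Suc n) * of_real t ^ n / fact (Suc n)) (at (of_real t))"
            using DERIV_cdivide[OF DERIV_power[OF DERIV_ident, where n="Suc n"], where c="fact (Suc n)"]
            by (simp del: fact_Suc power_Suc)
          moreover have "of_nat (Suc n) * of_real t ^ n / fact (Suc n) = (of_real t ^ n / fact n :: complex)"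
            by (simp add: fact_Suc del: of_nat_Suc)
          ultimately show ?thesis by simp
        qed
        from has_vector_derivative_mult[OF has_vector_derivative_real_field[OF this] d[of t]]
        show ?thesis by (simp add: algebra_simps)
      qed
      show "set_integrable lborel {0..} (\<lambda>t. ?p n t - q * ?p (Suc n) t)"
        by (intro set_integral_diff set_integrable_mult_right set_integrable_power_exp assms)
      show "continuous_on UNIV (\<lambda>t. ?p n t - q * ?p (Suc n) t)"
        by (intro continuous_on_diff continuous_on_mult_left continuous_on_power_exp)
    qed (rule lim)
    also have "- ?p (Suc n) 0 = 0" by simp
    finally have "(LBINT t:{0..}. ?p n t) - q * (LBINT t:{0..}. ?p (Suc n) t) = 0"
      unfolding set_integral_mult_right[symmetric]
      by (subst set_integral_diff(2)[symmetric])
         (simp_all only: set_integrable_mult_right set_integrable_power_exp assms)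
    moreover have "y = 1 / q ^ Suc (Suc n)" if "x - q * y = 0" "x = 1 / q ^ Suc n" for x y
      using that q by (simp add: field_simps)
    ultimately show ?case using Suc by blast
  qed
qed

section \<open>Laplace transform of a series of exponentials\<close>

context
  fixes Z :: "complex set" and b w :: "complex \<Rightarrow> complex" and M :: real
  assumes b: "(\<lambda>\<rho>. norm (b \<rho>)) summable_on Z"
    and w: "\<And>\<rho>. \<rho> \<in> Z \<Longrightarrow> Re (w \<rho>) \<le> M" and M: "M \<ge> 0"
begin

text \<open>This is \<open>K - K(0)\<close> without its polynomial term, for
  \<open>w \<rho> = \<rho> - \<sigma>\<close> and
  \<open>b \<rho> = n\<^sub>\<rho> / (\<rho> - \<sigma>) ^ d\<close>. A bound \<open>M\<close> for
  the real parts exists because a Dirichlet series with constant term 1 has no zeros far to the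
  right.\<close>

definition exp_series :: "real \<Rightarrow> complex" where
  "exp_series t = (\<Sum>\<^sub>\<infinity>\<rho>\<in>Z. b \<rho> * (exp (w \<rho> * of_real t) - 1))"

lemma norm_exp_minus_1_le:
  assumes "\<rho> \<in> Z" "t \<ge> 0"
  shows "norm (exp (w \<rho> * of_real t) - 1) \<le> 2 * exp (M * t)"
proof -
  have "norm (exp (w \<rho> * of_real t) - 1) \<le> norm (exp (w \<rho> * of_real t)) + norm (1 :: complex)"
    by (rule norm_triangle_ineq4)
  also have "norm (exp (w \<rho> * of_real t)) \<le> exp (M * t)"
    using mult_right_mono[OF w[OF assms(1)] assms(2)] by (simp add: norm_exp_eq_Re)
  also have "norm (1 :: complex) \<le> exp (M * t)" using M assms by simp
  finally show ?thesis by simp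
qed

text \<open>The terms may grow like \<open>exp (M * t)\<close>; with the weight
  \<open>exp (- (M * t))\<close> the M-test works on the whole half-line at once.\<close>

lemma uniform_limit_exp_series:
  "uniform_limit {0..} (\<lambda>X t. \<Sum>\<rho>\<in>X. of_real (exp (- (M * t))) * (b \<rho> * (exp (w \<rho> * of_real t) - 1)))
     (\<lambda>t. of_real (exp (- (M * t))) * exp_series t) (finite_subsets_at_top Z)"
proof -
  have le: "norm (of_real (exp (- (M * t))) * (b \<rho> * (exp (w \<rho> * of_real t) - 1))) \<le> 2 * norm (b \<rho>)"
    if "\<rho> \<in> Z" "t \<in> {0..}" for \<rho> t
  proof -
    have "norm (of_real (exp (- (M * t))) * (b \<rho> * (exp (w \<rho> * of_real t) - 1))) \<le> exp (- (M * t)) * (norm (b \<rho>) * (2 * exp (M * t)))"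
      unfolding norm_mult using norm_exp_minus_1_le[OF that(1), of t] that by (intro mult_mono) auto
    then show ?thesis by (simp add: exp_minus field_simps)
  qed
  have "uniform_limit {0..} (\<lambda>X t. \<Sum>\<rho>\<in>X. of_real (exp (- (M * t))) * (b \<rho> * (exp (w \<rho> * of_real t) - 1)))
     (\<lambda>t. \<Sum>\<^sub>\<infinity>\<rho>\<in>Z. of_real (exp (- (M * t))) * (b \<rho> * (exp (w \<rho> * of_real t) - 1))) (finite_subsets_at_top Z)"
    by (rule Weierstrass_m_test_general[OF le summable_on_cmult_right[OF b]])
  then show ?thesis
    unfolding exp_series_def by (simp add: infsum_cmult_right')
qed

lemma continuous_exp_series: "continuous_on {0..} exp_series"
proof -
  have "continuous_on {0..} (\<lambda>t. of_real (exp (- (M * t))) * exp_series t)"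
    by (rule uniform_limit_theorem[OF _ uniform_limit_exp_series])
       (auto intro!: always_eventually continuous_intros)
  then have "continuous_on {0..} (\<lambda>t. of_real (exp (M * t)) * (of_real (exp (- (M * t))) * exp_series t))"
    by (rule continuous_on_mult[rotated]) (intro continuous_intros)
  moreover have "(\<lambda>t. of_real (exp (M * t)) * (of_real (exp (- (M * t))) * exp_series t)) = exp_series"
    by (auto simp: exp_minus)
  ultimately show ?thesis by (simp only:)
qed

lemma has_sum_exp_series:
  assumes "t \<ge> 0"
  shows "((\<lambda>\<rho>. b \<rho> * (exp (w \<rho> * of_real t) - 1)) has_sum exp_series t) Z"
  unfolding exp_series_def
proof (rule has_sum_infsum, rule abs_summable_summable, rule summable_on_comparison_test)
  show "(\<lambda>\<rho>. norm (b \<rho>) * (2 * exp (M * t))) summable_on Z" by (rule summable_on_cmult_left[OF b])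
qed (use norm_exp_minus_1_le assms in \<open>auto simp: norm_mult intro!: mult_left_mono\<close>)

lemma norm_exp_series_le:
  assumes "t \<ge> 0"
  shows "norm (exp_series t) \<le> infsum (\<lambda>\<rho>. norm (b \<rho>)) Z * 2 * exp (M * t)"
proof -
  have "((\<lambda>\<rho>. norm (b \<rho>) * (2 * exp (M * t))) has_sum (infsum (\<lambda>\<rho>. norm (b \<rho>)) Z * (2 * exp (M * t)))) Z"
    by (intro has_sum_cmult_left has_sum_infsum b)
  from norm_infsum_le[OF has_sum_exp_series[OF assms] this] show ?thesis
    using norm_exp_minus_1_le assms by (auto simp: norm_mult mult_left_mono mult.assoc)
qed

text \<open>Sum and integral are interchanged along the net of finite subsets by means of the
  weighted uniform limit: an error of at most \<open>e * exp (M * t)\<close> contributes at most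
  \<open>e / (Re q - M)\<close> to the Laplace integral.\<close>

lemma laplace_exp_series:
  assumes q: "Re q > M"
  shows "((\<lambda>\<rho>. b \<rho> * (1 / (q - w \<rho>) - 1 / q)) has_sum (LBINT t:{0..}. exp_series t * exp (- (q * of_real t)))) Z"
  unfolding has_sum_def
proof (rule tendstoI)
  fix \<epsilon> :: real assume \<epsilon>: "\<epsilon> > 0"
  define r where "r = Re q - M"
  have r: "r > 0" using q by (simp add: r_def)
  define e where "e = \<epsilon> * r / 2"
  have e: "e > 0" unfolding e_def using r \<epsilon> by simp
  have iU: "set_integrable lborel {0..} (\<lambda>t. exp_series t * exp (- (q * of_real t)))"
  proof (rule exp_decay_integral(1)[OF _ r])
    show "continuous_on {0..} (\<lambda>t. exp_series t * exp (- (q * of_real t)))"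
      by (intro continuous_intros continuous_exp_series)
    show "norm (exp_series t * exp (- (q * of_real t))) \<le> infsum (\<lambda>\<rho>. norm (b \<rho>)) Z * 2 * exp (- (r * t))" if "t \<ge> 0" for t
    proof -
      have "norm (exp_series t * exp (- (q * of_real t))) \<le> infsum (\<lambda>\<rho>. norm (b \<rho>)) Z * 2 * exp (M * t) * exp (- (Re q * t))"
        unfolding norm_mult using norm_exp_series_le[OF that]
        by (intro mult_mono) (auto simp: norm_exp_eq_Re intro!: infsum_nonneg mult_nonneg_nonneg)
      moreover have "exp (- (r * t)) = exp (M * t) * exp (- (Re q * t))"
        by (simp add: r_def algebra_simps flip: exp_add)
      ultimately show ?thesis by (simp only: mult.assoc)
    qed
  qed
  have "eventually (\<lambda>X. finite X \<and> X \<subseteq> Z) (finite_subsets_at_top Z)"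
    by (rule eventually_finite_subsets_at_top_weakI) auto
  moreover have "eventually (\<lambda>X. \<forall>t\<in>{0..}. dist (\<Sum>\<rho>\<in>X. of_real (exp (- (M * t))) * (b \<rho> * (exp (w \<rho> * of_real t) - 1)))
     (of_real (exp (- (M * t))) * exp_series t) < e) (finite_subsets_at_top Z)"
    using uniform_limit_exp_series e by (rule uniform_limitD)
  ultimately show "eventually (\<lambda>X. dist (\<Sum>\<rho>\<in>X. b \<rho> * (1 / (q - w \<rho>) - 1 / q)) (LBINT t:{0..}. exp_series t * exp (- (q * of_real t))) < \<epsilon>) (finite_subsets_at_top Z)"
  proof eventually_elim
    case (elim X)
    let ?S = "\<lambda>t. \<Sum>\<rho>\<in>X. b \<rho> * (exp (w \<rho> * of_real t) - 1)"
    have l: "set_integrable lborel {0..} (\<lambda>t. exp (- (z * of_real t)))"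
            "(LBINT t:{0..}. exp (- (z * of_real t))) = 1 / z" if "Re z > 0" for z
      using set_integrable_power_exp[OF that, of 0] laplace_power[OF that, of 0] by simp_all
    have eq: "b \<rho> * (exp (w \<rho> * of_real t) - 1) * exp (- (q * of_real t)) =
        b \<rho> * (exp (- ((q - w \<rho>) * of_real t)) - exp (- (q * of_real t)))" for \<rho> t
      by (simp add: algebra_simps flip: exp_add)
    have qp: "Re q > 0" using q M by simp
    have qw: "Re (q - w \<rho>) > 0" if "\<rho> \<in> X" for \<rho> using w[of \<rho>] elim(1) that q by auto
    have int1: "set_integrable lborel {0..} (\<lambda>t. b \<rho> * (exp (w \<rho> * of_real t) - 1) * exp (- (q * of_real t)))"
       "(LBINT t:{0..}. b \<rho> * (exp (w \<rho> * of_real t) - 1) * exp (- (q * of_real t))) = b \<rho> * (1 / (q - w \<rho>) - 1 / q)"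
      if "\<rho> \<in> X" for \<rho>
      unfolding eq using l[OF qw[OF that]] l[OF qp]
      by (auto intro!: set_integrable_mult_right set_integral_diff simp: set_integral_diff)
    have iS: "set_integrable lborel {0..} (\<lambda>t. ?S t * exp (- (q * of_real t)))"
      unfolding sum_distrib_right using elim(1) int1(1) by (intro set_integral_sum(1)) auto
    have "(LBINT t:{0..}. ?S t * exp (- (q * of_real t))) = (\<Sum>\<rho>\<in>X. b \<rho> * (1 / (q - w \<rho>) - 1 / q))"
      unfolding sum_distrib_right using elim(1) int1 by (subst set_integral_sum(2)) auto
    then have "(\<Sum>\<rho>\<in>X. b \<rho> * (1 / (q - w \<rho>) - 1 / q)) - (LBINT t:{0..}. exp_series t * exp (- (q * of_real t)))
      = (LBINT t:{0..}. ?S t * exp (- (q * of_real t)) - exp_series t * exp (- (q * of_real t)))"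
      using set_integral_diff(2)[OF iS iU] by simp
    also have "norm \<dots> \<le> e / r"
    proof (rule exp_decay_integral(2)[OF _ r])
      show "continuous_on {0..} (\<lambda>t. ?S t * exp (- (q * of_real t)) - exp_series t * exp (- (q * of_real t)))"
        by (intro continuous_intros continuous_exp_series)
      fix t :: real assume t: "t \<ge> 0"
      have "norm (of_real (exp (- (M * t))) * (?S t - exp_series t)) \<le> e"
        using elim(2) t by (simp add: dist_norm sum_distrib_left right_diff_distrib less_imp_le)
      then have "exp (- (M * t)) * norm (?S t - exp_series t) \<le> e" by (simp add: norm_mult)
      then have "norm (?S t - exp_series t) \<le> e * exp (M * t)"
        by (simp add: exp_minus field_simps)
      then have "norm (?S t - exp_series t) * exp (- (Re q * t)) \<le> e * exp (M * t) * exp (- (Re q * t))"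
        by (rule mult_right_mono) auto
      then show "norm (?S t * exp (- (q * of_real t)) - exp_series t * exp (- (q * of_real t))) \<le> e * exp (- (r * t))"
      proof -
        have "exp (- (r * t)) = exp (M * t) * exp (- (Re q * t))"
          by (simp add: r_def algebra_simps flip: exp_add)
        moreover have "norm (?S t * exp (- (q * of_real t)) - exp_series t * exp (- (q * of_real t)))
            = norm (?S t - exp_series t) * exp (- (Re q * t))"
          by (simp only: left_diff_distrib[symmetric] norm_mult norm_exp_eq_Re) simp
        ultimately show ?thesis
          using \<open>norm (?S t - exp_series t) * exp (- (Re q * t)) \<le> e * exp (M * t) * exp (- (Re q * t))\<close>
          by (simp only: mult.assoc)
      qed
    qed
    also have "e / r < \<epsilon>" using r \<epsilon> by (simp add: e_def)
    finally show ?case by (simp add: dist_norm)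
  qed
qed

end


section \<open>Sums over words and multi-indices\<close>

lemma has_sum_times:
  fixes f :: "'a \<Rightarrow> 'c :: {real_normed_field, banach}"
  assumes f: "(f has_sum a) A" "(\<lambda>x. norm (f x)) summable_on A"
    and g: "(g has_sum b) B" "(\<lambda>x. norm (g x)) summable_on B"
  shows "((\<lambda>(x, y). f x * g y) has_sum (a * b)) (A \<times> B)"
    and "(\<lambda>z. norm (case z of (x, y) \<Rightarrow> f x * g y)) summable_on (A \<times> B)"
proof -
  show s: "(\<lambda>z. norm (case z of (x, y) \<Rightarrow> f x * g y)) summable_on (A \<times> B)"
  proof (rule summable_on_SigmaI)
    show "((\<lambda>y. norm (case (x, y) of (x, y) \<Rightarrow> f x * g y)) has_sum (norm (f x) * infsum (\<lambda>y. norm (g y)) B)) B" for x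
      using has_sum_cmult_right[OF has_sum_infsum[OF g(2)], of "norm (f x)"] by (simp add: norm_mult)
    show "(\<lambda>x. norm (f x) * infsum (\<lambda>y. norm (g y)) B) summable_on A"
      by (rule summable_on_cmult_left[OF f(2)])
  qed auto
  show "((\<lambda>(x, y). f x * g y) has_sum (a * b)) (A \<times> B)"
  proof (rule has_sum_SigmaI)
    show "((\<lambda>y. case (x, y) of (x, y) \<Rightarrow> f x * g y) has_sum (f x * b)) B" for x
      using has_sum_cmult_right[OF g(1)] by simp
    show "((\<lambda>x. f x * b) has_sum (a * b)) A" by (rule has_sum_cmult_left[OF f(1)])
    show "(\<lambda>(x, y). f x * g y) summable_on A \<times> B" by (rule abs_summable_summable[OF s])
  qed
qed

text \<open>Multi-indices are obtained from words by forgetting the order of the letters; the multinomial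
  coefficient in \<open>log_coeff\<close> counts the words over one multi-index.\<close>

definition words :: "'a set \<Rightarrow> nat \<Rightarrow> 'a list set" where
  "words I n = {xs. set xs \<subseteq> I \<and> length xs = n}"

lemma words_0 [simp]: "words I 0 = {[]}"
  by (auto simp: words_def)

lemma bij_betw_words_Suc: "bij_betw (\<lambda>(x, xs). x # xs) (I \<times> words I n) (words I (Suc n))"
  by (rule bij_betwI[where g="\<lambda>ys. (hd ys, tl ys)"])
     (auto simp: words_def length_Suc_conv)

lemma has_sum_words_prod:
  fixes u :: "'a \<Rightarrow> 'c :: {real_normed_field, banach}"
  assumes u: "(u has_sum X) I" "(\<lambda>j. norm (u j)) summable_on I"
  shows "((\<lambda>xs. prod_list (map u xs)) has_sum X ^ n) (words I n)
       \<and> (\<lambda>xs. norm (prod_list (map u xs))) summable_on words I n"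
proof (induction n)
  case (Suc n)
  let ?P = "\<lambda>xs. prod_list (map u xs)"
  have eq: "?P (case z of (x, xs) \<Rightarrow> x # xs) = (case z of (x, xs) \<Rightarrow> u x * ?P xs)" for z
    by (cases z) simp
  have "(?P has_sum X ^ Suc n) (words I (Suc n))"
    by (subst has_sum_reindex_bij_betw[OF bij_betw_words_Suc, symmetric])
       (use has_sum_times(1)[OF u Suc[THEN conjunct1] Suc[THEN conjunct2]] in \<open>simp add: eq\<close>)
  moreover have "(\<lambda>xs. norm (?P xs)) summable_on words I (Suc n)"
    by (subst summable_on_reindex_bij_betw[OF bij_betw_words_Suc, symmetric])
       (use has_sum_times(2)[OF u Suc[THEN conjunct1] Suc[THEN conjunct2]] in \<open>simp add: eq\<close>)
  ultimately show ?case ..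
qed (use has_sum_finite[of "{[]}" "\<lambda>xs. prod_list (map u xs)"] in simp)

text \<open>The product rule for \<open>X ^ n\<close>: the weight of a word is the sum over its
  letters, so each of the \<open>n\<close> factors is replaced by its weighted version in turn. For
  \<open>n = 0\<close> the truncated exponent is harmless because of the factor
  \<open>of_nat n\<close>.\<close>

lemma has_sum_words_weighted:
  fixes u l :: "'a \<Rightarrow> 'c :: {real_normed_field, banach}"
  assumes u: "(u has_sum X) I" "(\<lambda>j. norm (u j)) summable_on I"
    and y: "((\<lambda>j. l j * u j) has_sum Y) I" "(\<lambda>j. norm (l j * u j)) summable_on I"
  shows "((\<lambda>xs. sum_list (map l xs) * prod_list (map u xs)) has_sum (of_nat n * Y * X ^ (n - 1))) (words I n)
       \<and> (\<lambda>xs. norm (sum_list (map l xs) * prod_list (map u xs))) summable_on words I n"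
proof (induction n)
  case (Suc n)
  let ?P = "\<lambda>xs. prod_list (map u xs)"
  let ?T = "\<lambda>xs. sum_list (map l xs) * ?P xs"
  have eq: "?T (case z of (x, xs) \<Rightarrow> x # xs) = (case z of (x, xs) \<Rightarrow> l x * u x * ?P xs) + (case z of (x, xs) \<Rightarrow> u x * ?T xs)" for z
    by (cases z) (simp add: algebra_simps)
  note P = has_sum_words_prod[OF u, of n]
  note t1 = has_sum_times[OF y P[THEN conjunct1] P[THEN conjunct2]]
  note t2 = has_sum_times[OF u Suc[THEN conjunct1] Suc[THEN conjunct2]]
  have "Y * X ^ n + X * (of_nat n * Y * X ^ (n - 1)) = of_nat (Suc n) * Y * X ^ (Suc n - 1)"
    by (cases n) (auto simp: algebra_simps)
  then have "(?T has_sum (of_nat (Suc n) * Y * X ^ (Suc n - 1))) (words I (Suc n))"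
    by (subst has_sum_reindex_bij_betw[OF bij_betw_words_Suc, symmetric])
       (use has_sum_add[OF t1(1) t2(1)] in \<open>simp add: eq\<close>)
  moreover have "(\<lambda>xs. norm (?T xs)) summable_on words I (Suc n)"
    by (subst summable_on_reindex_bij_betw[OF bij_betw_words_Suc, symmetric])
       (unfold eq, rule Infinite_Sum.abs_summable_on_comparison_test'[OF summable_on_add[OF t1(2) t2(2)]], rule norm_triangle_ineq)
  ultimately show ?case ..
qed (use has_sum_finite[of "{[]}" "\<lambda>xs. sum_list (map l xs) * prod_list (map u xs)"] in simp)

lemma has_sum_Suc_geometric:
  fixes X :: complex
  assumes "norm X < 1"
  shows "((\<lambda>n. - (Y * (- X) ^ n)) has_sum (- (Y / (1 + X)))) UNIV"
proof -
  have "((\<lambda>n. (- X) ^ n) has_sum (1 / (1 - (- X)))) UNIV"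
  proof (rule norm_summable_imp_has_sum)
    show "summable (\<lambda>n. norm ((- X) ^ n))" using assms by (simp add: norm_power)
    show "(\<lambda>n. (- X) ^ n) sums (1 / (1 - (- X)))" by (rule geometric_sums) (use assms in simp)
  qed
  from has_sum_uminusI[OF has_sum_cmult_right[OF this, of Y]] show ?thesis by simp
qed

text \<open>The weights \<open>l\<close> produce the derivative of the logarithmic series and so
  avoid the logarithm itself: the word length from \<open>has_sum_words_weighted\<close> cancels the
  denominator, and a geometric series in \<open>- X\<close> remains.\<close>

lemma has_sum_log_words:
  fixes u :: "'a \<Rightarrow> complex" and l :: "'a \<Rightarrow> real"
  assumes u: "(u has_sum X) I" and y: "((\<lambda>j. of_real (l j) * u j) has_sum Y) I"
    and l: "\<And>j. j \<in> I \<Longrightarrow> l j \<ge> 0" and small: "infsum (\<lambda>j. norm (u j)) I < 1"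
  shows "((\<lambda>xs. of_real (sum_list (map l xs)) * ((-1) ^ length xs / of_nat (length xs)) * prod_list (map u xs))
            has_sum (- (Y / (1 + X)))) {xs. set xs \<subseteq> I \<and> xs \<noteq> []}"
proof -
  have su: "(\<lambda>j. norm (u j)) summable_on I" "(\<lambda>j. norm (of_real (l j) * u j)) summable_on I"
    using u y by (simp_all add: summable_on_iff_abs_summable_on_complex[symmetric] has_sum_imp_summable)
  define X' Y' where "X' = infsum (\<lambda>j. norm (u j)) I" and "Y' = infsum (\<lambda>j. l j * norm (u j)) I"
  have ln: "norm (complex_of_real (l j) * u j) = l j * norm (u j)" if "j \<in> I" for j
    using l[OF that] by (simp add: norm_mult)
  have sl: "(\<lambda>j. l j * norm (u j)) summable_on I"
    using su(2) by (subst summable_on_cong[OF ln[symmetric]]) auto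
  have su': "((\<lambda>j. norm (u j)) has_sum X') I" "((\<lambda>j. l j * norm (u j)) has_sum Y') I"
    unfolding X'_def Y'_def by (intro has_sum_infsum su sl)+
  have X': "0 \<le> X'" "X' < 1" "norm X \<le> X'"
    using small norm_has_sum_bound[OF su'(1) u]
    unfolding X'_def by (auto intro: infsum_nonneg)
  define T where "T = (\<lambda>xs. complex_of_real (sum_list (map l xs)) * ((-1) ^ length xs / of_nat (length xs)) * prod_list (map u xs))"
  have sig: "((\<lambda>(n, xs). T xs) has_sum (- (Y / (1 + X)))) (Sigma UNIV (\<lambda>n. words I (Suc n)))"
  proof (rule has_sum_SigmaI)
    show "((\<lambda>n. - (Y * (- X) ^ n)) has_sum (- (Y / (1 + X)))) UNIV"
      by (rule has_sum_Suc_geometric) (use X' in auto)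
    show "((\<lambda>xs. case (n, xs) of (n, xs) \<Rightarrow> T xs) has_sum (- (Y * (- X) ^ n))) (words I (Suc n))" for n
    proof -
      have "((\<lambda>xs. (\<Sum>x\<leftarrow>xs. of_real (l x)) * prod_list (map u xs)) has_sum (of_nat (Suc n) * Y * X ^ (Suc n - 1))) (words I (Suc n))"
        using has_sum_words_weighted[OF u su(1) y su(2), of "Suc n"] by blast
      from has_sum_cmult_right[OF this, of "(-1) ^ Suc n / of_nat (Suc n)"]
      have "((\<lambda>xs. (-1) ^ Suc n / of_nat (Suc n) * ((\<Sum>x\<leftarrow>xs. of_real (l x)) * prod_list (map u xs))) has_sum (- (Y * (- X) ^ n))) (words I (Suc n))"
        by (simp add: power_minus[of X] field_simps del: of_nat_Suc)
      moreover have "complex_of_real (sum_list (map l xs)) = (\<Sum>x\<leftarrow>xs. of_real (l x))" for xs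
        by (induction xs) auto
      ultimately show ?thesis
        by (subst has_sum_cong[where g="\<lambda>xs. (-1) ^ Suc n / of_nat (Suc n) * ((\<Sum>x\<leftarrow>xs. of_real (l x)) * prod_list (map u xs))"])
           (auto simp: T_def words_def)
    qed
    \<comment> \<open>The same computation for the absolute values has ratio \<open>X' < 1\<close>;
      this is why \<open>small\<close> concerns the sum of the norms and not
      \<open>norm X\<close>.\<close>
    show "(\<lambda>(n, xs). T xs) summable_on (SIGMA n:UNIV. words I (Suc n))"
    proof (rule abs_summable_summable, rule summable_on_SigmaI)
      show "((\<lambda>xs. norm (case (n, xs) of (n, xs) \<Rightarrow> T xs)) has_sum (Y' * X' ^ n)) (words I (Suc n))" for n
      proof -
        have "((\<lambda>xs. sum_list (map l xs) * prod_list (map (\<lambda>j. norm (u j)) xs)) has_sum (of_nat (Suc n) * Y' * X' ^ (Suc n - 1))) (words I (Suc n))"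
        proof (rule has_sum_words_weighted[OF su'(1) _ su'(2), THEN conjunct1])
          show "(\<lambda>j. norm (norm (u j))) summable_on I" using su(1) by simp
          show "(\<lambda>j. norm (l j * norm (u j))) summable_on I"
            using sl by (simp only: summable_on_iff_abs_summable_on_real[symmetric])
        qed
        from has_sum_cmult_right[OF this, of "1 / of_nat (Suc n)"]
        have "((\<lambda>xs. 1 / of_nat (Suc n) * (sum_list (map l xs) * prod_list (map (\<lambda>j. norm (u j)) xs))) has_sum (Y' * X' ^ n)) (words I (Suc n))"
          by (simp add: field_simps del: of_nat_Suc)
        moreover have "norm (prod_list (map u xs)) = prod_list (map (\<lambda>j. norm (u j)) xs)" for xs
          by (induction xs) (auto simp: norm_mult)
        moreover have "\<bar>sum_list (map l xs)\<bar> = sum_list (map l xs)" if "xs \<in> words I (Suc n)" for xs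
          using that l by (intro abs_of_nonneg sum_list_nonneg) (auto simp: words_def)
        ultimately show ?thesis
          by (subst has_sum_cong[where g="\<lambda>xs. 1 / of_nat (Suc n) * (sum_list (map l xs) * prod_list (map (\<lambda>j. norm (u j)) xs))"])
             (auto simp: T_def words_def norm_mult norm_divide norm_power simp del: of_nat_Suc)
      qed
      have "summable (\<lambda>n. norm (Y' * X' ^ n))"
      proof -
        have "norm (Y' * X' ^ n) = \<bar>Y'\<bar> * X' ^ n" for n
          using X'(1) by (simp add: abs_mult power_abs)
        then show ?thesis using X' by (simp add: summable_mult summable_geometric)
      qed
      then show "(\<lambda>n. Y' * X' ^ n) summable_on UNIV"
        by (rule norm_summable_imp_summable_on)
    qed auto
  qed
  have "bij_betw snd (Sigma UNIV (\<lambda>n. words I (Suc n))) {xs. set xs \<subseteq> I \<and> xs \<noteq> []}"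
    by (rule bij_betwI[where g="\<lambda>xs. (length xs - 1, xs)"]) (auto simp: words_def)
  from has_sum_reindex_bij_betw[OF this, of T] sig show ?thesis
    unfolding T_def by (simp add: case_prod_unfold)
qed

text \<open>Nonempty finite multisets over \<open>I\<close> correspond to \<open>Lam I\<close>. The
  words over a multi-index are then the permutations of its multiset, whose number is known.\<close>

definition mi_of_mset :: "nat multiset \<Rightarrow> nat \<Rightarrow> int" where
  "mi_of_mset M = (\<lambda>n. int (count M n))"

lemma mi_support_of_mset [simp]: "mi_support (mi_of_mset M) = set_mset M"
  by (auto simp: mi_support_def mi_of_mset_def)

lemma mi_norm_of_mset [simp]: "mi_norm (mi_of_mset M) = int (size M)"
  unfolding mi_norm_def mi_support_of_mset by (simp add: mi_of_mset_def size_multiset_overloaded_eq)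

lemma bij_betw_mi_of_mset: "bij_betw mi_of_mset {M. set_mset M \<subseteq> I \<and> M \<noteq> {#}} (Lam I)"
proof (rule bij_betwI[where g="\<lambda>k. Abs_multiset (\<lambda>n. nat (k n))"])
  show "mi_of_mset \<in> {M. set_mset M \<subseteq> I \<and> M \<noteq> {#}} \<rightarrow> Lam I"
  proof
    fix M assume M: "M \<in> {M. set_mset M \<subseteq> I \<and> M \<noteq> {#}}"
    then have "size M \<noteq> 0" by simp
    then have "1 \<le> int (size M)" by linarith
    with M show "mi_of_mset M \<in> Lam I" unfolding Lam_def by (auto simp: mi_of_mset_def[of M, THEN fun_cong])
  qed
  have *: "count (Abs_multiset (\<lambda>n. nat (k n))) = (\<lambda>n. nat (k n))" if "k \<in> Lam I" for k
  proof (rule count_Abs_multiset)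
    have "{n. 0 < nat (k n)} \<subseteq> mi_support k" by (auto simp: mi_support_def)
    then show "finite {n. 0 < nat (k n)}" using that by (auto simp: Lam_def intro: finite_subset)
  qed
  show **: "mi_of_mset (Abs_multiset (\<lambda>n. nat (k n))) = k" if "k \<in> Lam I" for k
    unfolding mi_of_mset_def *[OF that] using that by (auto simp: Lam_def)
  show "(\<lambda>k. Abs_multiset (\<lambda>n. nat (k n))) \<in> Lam I \<rightarrow> {M. set_mset M \<subseteq> I \<and> M \<noteq> {#}}"
  proof
    fix k assume k: "k \<in> Lam I"
    let ?M = "Abs_multiset (\<lambda>n. nat (k n))"
    have "set_mset ?M = mi_support k" "int (size ?M) = mi_norm k"
      using **[OF k] by (metis mi_support_of_mset, metis mi_norm_of_mset)
    then show "?M \<in> {M. set_mset M \<subseteq> I \<and> M \<noteq> {#}}" using k by (auto simp: Lam_def)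
  qed
  show "Abs_multiset (\<lambda>n. nat (mi_of_mset M n)) = M" for M
    by (simp add: mi_of_mset_def)
qed

lemma sum_list_map_mset: "sum_list (map l xs) = (\<Sum>n\<in>set_mset (mset xs). l n * of_nat (count (mset xs) n))"
  for l :: "'a \<Rightarrow> real"
proof -
  have "sum_list (map l ys) = (\<Sum>n\<in>set_mset (mset xs). l n * of_nat (count (mset ys) n))" if "set ys \<subseteq> set xs" for ys
    using that
  proof (induction ys)
    case (Cons y ys)
    have "(\<Sum>n\<in>set xs. l n * (if y = n then 1 else 0)) = l y"
      using Cons.prems by (simp add: if_distrib cong: if_cong)
    moreover have "real (count (mset (y # ys)) n) = real (count (mset ys) n) + (if y = n then 1 else 0)" for n
      by simp
    ultimately show ?case using Cons by (simp only: distrib_left sum.distrib) simp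
  qed simp
  then show ?thesis by blast
qed

lemma prod_list_map_mset: "prod_list (map u xs) = (\<Prod>n\<in>set_mset (mset xs). u n ^ count (mset xs) n)"
  for u :: "'a \<Rightarrow> complex"
proof -
  have "prod_list (map u xs) = prod_mset (image_mset u (mset xs))"
    by (metis mset_map prod_mset_prod_list)
  then show ?thesis by (simp only: image_prod_mset_multiplicity)
qed

text \<open>The summand of \<open>has_sum_log_words\<close> is constant on the permutations of one
  multiset, so each inner sum is finite and equals that constant times the number of
  permutations.\<close>

lemma has_sum_log_coeff:
  fixes u :: "nat \<Rightarrow> complex" and l :: "nat \<Rightarrow> real"
  assumes u: "(u has_sum X) I" and y: "((\<lambda>j. of_real (l j) * u j) has_sum Y) I"
    and l: "\<And>j. j \<in> I \<Longrightarrow> l j \<ge> 0" and small: "infsum (\<lambda>j. norm (u j)) I < 1"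
  shows "((\<lambda>k. of_real (mi_freq l k) * log_coeff u k) has_sum (- (Y / (1 + X)))) (Lam I)"
proof -
  define T where "T = (\<lambda>xs. complex_of_real (sum_list (map l xs)) * ((-1) ^ length xs / of_nat (length xs)) * prod_list (map u xs))"
  define MS where "MS = {M. set_mset M \<subseteq> I \<and> M \<noteq> {#}}"
  have "bij_betw snd (Sigma MS permutations_of_multiset) {xs. set xs \<subseteq> I \<and> xs \<noteq> []}"
    by (rule bij_betwI[where g="\<lambda>xs. (mset xs, xs)"]) (auto simp: MS_def permutations_of_multiset_def subset_eq)
  from has_sum_reindex_bij_betw[OF this, of T] has_sum_log_words[OF assms]
  have "((\<lambda>z. T (snd z)) has_sum (- (Y / (1 + X)))) (Sigma MS permutations_of_multiset)"
    unfolding T_def by simp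
  then have "((\<lambda>M. of_real (mi_freq l (mi_of_mset M)) * log_coeff u (mi_of_mset M)) has_sum (- (Y / (1 + X)))) MS"
  proof (rule has_sum_SigmaD)
    fix M assume "M \<in> MS"
    define t where "t = complex_of_real (mi_freq l (mi_of_mset M)) * ((-1) ^ size M / of_nat (size M)) *
        (\<Prod>n\<in>set_mset M. u n ^ count M n)"
    have T: "T xs = t" if "xs \<in> permutations_of_multiset M" for xs
    proof -
      have "mset xs = M" "length xs = size M" using that
        by (auto dest: permutations_of_multisetD length_finite_permutations_of_multiset)
      then show ?thesis
        unfolding T_def t_def sum_list_map_mset prod_list_map_mset mi_freq_def mi_support_of_mset by (simp add: mi_of_mset_def)
    qed
    let ?F = "\<Prod>x\<in>set_mset M. fact (count M x) :: complex"
    have "complex_of_nat (card (permutations_of_multiset M) * (\<Prod>x\<in>set_mset M. fact (count M x))) = of_nat (fact (size M))"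
      by (simp only: card_permutations_of_multiset_aux)
    then have "of_nat (card (permutations_of_multiset M)) * ?F = fact (size M)"
      by simp
    moreover have "?F \<noteq> 0" by simp
    ultimately have card: "of_nat (card (permutations_of_multiset M)) = fact (size M) / ?F"
      by (simp add: field_simps)
    have "sum T (permutations_of_multiset M) = fact (size M) / ?F * t"
      using T by (simp add: card)
    also have "\<dots> = of_real (mi_freq l (mi_of_mset M)) * log_coeff u (mi_of_mset M)"
      unfolding log_coeff_def mi_support_of_mset mi_norm_of_mset t_def by (simp add: mi_of_mset_def mult_ac)
    finally show "((\<lambda>xs. T (snd (M, xs))) has_sum of_real (mi_freq l (mi_of_mset M)) * log_coeff u (mi_of_mset M)) (permutations_of_multiset M)"
      using has_sum_finite[OF finite_permutations_of_multiset, of T M] by simp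
  qed
  then show ?thesis
    unfolding MS_def using has_sum_reindex_bij_betw[OF bij_betw_mi_of_mset] by blast
qed

text \<open>\<open>log_coeff\<close> is a monomial in the coefficients, so the exponentials attached
  to them multiply up to a single one whose frequency is that of \<open>k\<close>.\<close>

lemma log_coeff_twist:
  assumes "k \<in> Lam I"
  shows "log_coeff (\<lambda>n. a n * exp (- (of_real (lam n) * s))) k = log_coeff a k * exp (- (of_real (mi_freq lam k) * s))"
proof -
  have fin: "finite (mi_support k)" and nn: "\<And>n. 0 \<le> k n" using assms by (auto simp: Lam_def)
  have "(\<Prod>j\<in>mi_support k. (a j * exp (- (of_real (lam j) * s))) ^ nat (k j)) =
      (\<Prod>j\<in>mi_support k. a j ^ nat (k j)) * (\<Prod>j\<in>mi_support k. exp (- (of_real (lam j * of_int (k j)) * s)))"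
    unfolding prod.distrib[symmetric]
  proof (rule prod.cong)
    fix j assume "j \<in> mi_support k"
    have "of_nat (nat (k j)) = (of_int (k j) :: complex)" using nn[of j] by simp
    then have "exp (- (of_real (lam j) * s)) ^ nat (k j) = exp (of_int (k j) * - (of_real (lam j) * s))"
      by (simp only: exp_of_nat_mult[symmetric])
    then show "(a j * exp (- (of_real (lam j) * s))) ^ nat (k j) = a j ^ nat (k j) * exp (- (of_real (lam j * of_int (k j)) * s))"
      by (simp add: power_mult_distrib algebra_simps)
  qed simp
  also have "(\<Prod>j\<in>mi_support k. exp (- (of_real (lam j * of_int (k j)) * s))) = exp (\<Sum>j\<in>mi_support k. - (of_real (lam j * of_int (k j)) * s))"
    by (rule exp_sum[symmetric]) (rule fin)
  also have "(\<Sum>j\<in>mi_support k. - (of_real (lam j * of_int (k j)) * s)) = - (of_real (mi_freq lam k) * s)"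
    unfolding mi_freq_def of_real_sum sum_distrib_right sum_negf[symmetric] ..
  finally show ?thesis unfolding log_coeff_def by (simp add: algebra_simps)
qed


section \<open>Canonical products\<close>

text \<open>With the principal branch this is a holomorphic logarithm of the Weierstrass factor on
  the unit disc, where \<open>1 - u\<close> has positive real part.\<close>

definition weierstrass_log :: "nat \<Rightarrow> complex \<Rightarrow> complex" where
  "weierstrass_log m u = Ln (1 - u) + (\<Sum>k=1..m. u ^ k / of_nat k)"

lemma exp_weierstrass_log: "u \<noteq> 1 \<Longrightarrow> exp (weierstrass_log m u) = weierstrass_factor m u"
  by (simp add: weierstrass_log_def weierstrass_factor_def exp_add)

lemma weierstrass_log_0 [simp]: "weierstrass_log m 0 = 0"
  by (simp add: weierstrass_log_def power_0_left)

lemma has_field_derivative_sum_power_div: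
  assumes "u \<noteq> (1 :: complex)"
  shows "((\<lambda>u. \<Sum>k=1..m. u ^ k / of_nat k) has_field_derivative ((1 - u ^ m) / (1 - u))) (at u)"
proof -
  have "((\<lambda>u. \<Sum>k=1..m. u ^ k / of_nat k) has_field_derivative (\<Sum>k=1..m. u ^ (k - 1))) (at u)"
    by (rule derivative_eq_intros refl | simp)+
  also have "(\<Sum>k=1..m. u ^ (k - 1)) = (\<Sum>k<m. u ^ k)"
    by (rule sum.reindex_bij_witness[where i=Suc and j="\<lambda>k. k - 1"]) auto
  also have "\<dots> = (1 - u ^ m) / (1 - u)"
    using assms by (simp add: sum_gp_strict)
  finally show ?thesis .
qed

text \<open>The derivative of the polynomial part is a finite geometric sum, which cancels the first
  \<open>m\<close> terms of \<open>- 1 / (1 - u)\<close>.\<close>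

lemma has_field_derivative_weierstrass_log:
  assumes "norm u < 1"
  shows "(weierstrass_log m has_field_derivative - (u ^ m / (1 - u))) (at u)"
proof -
  have u: "u \<noteq> 1" using assms by auto
  have "Re (1 - u) > 0" using assms complex_Re_le_cmod[of u] by simp
  then have nn: "1 - u \<notin> \<real>\<^sub>\<le>\<^sub>0" by (auto simp: complex_nonpos_Reals_iff)
  have "((\<lambda>u. Ln (1 - u) + (\<Sum>k=1..m. u ^ k / of_nat k)) has_field_derivative
      (- 1 / (1 - u) + (1 - u ^ m) / (1 - u))) (at u)"
    using nn by (intro DERIV_add has_field_derivative_sum_power_div[OF u])
      (auto intro!: derivative_eq_intros simp: inverse_eq_divide)
  moreover have "- 1 / (1 - u) + (1 - u ^ m) / (1 - u) = - (u ^ m / (1 - u))"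
    by (simp add: diff_divide_distrib)
  ultimately show ?thesis unfolding weierstrass_log_def[abs_def] by simp
qed

text \<open>The mean value inequality from 0: on the disc of radius \<open>norm u\<close> one has
  \<open>norm (1 - z) \<ge> 1 / 2\<close>, so the derivative is at most
  \<open>2 * norm u ^ m\<close>.\<close>

lemma norm_weierstrass_log_le:
  assumes "norm u \<le> 1 / 2"
  shows "norm (weierstrass_log m u) \<le> 2 * norm u ^ Suc m"
proof -
  have "norm (weierstrass_log m u - weierstrass_log m 0) \<le> 2 * norm u ^ m * norm (u - 0)"
  proof (rule field_differentiable_bound[of "cball 0 (norm u)"])
    fix z :: complex assume z: "z \<in> cball 0 (norm u)"
    then show "(weierstrass_log m has_field_derivative - (z ^ m / (1 - z))) (at z within cball 0 (norm u))"
      using assms by (intro has_field_derivative_at_within[OF has_field_derivative_weierstrass_log]) auto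
    have "1 / 2 \<le> norm (1 - z)"
      using z assms norm_triangle_ineq2[of 1 z] by simp
    then have "norm (z ^ m) / norm (1 - z) \<le> norm u ^ m / (1 / 2)"
      using z by (intro frac_le) (auto simp: norm_power intro!: power_mono)
    then show "norm (- (z ^ m / (1 - z))) \<le> 2 * norm u ^ m" by (simp add: norm_divide)
  qed auto
  then show ?thesis by (simp add: mult_ac)
qed

lemma has_field_derivative_weierstrass_factor:
  assumes "u \<noteq> 1"
  shows "(weierstrass_factor m has_field_derivative weierstrass_factor m u * - (u ^ m / (1 - u))) (at u)"
proof -
  let ?S = "\<lambda>u. \<Sum>k=1..m. u ^ k / of_nat k"
  have "((\<lambda>u. (1 - u) * exp (?S u)) has_field_derivative
      (- exp (?S u) + (1 - u) * (exp (?S u) * ((1 - u ^ m) / (1 - u))))) (at u)"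
    by (rule derivative_eq_intros has_field_derivative_sum_power_div[OF assms] refl | simp)+
  also have "- exp (?S u) + (1 - u) * (exp (?S u) * ((1 - u ^ m) / (1 - u))) = weierstrass_factor m u * - (u ^ m / (1 - u))"
    using assms by (simp add: weierstrass_factor_def field_simps)
  finally show ?thesis unfolding weierstrass_factor_def[abs_def] .
qed

text \<open>Nonvanishing is part of the notion, so that products turn into sums, integer powers into
  multiples, and \<open>L\<close> is unique, without side conditions in each rule.\<close>

definition has_logderiv :: "(complex \<Rightarrow> complex) \<Rightarrow> complex \<Rightarrow> complex \<Rightarrow> bool" where
  "has_logderiv f L s \<longleftrightarrow> f s \<noteq> 0 \<and> (f has_field_derivative f s * L) (at s)"

lemma has_logderiv_mult:
  assumes "has_logderiv f L s" "has_logderiv g M s"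
  shows "has_logderiv (\<lambda>s. f s * g s) (L + M) s"
  using assms DERIV_mult[of f "f s * L" s UNIV g "g s * M"]
  by (auto simp: has_logderiv_def algebra_simps)

lemma has_logderiv_prod:
  assumes "finite A" "\<And>x. x \<in> A \<Longrightarrow> has_logderiv (f x) (L x) s"
  shows "has_logderiv (\<lambda>s. \<Prod>x\<in>A. f x s) (\<Sum>x\<in>A. L x) s"
  using assms by (induction rule: finite_induct) (auto intro!: has_logderiv_mult simp: has_logderiv_def[of "\<lambda>_. 1"])

lemma has_logderiv_powi:
  assumes "has_logderiv f L s"
  shows "has_logderiv (\<lambda>s. f s powi n) (of_int n * L) s"
proof -
  have "((\<lambda>s. f s powi n) has_field_derivative of_int n * f s powi (n - 1) * (f s * L)) (at s)"
    using assms by (intro DERIV_power_int) (auto simp: has_logderiv_def)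
  moreover have "of_int n * f s powi (n - 1) * (f s * L) = f s powi n * (of_int n * L)"
    using assms by (simp add: has_logderiv_def power_int_diff)
  ultimately show ?thesis using assms by (simp add: has_logderiv_def)
qed

lemma has_logderiv_exp:
  assumes "(g has_field_derivative L) (at s)"
  shows "has_logderiv (\<lambda>s. exp (g s)) L s"
  using assms unfolding has_logderiv_def by (auto intro!: derivative_eq_intros)

lemma has_logderiv_unique: "has_logderiv f L s \<Longrightarrow> has_logderiv f M s \<Longrightarrow> L = M"
  unfolding has_logderiv_def by (metis DERIV_unique mult_cancel_left)

lemma has_logderiv_transform:
  assumes "has_logderiv f L s" "open S" "s \<in> S" "\<And>x. x \<in> S \<Longrightarrow> f x = g x"
  shows "has_logderiv g L s"
  using assms has_field_derivative_transform_within_open[of f "f s * L" s S g]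
  by (auto simp: has_logderiv_def)

text \<open>The exponent may have either sign: for zeros the lower bound on \<open>norm z\<close> is
  used, for poles the upper one.\<close>

lemma norm_powi_lower:
  fixes z :: complex
  assumes "exp (- c) \<le> norm z" "norm z \<le> exp c"
  shows "norm (z powi k) \<ge> exp (- (c * \<bar>of_int k\<bar>))"
proof (cases "k \<ge> 0")
  case True
  then have "exp (- (c * \<bar>of_int k\<bar>)) = exp (- c) ^ nat k"
    by (simp flip: exp_of_nat_mult add: mult.commute)
  also have "\<dots> \<le> norm z ^ nat k" by (intro power_mono assms) auto
  finally show ?thesis using True by (simp add: norm_power_int norm_power power_int_def)
next
  case False
  have z: "norm z > 0" using assms(1) exp_gt_zero[of "- c"] by linarith
  have "norm z ^ nat (- k) \<le> exp c ^ nat (- k)" by (intro power_mono assms) auto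
  also have "\<dots> = exp (c * \<bar>of_int k\<bar>)" using False by (simp flip: exp_of_nat_mult add: mult.commute)
  finally have "1 / exp (c * \<bar>of_int k\<bar>) \<le> 1 / norm z ^ nat (- k)"
    using z by (intro divide_left_mono) auto
  then show ?thesis using False by (simp add: norm_power_int norm_power norm_divide power_int_def exp_minus field_simps)
qed

text \<open>\<open>Suc m\<close> is the exponent \<open>d\<close>. The centre is a parameter because
  the locale is used at 0, where the convergence exponent is defined, and at the given point
  \<sigma>.\<close>

locale canonical_divisor =
  fixes Z :: "complex set" and n :: "complex \<Rightarrow> int" and \<sigma> :: complex and m :: nat
  assumes sigma: "\<sigma> \<notin> Z" and nz: "\<And>\<rho>. \<rho> \<in> Z \<Longrightarrow> n \<rho> \<noteq> 0"
    and summ: "(\<lambda>\<rho>. real_of_int \<bar>n \<rho>\<bar> / norm (\<rho> - \<sigma>) ^ Suc m) summable_on Z"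
begin

definition elem :: "complex \<Rightarrow> complex \<Rightarrow> complex" where
  "elem \<rho> s = weierstrass_factor m ((s - \<sigma>) / (\<rho> - \<sigma>))"

text \<open>The logarithmic derivative of \<open>elem \<rho>\<close>, in the shape that the Laplace
  transform of \<open>K - K(0)\<close> will have.\<close>

definition elem_ld :: "complex \<Rightarrow> complex \<Rightarrow> complex" where
  "elem_ld \<rho> s = (s - \<sigma>) ^ m / ((s - \<rho>) * (\<rho> - \<sigma>) ^ m)"

text \<open>The factor 2 ensures
  \<open>norm ((s - \<sigma>) / (\<rho> - \<sigma>)) \<le> 1 / 2\<close> for \<open>s\<close> in the
  disc of radius \<open>R\<close> and \<rho> outside the head, as
  \<open>norm_weierstrass_log_le\<close> requires.\<close>

definition head :: "real \<Rightarrow> complex set" where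
  "head R = {\<rho>\<in>Z. norm (\<rho> - \<sigma>) \<le> 2 * R}"

definition total :: real where
  "total = (\<Sum>\<^sub>\<infinity>\<rho>\<in>Z. real_of_int \<bar>n \<rho>\<bar> / norm (\<rho> - \<sigma>) ^ Suc m)"

lemma neq_sigma: "\<rho> \<in> Z \<Longrightarrow> \<rho> \<noteq> \<sigma>"
  using sigma by auto

lemma one_le_abs_n: "\<rho> \<in> Z \<Longrightarrow> 1 \<le> \<bar>n \<rho>\<bar>"
  using nz by fastforce

lemma sum_le_total:
  assumes "finite X" "X \<subseteq> Z"
  shows "(\<Sum>\<rho>\<in>X. real_of_int \<bar>n \<rho>\<bar> / norm (\<rho> - \<sigma>) ^ Suc m) \<le> total"
  unfolding total_def by (rule finite_sum_le_infsum[OF summ assms]) auto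

lemma total_nonneg: "total \<ge> 0"
  using sum_le_total[of "{}"] by simp

text \<open>Each point of the ball contributes at least \<open>1 / R ^ Suc m\<close> to
  \<open>total\<close>, its multiplicity being a nonzero integer. The bound is used for finiteness
  and later to find circles that stay away from \<open>Z\<close>.\<close>

lemma card_ball_le:
  assumes "finite X" "X \<subseteq> Z" "\<And>\<rho>. \<rho> \<in> X \<Longrightarrow> norm (\<rho> - \<sigma>) \<le> R" "R \<ge> 0"
  shows "real (card X) \<le> total * R ^ Suc m"
proof (cases "X = {}")
  case True
  then show ?thesis using total_nonneg assms(4) by simp
next
  case False
  then obtain \<rho>0 where "\<rho>0 \<in> X" by auto
  then have R: "R > 0" using assms neq_sigma[of \<rho>0] by (smt (verit) norm_ge_zero subsetD zero_less_norm_iff right_minus_eq)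
  have "real (card X) * (1 / R ^ Suc m) = (\<Sum>\<rho>\<in>X. 1 / R ^ Suc m)" by simp
  also have "\<dots> \<le> (\<Sum>\<rho>\<in>X. real_of_int \<bar>n \<rho>\<bar> / norm (\<rho> - \<sigma>) ^ Suc m)"
  proof (rule sum_mono)
    fix \<rho> assume \<rho>: "\<rho> \<in> X"
    then have "\<rho> \<in> Z" using assms by auto
    then have "norm (\<rho> - \<sigma>) > 0" "1 \<le> real_of_int \<bar>n \<rho>\<bar>" using neq_sigma one_le_abs_n[of \<rho>] by auto
    then show "1 / R ^ Suc m \<le> real_of_int \<bar>n \<rho>\<bar> / norm (\<rho> - \<sigma>) ^ Suc m"
      using assms(3)[OF \<rho>] by (intro frac_le power_mono zero_less_power) auto
  qed
  also have "\<dots> \<le> total" by (rule sum_le_total[OF assms(1,2)])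
  finally show ?thesis using R by (simp add: field_simps)
qed

lemma finite_head: "finite (head R)"
proof (rule ccontr)
  assume inf: "infinite (head R)"
  obtain k :: nat where k: "real k > total * (2 * R) ^ Suc m" using reals_Archimedean2 by blast
  obtain X where X: "X \<subseteq> head R" "finite X" "card X = k"
    using infinite_arbitrarily_large[OF inf] by blast
  have "real (card X) \<le> total * (2 * R) ^ Suc m"
  proof (intro card_ball_le)
    have "head R \<noteq> {}" using inf by auto
    then show "0 \<le> 2 * R" using norm_ge_zero order_trans unfolding head_def by blast
  qed (use X in \<open>auto simp: head_def\<close>)
  with k X show False by simp
qed

lemma head_subset: "head R \<subseteq> Z" by (auto simp: head_def)

lemma not_islimpt_Z: "\<not> x islimpt Z"
proof
  assume "x islimpt Z"
  then have "infinite (Z \<inter> ball x 1)"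
    by (simp add: islimpt_eq_infinite_ball)
  moreover have "Z \<inter> ball x 1 \<subseteq> head (norm (x - \<sigma>) + 1)"
  proof
    fix \<rho> assume "\<rho> \<in> Z \<inter> ball x 1"
    moreover have "norm (\<rho> - \<sigma>) \<le> norm (\<rho> - x) + norm (x - \<sigma>)"
      using norm_triangle_ineq[of "\<rho> - x" "x - \<sigma>"] by simp
    ultimately have "\<rho> \<in> Z" "norm (\<rho> - \<sigma>) \<le> 1 + norm (x - \<sigma>)"
      by (auto simp: dist_norm norm_minus_commute)
    moreover have "0 \<le> norm (x - \<sigma>)" by (rule norm_ge_zero)
    ultimately have "norm (\<rho> - \<sigma>) \<le> 2 * (norm (x - \<sigma>) + 1)"
      by argo
    with \<open>\<rho> \<in> Z\<close> show "\<rho> \<in> head (norm (x - \<sigma>) + 1)"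
      by (simp add: head_def)
  qed
  ultimately show False
    using finite_head finite_subset by blast
qed

text \<open>The finitely many factors in \<open>head R\<close> are split off because \<open>weierstrass_log\<close> is a logarithm of the
  remaining ones on the whole disc of radius \<open>R\<close>.\<close>

definition tail_log :: "real \<Rightarrow> complex \<Rightarrow> complex \<Rightarrow> complex" where
  "tail_log R \<rho> s = (if \<rho> \<in> head R then 0 else of_int (n \<rho>) * weierstrass_log m ((s - \<sigma>) / (\<rho> - \<sigma>)))"

definition tail_sum :: "real \<Rightarrow> complex \<Rightarrow> complex" where
  "tail_sum R s = (\<Sum>\<^sub>\<infinity>\<rho>\<in>Z. tail_log R \<rho> s)"

lemma tail_quotient_le:
  assumes "\<rho> \<in> Z" "\<rho> \<notin> head R" "norm (s - \<sigma>) \<le> R"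
  shows "norm ((s - \<sigma>) / (\<rho> - \<sigma>)) \<le> 1 / 2"
  using assms by (auto simp: head_def norm_divide divide_le_eq)

lemma norm_tail_log_le:
  assumes "\<rho> \<in> Z" "norm (s - \<sigma>) \<le> R"
  shows "norm (tail_log R \<rho> s) \<le> 2 * R ^ Suc m * (real_of_int \<bar>n \<rho>\<bar> / norm (\<rho> - \<sigma>) ^ Suc m)"
proof (cases "\<rho> \<in> head R")
  case True
  have "R \<ge> 0" using assms(2) norm_ge_zero[of "s - \<sigma>"] by linarith
  then show ?thesis using True by (simp add: tail_log_def)
next
  case False
  have "norm (tail_log R \<rho> s) = \<bar>n \<rho>\<bar> * norm (weierstrass_log m ((s - \<sigma>) / (\<rho> - \<sigma>)))"
    using False by (simp add: tail_log_def norm_mult)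
  also have "\<dots> \<le> \<bar>n \<rho>\<bar> * (2 * norm ((s - \<sigma>) / (\<rho> - \<sigma>)) ^ Suc m)"
    by (intro mult_left_mono norm_weierstrass_log_le tail_quotient_le[OF assms(1) False assms(2)]) auto
  also have "\<dots> \<le> \<bar>n \<rho>\<bar> * (2 * (R ^ Suc m / norm (\<rho> - \<sigma>) ^ Suc m))"
    unfolding norm_divide power_divide
    by (intro mult_left_mono divide_right_mono power_mono assms(2)) auto
  finally show ?thesis by (simp add: field_simps)
qed

lemma uniform_limit_tail:
  "uniform_limit (cball \<sigma> R) (\<lambda>X s. \<Sum>\<rho>\<in>X. tail_log R \<rho> s) (tail_sum R) (finite_subsets_at_top Z)"
  unfolding tail_sum_def[abs_def]
  by (rule Weierstrass_m_test_general[where M="\<lambda>\<rho>. 2 * R ^ Suc m * (real_of_int \<bar>n \<rho>\<bar> / norm (\<rho> - \<sigma>) ^ Suc m)"])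
     (use norm_tail_log_le summable_on_cmult_right[OF summ] in \<open>auto simp only: mem_cball dist_norm norm_minus_commute\<close>)

lemma elem_eq_0_iff: "\<rho> \<in> Z \<Longrightarrow> elem \<rho> s = 0 \<longleftrightarrow> s = \<rho>"
  using neq_sigma[of \<rho>] by (auto simp: elem_def)

lemma elem_ld_eq:
  assumes "\<rho> \<in> Z" "s \<noteq> \<rho>"
  defines "u \<equiv> (s - \<sigma>) / (\<rho> - \<sigma>)"
  shows "- (u ^ m / (1 - u)) * (1 / (\<rho> - \<sigma>)) = elem_ld \<rho> s"
proof -
  have "1 - u = (\<rho> - s) / (\<rho> - \<sigma>)" using neq_sigma[OF assms(1)] by (simp add: u_def field_simps)
  then have "- (u ^ m / (1 - u)) * (1 / (\<rho> - \<sigma>)) = - (u ^ m) / (\<rho> - s)"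
    using neq_sigma[OF assms(1)] assms(2) by simp
  also have "\<dots> = u ^ m / (s - \<rho>)" by (metis minus_diff_eq minus_divide_left minus_divide_right)
  also have "\<dots> = elem_ld \<rho> s" by (simp add: elem_ld_def u_def power_divide mult.commute)
  finally show ?thesis .
qed

lemma has_field_derivative_tail_log:
  assumes "\<rho> \<in> Z" "norm (s - \<sigma>) < R"
  shows "(tail_log R \<rho> has_field_derivative (if \<rho> \<in> head R then 0 else of_int (n \<rho>) * elem_ld \<rho> s)) (at s)"
proof (cases "\<rho> \<in> head R")
  case True
  then show ?thesis by (simp add: tail_log_def[abs_def])
next
  case False
  let ?u = "(s - \<sigma>) / (\<rho> - \<sigma>)"
  have u: "norm ?u \<le> 1 / 2" using tail_quotient_le[OF assms(1) False] assms(2) by simp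
  then have "s \<noteq> \<rho>" using neq_sigma[OF assms(1)] by auto
  have "((\<lambda>s. (s - \<sigma>) / (\<rho> - \<sigma>)) has_field_derivative 1 / (\<rho> - \<sigma>)) (at s)"
    using neq_sigma[OF assms(1)] by (auto intro!: derivative_eq_intros)
  from DERIV_chain2[OF has_field_derivative_weierstrass_log this, of m]
  have "((\<lambda>s. weierstrass_log m ((s - \<sigma>) / (\<rho> - \<sigma>))) has_field_derivative
      - (?u ^ m / (1 - ?u)) * (1 / (\<rho> - \<sigma>))) (at s)" using u by simp
  moreover have "- (?u ^ m / (1 - ?u)) * (1 / (\<rho> - \<sigma>)) = elem_ld \<rho> s"
    by (rule elem_ld_eq) fact+
  ultimately show ?thesis using False
    unfolding tail_log_def[abs_def] by (auto intro!: DERIV_cmult)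
qed

lemma has_logderiv_elem:
  assumes "\<rho> \<in> Z" "s \<noteq> \<rho>"
  shows "has_logderiv (elem \<rho>) (elem_ld \<rho> s) s"
proof -
  let ?u = "(s - \<sigma>) / (\<rho> - \<sigma>)"
  have u: "?u \<noteq> 1" using assms neq_sigma[OF assms(1)] by auto
  have "((\<lambda>s. (s - \<sigma>) / (\<rho> - \<sigma>)) has_field_derivative 1 / (\<rho> - \<sigma>)) (at s)"
    using neq_sigma[OF assms(1)] by (auto intro!: derivative_eq_intros)
  from DERIV_chain2[OF has_field_derivative_weierstrass_factor[OF u] this, of m]
  have "(elem \<rho> has_field_derivative elem \<rho> s * - (?u ^ m / (1 - ?u)) * (1 / (\<rho> - \<sigma>))) (at s)"
    by (simp add: elem_def[abs_def])
  moreover have "- (?u ^ m / (1 - ?u)) * (1 / (\<rho> - \<sigma>)) = elem_ld \<rho> s"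
    by (rule elem_ld_eq) fact+
  ultimately show ?thesis using assms
    unfolding mult.assoc by (simp only: has_logderiv_def elem_eq_0_iff simp_thms)
qed

section \<open>Convergence and logarithmic derivative of the canonical product\<close>

definition head_prod :: "real \<Rightarrow> complex \<Rightarrow> complex" where
  "head_prod R s = (\<Prod>\<rho>\<in>head R. elem \<rho> s powi n \<rho>)"

lemma eventually_superset:
  "finite A \<Longrightarrow> A \<subseteq> Z \<Longrightarrow> eventually (\<lambda>X. finite X \<and> A \<subseteq> X \<and> X \<subseteq> Z) (finite_subsets_at_top Z)"
  unfolding eventually_finite_subsets_at_top by blast

lemma prod_tendsto:
  assumes "norm (s - \<sigma>) \<le> R"
  shows "((\<lambda>X. \<Prod>\<rho>\<in>X. elem \<rho> s powi n \<rho>) \<longlongrightarrow> head_prod R s * exp (tail_sum R s)) (finite_subsets_at_top Z)"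
proof (rule Lim_transform_eventually)
  show "((\<lambda>X. head_prod R s * exp (\<Sum>\<rho>\<in>X. tail_log R \<rho> s)) \<longlongrightarrow> head_prod R s * exp (tail_sum R s)) (finite_subsets_at_top Z)"
    by (intro tendsto_intros tendsto_uniform_limitI[OF uniform_limit_tail])
       (use assms in \<open>auto simp: dist_norm norm_minus_commute\<close>)
  show "eventually (\<lambda>X. head_prod R s * exp (\<Sum>\<rho>\<in>X. tail_log R \<rho> s) = (\<Prod>\<rho>\<in>X. elem \<rho> s powi n \<rho>)) (finite_subsets_at_top Z)"
  proof (rule eventually_mono[OF eventually_superset[OF finite_head head_subset]])
    fix X assume X: "finite X \<and> head R \<subseteq> X \<and> X \<subseteq> Z"
    have "exp (\<Sum>\<rho>\<in>X. tail_log R \<rho> s) = (\<Prod>\<rho>\<in>X. exp (tail_log R \<rho> s))"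
      using X by (simp add: exp_sum)
    also have "\<dots> = (\<Prod>\<rho>\<in>X - head R. elem \<rho> s powi n \<rho>)"
    proof (rule prod.mono_neutral_cong_right)
      fix \<rho> assume "\<rho> \<in> X - head R"
      then have \<rho>: "\<rho> \<in> Z" "\<rho> \<notin> head R" using X by auto
      have "(s - \<sigma>) / (\<rho> - \<sigma>) \<noteq> 1" using tail_quotient_le[OF \<rho> assms] by auto
      then show "exp (tail_log R \<rho> s) = elem \<rho> s powi n \<rho>"
        using \<rho> by (simp add: tail_log_def elem_def exp_power_int[symmetric] exp_weierstrass_log)
    qed (use X in \<open>auto simp: tail_log_def\<close>)
    finally show "head_prod R s * exp (\<Sum>\<rho>\<in>X. tail_log R \<rho> s) = (\<Prod>\<rho>\<in>X. elem \<rho> s powi n \<rho>)"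
      using X prod.subset_diff[of "head R" X "\<lambda>\<rho>. elem \<rho> s powi n \<rho>"] by (simp add: head_prod_def mult.commute)
  qed
qed

text \<open>As a limit over finite subsets it does not depend on the radius \<open>R\<close>, which
  enters only the local representation \<open>cprod_eq\<close>.\<close>

definition cprod :: "complex \<Rightarrow> complex" where
  "cprod s = Lim (finite_subsets_at_top Z) (\<lambda>X. \<Prod>\<rho>\<in>X. elem \<rho> s powi n \<rho>)"

lemma cprod_eq: "norm (s - \<sigma>) \<le> R \<Longrightarrow> cprod s = head_prod R s * exp (tail_sum R s)"
  unfolding cprod_def by (intro tendsto_Lim prod_tendsto) auto

lemma tendsto_cprod: "((\<lambda>X. \<Prod>\<rho>\<in>X. elem \<rho> s powi n \<rho>) \<longlongrightarrow> cprod s) (finite_subsets_at_top Z)"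
  using prod_tendsto[of s "norm (s - \<sigma>)"] cprod_eq[of s "norm (s - \<sigma>)"] by simp

text \<open>Uniform convergence on the closed disc yields the derivative and its termwise expansion
  together; the latter becomes an unconditional sum because the limit runs over finite
  subsets.\<close>

lemma tail_sum_derivative:
  assumes "R > 0"
  obtains g' where "\<And>s. s \<in> ball \<sigma> R \<Longrightarrow> (tail_sum R has_field_derivative g' s) (at s)"
    and "\<And>s. s \<in> ball \<sigma> R \<Longrightarrow> ((\<lambda>\<rho>. if \<rho> \<in> head R then 0 else of_int (n \<rho>) * elem_ld \<rho> s) has_sum g' s) Z"
proof -
  have cont: "continuous_on (cball \<sigma> R) (tail_log R \<rho>)" if "\<rho> \<in> Z" for \<rho>
  proof (cases "\<rho> \<in> head R")
    case True
    then show ?thesis by (simp add: tail_log_def[abs_def])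
  next
    case False
    have "continuous_on (cball 0 (1 / 2)) (weierstrass_log m)"
      by (intro DERIV_continuous_on[OF has_field_derivative_at_within[OF has_field_derivative_weierstrass_log]]) auto
    then have "continuous_on (cball \<sigma> R) (\<lambda>s. weierstrass_log m ((s - \<sigma>) / (\<rho> - \<sigma>)))"
      by (rule continuous_on_compose2)
        (use neq_sigma[OF that] tail_quotient_le[OF that False] in \<open>auto intro!: continuous_intros simp: dist_norm norm_minus_commute\<close>)
    then show ?thesis using False by (simp add: tail_log_def[abs_def] continuous_on_mult_left)
  qed
  have ev: "eventually (\<lambda>X. continuous_on (cball \<sigma> R) (\<lambda>s. \<Sum>\<rho>\<in>X. tail_log R \<rho> s) \<and>
     (\<forall>w\<in>ball \<sigma> R. ((\<lambda>s. \<Sum>\<rho>\<in>X. tail_log R \<rho> s) has_field_derivative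
        (\<Sum>\<rho>\<in>X. if \<rho> \<in> head R then 0 else of_int (n \<rho>) * elem_ld \<rho> w)) (at w))) (finite_subsets_at_top Z)"
    (is "eventually ?P _")
  proof (rule eventually_mono[OF eventually_superset[of "{}"]])
    fix X assume X: "finite X \<and> {} \<subseteq> X \<and> X \<subseteq> Z"
    then show "?P X"
      by (intro conjI ballI continuous_on_sum cont DERIV_sum has_field_derivative_tail_log)
         (auto simp: dist_norm norm_minus_commute)
  qed auto
  obtain g' where "\<And>w. w \<in> ball \<sigma> R \<Longrightarrow> (tail_sum R has_field_derivative g' w) (at w) \<and>
     ((\<lambda>X. \<Sum>\<rho>\<in>X. if \<rho> \<in> head R then 0 else of_int (n \<rho>) * elem_ld \<rho> w) \<longlongrightarrow> g' w) (finite_subsets_at_top Z)"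
    by (rule has_complex_derivative_uniform_limit[OF ev uniform_limit_tail _ assms]) auto
  then show ?thesis using that[of g'] by (auto simp: has_sum_def)
qed

lemma has_logderiv_cprod:
  assumes "s \<notin> Z"
  obtains J where "((\<lambda>\<rho>. of_int (n \<rho>) * elem_ld \<rho> s) has_sum J) Z" "has_logderiv cprod J s"
proof -
  define R where "R = norm (s - \<sigma>) + 1"
  have R: "R > 0" "s \<in> ball \<sigma> R" unfolding R_def by (auto simp: dist_norm norm_minus_commute intro: add_nonneg_pos)
  from tail_sum_derivative[OF R(1)] obtain g' where g': "(tail_sum R has_field_derivative g' s) (at s)"
    "((\<lambda>\<rho>. if \<rho> \<in> head R then 0 else of_int (n \<rho>) * elem_ld \<rho> s) has_sum g' s) Z"
    using R(2) by metis
  define H where "H = (\<Sum>\<rho>\<in>head R. of_int (n \<rho>) * elem_ld \<rho> s)"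
  have "has_logderiv (head_prod R) H s"
    unfolding head_prod_def[abs_def] H_def
    by (intro has_logderiv_prod finite_head has_logderiv_powi has_logderiv_elem) (use assms head_subset in auto)
  then have "has_logderiv (\<lambda>s. head_prod R s * exp (tail_sum R s)) (H + g' s) s"
    by (intro has_logderiv_mult has_logderiv_exp g')
  then have 1: "has_logderiv cprod (H + g' s) s"
    by (rule has_logderiv_transform[OF _ open_ball R(2)])
       (simp add: cprod_eq[of _ R] dist_norm norm_minus_commute)
  have "((\<lambda>\<rho>. if \<rho> \<in> head R then of_int (n \<rho>) * elem_ld \<rho> s else 0) has_sum H) Z"
  proof (subst has_sum_cong_neutral)
    show "((\<lambda>\<rho>. of_int (n \<rho>) * elem_ld \<rho> s) has_sum H) (head R)"
      unfolding H_def by (rule has_sum_finite[OF finite_head])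
  qed (use head_subset in auto)
  from has_sum_add[OF this g'(2)]
  have "((\<lambda>\<rho>. of_int (n \<rho>) * elem_ld \<rho> s) has_sum (H + g' s)) Z"
    by (rule has_sum_cong[THEN iffD1, rotated]) auto
  with 1 show ?thesis by (rule that[rotated])
qed

lemma analytic_tail_sum:
  assumes "R > 0"
  shows "tail_sum R analytic_on ball \<sigma> R"
proof (rule tail_sum_derivative[OF assms])
  fix g' assume "\<And>s. s \<in> ball \<sigma> R \<Longrightarrow> (tail_sum R has_field_derivative g' s) (at s)"
  then have "tail_sum R holomorphic_on ball \<sigma> R"
    by (intro holomorphic_onI) (metis field_differentiable_at_within field_differentiable_def)
  then show ?thesis by (simp add: analytic_on_open)
qed

text \<open>Both bounds have an exponent proportional to \<open>norm u ^ Suc m\<close>, where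
  \<open>u\<close> is the quotient, so that over all factors the exponents add up to a multiple of
  \<open>total\<close>. For small \<open>u\<close> this is \<open>norm_weierstrass_log_le\<close>.
  Otherwise \<open>b = (2 * norm u) ^ Suc m\<close> is at least 1 and dominates all lower powers:
  the polynomial part costs \<open>m * b\<close>, the factor \<open>1 - u\<close> at most
  \<open>2 * b * (R / \<delta>)\<close>, whence \<open>m + 2\<close>.\<close>

lemma elem_bounds:
  assumes \<rho>: "\<rho> \<in> Z" and s: "norm (s - \<sigma>) \<le> R" and R: "R \<ge> 1" and \<delta>: "0 < \<delta>" "\<delta> \<le> 1" "\<delta> \<le> norm (s - \<rho>)"
  defines "c \<equiv> (real m + 2) * 2 ^ Suc m * (R / \<delta>) * norm ((s - \<sigma>) / (\<rho> - \<sigma>)) ^ Suc m"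
  shows "exp (- c) \<le> norm (elem \<rho> s)" "norm (elem \<rho> s) \<le> exp c"
proof -
  define u where "u = (s - \<sigma>) / (\<rho> - \<sigma>)"
  have R\<delta>: "R / \<delta> \<ge> 1" using R \<delta> by (simp add: field_simps)
  have c: "c = ((real m + 2) * (R / \<delta>)) * (2 * norm u) ^ Suc m"
    unfolding c_def u_def by (simp add: power_mult_distrib)
  have ne: "\<rho> \<noteq> \<sigma>" "\<rho> \<noteq> s" using neq_sigma[OF \<rho>] \<delta> by auto
  then have u1: "u \<noteq> 1" by (auto simp: u_def)
  have "exp (- c) \<le> norm (elem \<rho> s) \<and> norm (elem \<rho> s) \<le> exp c"
  proof (cases "norm u \<le> 1 / 2")
    case True
    have "norm (weierstrass_log m u) \<le> 2 * norm u ^ Suc m" by (rule norm_weierstrass_log_le[OF True])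
    also have "\<dots> \<le> (2 * norm u) ^ Suc m"
      unfolding power_mult_distrib by (intro mult_right_mono) auto
    also have "\<dots> \<le> c" unfolding c
    proof -
      have "1 * 1 \<le> (real m + 2) * (R / \<delta>)" using R\<delta> by (intro mult_mono) auto
      then show "(2 * norm u) ^ Suc m \<le> ((real m + 2) * (R / \<delta>)) * (2 * norm u) ^ Suc m"
        using mult_right_mono[of 1 "(real m + 2) * (R / \<delta>)" "(2 * norm u) ^ Suc m"] by simp
    qed
    finally have "\<bar>Re (weierstrass_log m u)\<bar> \<le> c" using abs_Re_le_cmod order_trans by blast
    moreover have "elem \<rho> s = exp (weierstrass_log m u)"
      unfolding elem_def using exp_weierstrass_log[OF u1] by (simp add: u_def)
    ultimately show ?thesis by (simp add: norm_exp_eq_Re abs_le_iff)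
  next
    case False
    define b where "b = (2 * norm u) ^ Suc m"
    have b1: "b \<ge> 1" unfolding b_def using False by (intro one_le_power) auto
    have le_b: "norm u ^ k \<le> b" if "k \<le> Suc m" for k
    proof -
      have "norm u ^ k \<le> (2 * norm u) ^ k" by (intro power_mono) auto
      also have "\<dots> \<le> b" unfolding b_def using False that by (intro power_increasing) auto
      finally show ?thesis .
    qed
    define T where "T = (\<Sum>k=1..m. u ^ k / of_nat k)"
    have "norm T \<le> (\<Sum>k=1..m. b)"
      unfolding T_def
    proof (rule sum_norm_le)
      fix k assume k: "k \<in> {1..m}"
      have "norm (u ^ k / of_nat k) = norm u ^ k / real k" by (simp add: norm_divide norm_power)
      also have "\<dots> \<le> norm u ^ k / 1" using k by (intro divide_left_mono) auto
      also have "\<dots> \<le> b" using le_b[of k] k by simp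
      finally show "norm (u ^ k / of_nat k) \<le> b" .
    qed
    then have T: "\<bar>Re T\<bar> \<le> m * b" using abs_Re_le_cmod[of T] by simp
    have E: "norm (elem \<rho> s) = norm (1 - u) * exp (Re T)"
      unfolding elem_def weierstrass_factor_def T_def u_def by (simp add: norm_mult norm_exp_eq_Re)
    have up: "norm (1 - u) \<le> exp (b * (R / \<delta>))"
    proof -
      have "norm (1 - u) \<le> 1 + norm u" using norm_triangle_ineq4[of 1 u] by simp
      also have "\<dots> \<le> exp (norm u)" by (rule exp_ge_add_one_self)
      also have "norm u \<le> b * (R / \<delta>)" using le_b[of 1] mult_mono[of "norm u" b 1 "R / \<delta>"] R\<delta> b1 by simp
      finally show ?thesis by simp
    qed
    have lo: "norm (1 - u) \<ge> exp (- (2 * b * (R / \<delta>)))"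
    proof -
      \<comment> \<open>Only points at distance at most \<open>2 * R\<close> have
        \<open>norm u > 1 / 2\<close>, so the distance \<delta> from \<open>s\<close> to \<rho>
        bounds \<open>norm (1 - u)\<close> from below.\<close>
      have "norm (\<rho> - \<sigma>) \<le> 2 * R"
        using False s ne by (auto simp: u_def norm_divide field_simps)
      moreover have "1 - u = (\<rho> - s) / (\<rho> - \<sigma>)" using ne by (simp add: u_def field_simps)
      moreover have "norm (\<rho> - \<sigma>) > 0" using ne by simp
      ultimately have "norm (1 - u) \<ge> \<delta> / (2 * R)"
        using \<delta> by (auto simp: norm_divide norm_minus_commute intro!: frac_le)
      moreover have "exp (- (2 * b * (R / \<delta>))) \<le> \<delta> / (2 * R)"
      proof -
        have "2 * R / \<delta> \<le> 2 * b * (R / \<delta>)" using mult_right_mono[OF b1, of "R / \<delta>"] R\<delta> by simp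
        also have "\<dots> \<le> exp (2 * b * (R / \<delta>))" using exp_ge_add_one_self[of "2 * b * (R / \<delta>)"] by linarith
        finally have "1 / exp (2 * b * (R / \<delta>)) \<le> 1 / (2 * R / \<delta>)"
          using R \<delta> by (intro divide_left_mono) auto
        then show ?thesis by (simp add: exp_minus field_simps)
      qed
      ultimately show ?thesis by linarith
    qed
    have mb: "m * b + 2 * b * (R / \<delta>) \<le> c"
    proof -
      have "m * b * 1 \<le> m * b * (R / \<delta>)" using R\<delta> b1 by (intro mult_left_mono) auto
      then show ?thesis unfolding c b_def[symmetric] by (simp add: algebra_simps)
    qed
    have "exp (- c) \<le> exp (- (2 * b * (R / \<delta>))) * exp (Re T)"
      using mb T by (simp flip: exp_add)
    also have "\<dots> \<le> norm (elem \<rho> s)" unfolding E using lo by (intro mult_right_mono) auto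
    finally have 1: "exp (- c) \<le> norm (elem \<rho> s)" .
    have "norm (elem \<rho> s) \<le> exp (b * (R / \<delta>)) * exp (Re T)" unfolding E using up by (intro mult_right_mono) auto
    also have "\<dots> \<le> exp c"
    proof -
      have "b * (R / \<delta>) \<ge> 0" using b1 R\<delta> by (intro mult_nonneg_nonneg) auto
      then have "b * (R / \<delta>) + Re T \<le> c" using mb abs_le_D1[OF T]
        by argo
      then show ?thesis by (simp flip: exp_add)
    qed
    finally show ?thesis using 1 by blast
  qed
  then show "exp (- c) \<le> norm (elem \<rho> s)" "norm (elem \<rho> s) \<le> exp c" by auto
qed

text \<open>The estimate for finite products is uniform in the set of factors and passes to the
  limit. The factor \<open>R / \<delta>\<close> is affordable because the radii will be chosen with
  \<open>1 / \<delta>\<close> of polynomial size.\<close>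

lemma cprod_lower_bound:
  assumes s: "norm (s - \<sigma>) \<le> R" and R: "R \<ge> 1" and \<delta>: "0 < \<delta>" "\<delta> \<le> 1" "\<And>\<rho>. \<rho> \<in> Z \<Longrightarrow> \<delta> \<le> norm (s - \<rho>)"
  shows "norm (cprod s) \<ge> exp (- ((real m + 2) * 2 ^ Suc m * (R / \<delta>) * R ^ Suc m * total))"
proof -
  let ?K = "(real m + 2) * 2 ^ Suc m * (R / \<delta>)"
  have K: "?K \<ge> 0" using R \<delta> by simp
  have "norm (\<Prod>\<rho>\<in>X. elem \<rho> s powi n \<rho>) \<ge> exp (- (?K * R ^ Suc m * total))" if X: "finite X" "X \<subseteq> Z" for X
  proof -
    have "?K * norm ((s - \<sigma>) / (\<rho> - \<sigma>)) ^ Suc m * \<bar>of_int (n \<rho>)\<bar> \<le> ?K * R ^ Suc m * (real_of_int \<bar>n \<rho>\<bar> / norm (\<rho> - \<sigma>) ^ Suc m)" for \<rho>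
    proof -
      have "norm (s - \<sigma>) ^ Suc m \<le> R ^ Suc m" using s by (intro power_mono) auto
      then have "?K * (norm (s - \<sigma>) ^ Suc m / norm (\<rho> - \<sigma>) ^ Suc m) * \<bar>of_int (n \<rho>)\<bar> \<le>
          ?K * (R ^ Suc m / norm (\<rho> - \<sigma>) ^ Suc m) * \<bar>of_int (n \<rho>)\<bar>"
        using K by (intro mult_right_mono mult_left_mono divide_right_mono) auto
      then show ?thesis by (simp add: norm_divide power_divide)
    qed
    then have "(\<Sum>\<rho>\<in>X. ?K * norm ((s - \<sigma>) / (\<rho> - \<sigma>)) ^ Suc m * \<bar>of_int (n \<rho>)\<bar>) \<le>
       (\<Sum>\<rho>\<in>X. ?K * R ^ Suc m * (real_of_int \<bar>n \<rho>\<bar> / norm (\<rho> - \<sigma>) ^ Suc m))"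
      by (intro sum_mono)
    also have "\<dots> \<le> ?K * R ^ Suc m * total"
      unfolding sum_distrib_left[symmetric] using sum_le_total[OF X] R \<delta> by (intro mult_left_mono mult_nonneg_nonneg) auto
    finally have "exp (- (?K * R ^ Suc m * total)) \<le> exp (\<Sum>\<rho>\<in>X. - (?K * norm ((s - \<sigma>) / (\<rho> - \<sigma>)) ^ Suc m * \<bar>of_int (n \<rho>)\<bar>))"
      by (simp add: sum_negf)
    also have "\<dots> = (\<Prod>\<rho>\<in>X. exp (- (?K * norm ((s - \<sigma>) / (\<rho> - \<sigma>)) ^ Suc m * \<bar>of_int (n \<rho>)\<bar>)))"
      by (rule exp_sum[OF X(1)])
    also have "\<dots> \<le> (\<Prod>\<rho>\<in>X. norm (elem \<rho> s powi n \<rho>))"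
      using X elem_bounds[OF _ s R \<delta>(1,2)] \<delta>(3) by (intro prod_mono conjI norm_powi_lower) auto
    finally show ?thesis by (simp add: prod_norm)
  qed
  then have ev: "eventually (\<lambda>X. norm (\<Prod>\<rho>\<in>X. elem \<rho> s powi n \<rho>) \<ge> exp (- (?K * R ^ Suc m * total))) (finite_subsets_at_top Z)"
    by (intro eventually_finite_subsets_at_top_weakI)
  show ?thesis
    by (rule tendsto_lowerbound[OF tendsto_norm[OF tendsto_cprod] ev]) simp
qed

end


section \<open>Entire functions of polynomial mean growth\<close>

lemma has_integral_circle_coeff:
  fixes h :: "complex \<Rightarrow> complex"
  assumes h: "h holomorphic_on UNIV" and r: "r > 0"
  shows "((\<lambda>t. h (of_real r * cis t) * cis (- (real k * t))) has_integral
            2 * pi * of_real r ^ k * ((deriv ^^ k) h 0 / fact k)) {0..2 * pi}"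
proof -
  have "((\<lambda>u. h u / (u - 0) ^ Suc k) has_contour_integral (2 * pi * \<i>) / fact k * (deriv ^^ k) h 0) (circlepath 0 r)"
    by (rule Cauchy_has_contour_integral_higher_derivative_circlepath)
       (use r h in \<open>auto intro: holomorphic_on_imp_continuous_on holomorphic_on_subset\<close>)
  then have "((\<lambda>t. h (of_real r * cis t) / (of_real r * cis t) ^ Suc k * of_real r * \<i> * cis t) has_integral
     (2 * pi * \<i>) / fact k * (deriv ^^ k) h 0) {0..2 * pi}"
    unfolding circlepath_def by (subst (asm) has_contour_integral_part_circlepath_iff) auto
  then have "((\<lambda>t. (of_real r ^ k / \<i>) * (h (of_real r * cis t) / (of_real r * cis t) ^ Suc k * of_real r * \<i> * cis t)) has_integral
     (of_real r ^ k / \<i>) * ((2 * pi * \<i>) / fact k * (deriv ^^ k) h 0)) {0..2 * pi}"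
    by (rule has_integral_mult_right)
  moreover have "(of_real r ^ k / \<i>) * (h (of_real r * cis t) / (of_real r * cis t) ^ Suc k * of_real r * \<i> * cis t)
      = h (of_real r * cis t) * cis (- (real k * t))" for t
  proof -
    have "cis (- (real k * t)) = inverse (cis t ^ k)"
      by (simp add: Complex.DeMoivre flip: cis_inverse)
    then show ?thesis using r by (simp add: field_simps power_mult_distrib)
  qed
  ultimately show ?thesis by (simp add: field_simps)
qed

text \<open>The Fourier coefficients of \<open>Re h\<close> on a circle are, up to the factor \<open>r\<^sup>k\<close>,
  the Taylor coefficients of \<open>h\<close>, and \<open>\<bar>Re h\<bar> = 2 max 0 (Re h) - Re h\<close> has the same order of
  growth in the mean as \<open>max 0 (Re h)\<close>.\<close>

lemma taylor_coeff_bound_mean: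
  fixes h :: "complex \<Rightarrow> complex"
  assumes h: "h holomorphic_on UNIV" and r: "r > 0" and k: "k > 0"
    and I: "((\<lambda>t. max 0 (Re (h (of_real r * cis t)))) has_integral I) {0..2 * pi}"
  shows "2 * pi * r ^ k * norm ((deriv ^^ k) h 0 / fact k) \<le> 4 * I + 4 * pi * norm (h 0)"
proof -
  define H where "H = (\<lambda>t. h (of_real r * cis t))"
  define c where "c = (deriv ^^ k) h 0 / fact k"
  have 1: "((\<lambda>t. H t * cis (- (real k * t))) has_integral 2 * pi * of_real r ^ k * c) {0..2 * pi}"
    unfolding H_def c_def by (rule has_integral_circle_coeff[OF h r])
  \<comment> \<open>The negative Fourier coefficients of \<open>h\<close> on the circle vanish, by
    Cauchy's theorem for \<open>h u * u ^ k\<close>. After conjugation this allows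
    \<open>cnj (H t)\<close> to be added in the integral \<open>1\<close>, which replaces
    \<open>H t\<close> by twice its real part.\<close>
  have "((\<lambda>t. h (of_real r * cis t) * (of_real r * cis t) ^ k * cis (- (real 0 * t))) has_integral
     2 * pi * of_real r ^ 0 * ((deriv ^^ 0) (\<lambda>u. h u * u ^ k) 0 / fact 0)) {0..2 * pi}"
    by (rule has_integral_circle_coeff[of "\<lambda>u. h u * u ^ k"]) (use h r in \<open>auto intro!: holomorphic_intros\<close>)
  then have "((\<lambda>t. H t * (of_real r * cis t) ^ k) has_integral 0) {0..2 * pi}"
    using k by (simp add: H_def zero_power)
  then have "((\<lambda>t. H t * (of_real r * cis t) ^ k / of_real r ^ k) has_integral 0 / of_real r ^ k) {0..2 * pi}"
    by (rule has_integral_divide)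
  then have "((\<lambda>t. H t * cis (real k * t)) has_integral 0) {0..2 * pi}"
    using r by (simp add: power_mult_distrib Complex.DeMoivre)
  then have "((cnj \<circ> (\<lambda>t. H t * cis (real k * t))) has_integral cnj 0) {0..2 * pi}"
    by (subst has_integral_cnj)
  then have "((\<lambda>t. cnj (H t) * cis (- (real k * t))) has_integral 0) {0..2 * pi}"
    by (simp add: o_def cis_cnj)
  from has_integral_add[OF 1 this]
  have 2: "((\<lambda>t. 2 * of_real (Re (H t)) * cis (- (real k * t))) has_integral 2 * pi * of_real r ^ k * c) {0..2 * pi}"
    by (simp add: complex_add_cnj flip: distrib_right)
  have "((\<lambda>t. H t) has_integral 2 * pi * h 0) {0..2 * pi}"
    using has_integral_circle_coeff[OF h r, of 0] by (simp add: H_def)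
  from has_integral_linear[OF this bounded_linear_Re]
  have "((\<lambda>t. Re (H t)) has_integral 2 * pi * Re (h 0)) {0..2 * pi}"
    by (simp add: o_def)
  from has_integral_diff[OF has_integral_mult_right[OF I, of 4] has_integral_mult_right[OF this, of 2]]
  have 3: "((\<lambda>t. 2 * \<bar>Re (H t)\<bar>) has_integral 4 * I - 2 * (2 * pi * Re (h 0))) {0..2 * pi}"
    by (rule has_integral_eq[rotated]) (auto simp: H_def)
  have "norm (2 * pi * of_real r ^ k * c) \<le> 4 * I - 2 * (2 * pi * Re (h 0))"
    unfolding integral_unique[OF 2, symmetric] integral_unique[OF 3, symmetric]
    by (rule integral_norm_bound_integral[OF has_integral_integrable[OF 2] has_integral_integrable[OF 3]])
       (simp add: norm_mult)
  also have "\<dots> \<le> 4 * I + 4 * pi * norm (h 0)"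
    using mult_left_mono[of "- Re (h 0)" "norm (h 0)" "4 * pi"] abs_Re_le_cmod[of "h 0"] by (simp add: abs_le_iff)
  finally show ?thesis using r by (simp add: norm_mult norm_power c_def norm_divide)
qed

text \<open>A Liouville argument for each Taylor coefficient of index above \<open>A\<close>. The
  bound is asked only for arbitrarily large radii, because in the application the circles must avoid
  the divisor.\<close>

lemma entire_polynomial_if_mean_bound:
  fixes h :: "complex \<Rightarrow> complex"
  assumes h: "h holomorphic_on UNIV"
    and bd: "\<And>r0. \<exists>r\<ge>r0. \<exists>I. I \<le> C * r ^ A \<and>
            ((\<lambda>t. max 0 (Re (h (of_real r * cis t)))) has_integral I) {0..2 * pi}"
  obtains Q where "\<And>s. h s = poly Q s"
proof -
  have "(deriv ^^ k) h 0 / fact k = 0" if k: "k > A" for k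
  proof (rule ccontr)
    let ?c = "norm ((deriv ^^ k) h 0 / fact k)"
    assume "(deriv ^^ k) h 0 / fact k \<noteq> 0"
    then have c: "?c > 0" by (subst zero_less_norm_iff)
    \<comment> \<open>For \<open>r \<ge> 1\<close> the right-hand side of
      \<open>taylor_coeff_bound_mean\<close> is at most \<open>K * r ^ A\<close>, so a radius
      \<open>r \<ge> K / ?c\<close> is already contradictory.\<close>
    define K where "K = 4 * \<bar>C\<bar> + 4 * pi * norm (h 0)"
    have K: "K \<ge> 0" by (simp add: K_def)
    obtain r I where r: "r \<ge> max 1 (K / ?c)" and I: "I \<le> C * r ^ A"
        "((\<lambda>t. max 0 (Re (h (of_real r * cis t)))) has_integral I) {0..2 * pi}"
      using bd by blast
    have r1: "r \<ge> 1" using r by auto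
    have "?c * r * r ^ A \<le> ?c * r ^ k"
      using power_increasing[of "Suc A" k r] that r1 by (auto intro!: mult_left_mono simp: mult.assoc)
    also have "\<dots> < 2 * pi * r ^ k * ?c"
      using c r1 pi_gt3 by (simp add: field_simps)
    also have "\<dots> \<le> 4 * I + 4 * pi * norm (h 0)"
      by (rule taylor_coeff_bound_mean[OF h _ _ I(2)]) (use r1 that in auto)
    also have "\<dots> \<le> 4 * (\<bar>C\<bar> * r ^ A) + 4 * pi * norm (h 0) * r ^ A"
    proof (intro add_mono mult_left_mono)
      show "I \<le> \<bar>C\<bar> * r ^ A"
        using I(1) mult_right_mono[of C "\<bar>C\<bar>" "r ^ A"] r1 by (meson abs_ge_self order_trans zero_le_power zero_le_one)
      show "4 * pi * norm (h 0) \<le> 4 * pi * norm (h 0) * r ^ A"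
        using mult_left_mono[OF one_le_power[OF r1], of "4 * pi * norm (h 0)" A] by auto
    qed auto
    also have "\<dots> = K * r ^ A" by (simp add: K_def algebra_simps)
    finally have "?c * r < K" using r1 by simp
    moreover have "K \<le> ?c * r" using r c by (simp add: divide_le_eq mult.commute)
    ultimately show False by simp
  qed
  then have zero: "(deriv ^^ k) h 0 / fact k = 0" if "k \<notin> {..A}" for k
    using that by auto
  define Q where "Q = (\<Sum>k\<le>A. monom ((deriv ^^ k) h 0 / fact k) k)"
  have "h s = poly Q s" for s
  proof -
    have "((\<lambda>k. (deriv ^^ k) h 0 / fact k * (s - 0) ^ k) sums h s)"
      by (rule holomorphic_power_series[of h 0 "norm s + 1"]) (use h in \<open>auto intro: holomorphic_on_subset\<close>)
    moreover have "((\<lambda>k. (deriv ^^ k) h 0 / fact k * (s - 0) ^ k) sums (\<Sum>k\<le>A. (deriv ^^ k) h 0 / fact k * (s - 0) ^ k))"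
      by (rule sums_finite) (use zero in auto)
    ultimately show ?thesis
      by (auto simp: Q_def poly_sum poly_monom dest: sums_unique2)
  qed
  then show ?thesis by (rule that)
qed


section \<open>Factorization by canonical products\<close>

text \<open>The order of \<open>f\<close> at \<open>p\<close> is \<open>k\<close>, in a form that
  multiplies without conditions on singularities and ignores the value of \<open>f\<close> at
  \<open>p\<close> itself.\<close>

definition monomial_near :: "(complex \<Rightarrow> complex) \<Rightarrow> complex \<Rightarrow> int \<Rightarrow> bool" where
  "monomial_near f p k \<longleftrightarrow> (\<exists>g. g analytic_on {p} \<and> g p \<noteq> 0 \<and> eventually (\<lambda>s. f s = (s - p) powi k * g s) (at p))"

lemma monomial_nearI_analytic:
  "f analytic_on {p} \<Longrightarrow> f p \<noteq> 0 \<Longrightarrow> monomial_near f p 0"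
  unfolding monomial_near_def by auto

lemma monomial_near_ident: "monomial_near (\<lambda>s. s - p) p 1"
  unfolding monomial_near_def by (intro exI[of _ "\<lambda>_. 1"]) auto

lemma monomial_near_mult:
  assumes "monomial_near f p k" "monomial_near g p l"
  shows "monomial_near (\<lambda>s. f s * g s) p (k + l)"
proof -
  from assms obtain F G where FG: "F analytic_on {p}" "F p \<noteq> 0" "eventually (\<lambda>s. f s = (s - p) powi k * F s) (at p)"
    "G analytic_on {p}" "G p \<noteq> 0" "eventually (\<lambda>s. g s = (s - p) powi l * G s) (at p)"
    unfolding monomial_near_def by blast
  have "eventually (\<lambda>s. s \<noteq> p) (at p)" by (rule eventually_neq_at_within)
  with FG(3,6) have "eventually (\<lambda>s. f s * g s = (s - p) powi (k + l) * (F s * G s)) (at p)"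
    by eventually_elim (simp add: power_int_add)
  moreover have "(\<lambda>s. F s * G s) analytic_on {p}" by (intro analytic_intros FG)
  ultimately show ?thesis unfolding monomial_near_def using FG(2,5) by (intro exI[of _ "\<lambda>s. F s * G s"]) auto
qed

lemma monomial_near_powi:
  assumes "monomial_near f p k"
  shows "monomial_near (\<lambda>s. f s powi l) p (k * l)"
proof -
  from assms obtain F where F: "F analytic_on {p}" "F p \<noteq> 0" "eventually (\<lambda>s. f s = (s - p) powi k * F s) (at p)"
    unfolding monomial_near_def by blast
  from F(3) have "eventually (\<lambda>s. f s powi l = (s - p) powi (k * l) * (F s powi l)) (at p)"
    by eventually_elim (simp add: power_int_mult_distrib power_int_mult)
  moreover have "(\<lambda>s. F s powi l) analytic_on {p}" by (intro analytic_intros F) (use F in auto)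
  ultimately show ?thesis unfolding monomial_near_def using F(2) by (intro exI[of _ "\<lambda>s. F s powi l"]) auto
qed

lemma monomial_near_prod:
  assumes "finite A" "\<And>x. x \<in> A \<Longrightarrow> monomial_near (f x) p (k x)"
  shows "monomial_near (\<lambda>s. \<Prod>x\<in>A. f x s) p (\<Sum>x\<in>A. k x)"
  using assms by (induction rule: finite_induct) (auto intro!: monomial_near_mult monomial_nearI_analytic)

lemma monomial_near_cong:
  assumes "monomial_near f p k" "eventually (\<lambda>s. f s = g s) (at p)"
  shows "monomial_near g p k"
proof -
  from assms(1) obtain F where F: "F analytic_on {p}" "F p \<noteq> 0" "eventually (\<lambda>s. f s = (s - p) powi k * F s) (at p)"
    unfolding monomial_near_def by blast
  from F(3) assms(2) have "eventually (\<lambda>s. g s = (s - p) powi k * F s) (at p)"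
    by eventually_elim simp
  with F show ?thesis unfolding monomial_near_def by blast
qed

text \<open>If all orders are 0, the limits of \<open>f\<close> define a zero-free entire function,
  which has a logarithm since the plane is contractible. The conclusion speaks of limits because
  \<open>f\<close> may have wrong values at removable singularities.\<close>

lemma monomial_near_0_imp_exp:
  assumes "\<And>p. monomial_near f p 0"
  obtains h where "h holomorphic_on UNIV" "\<And>p c. f \<midarrow>p\<rightarrow> c \<Longrightarrow> c = exp (h p)"
proof -
  define \<Psi> where "\<Psi> = (\<lambda>p. Lim (at p) f)"
  have loc: "\<Psi> analytic_on {p} \<and> \<Psi> p \<noteq> 0 \<and> f \<midarrow>p\<rightarrow> \<Psi> p" for p
  proof -
    from assms[of p] obtain g where g: "g analytic_on {p}" "g p \<noteq> 0" "eventually (\<lambda>s. f s = g s) (at p)"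
      unfolding monomial_near_def by auto
    obtain U where U: "open U" "p \<in> U" "g holomorphic_on U"
      using g(1) unfolding analytic_at by blast
    obtain V where V: "open V" "p \<in> V" "\<And>s. s \<in> V \<Longrightarrow> s \<noteq> p \<Longrightarrow> f s = g s"
      using g(3) unfolding eventually_at_topological by auto
    have lim: "f \<midarrow>q\<rightarrow> g q" if q: "q \<in> U \<inter> V" for q
    proof -
      have "g \<midarrow>q\<rightarrow> g q"
        using U q holomorphic_on_imp_continuous_on continuous_on_eq_continuous_at isCont_def by blast
      moreover have "eventually (\<lambda>s. g s = f s) (at q)"
      proof (cases "q = p")
        case True
        then show ?thesis using g(3) by (auto elim: eventually_mono)
      next
        case False
        have "eventually (\<lambda>s. s \<in> V - {p}) (at q)"
          by (rule eventually_at_in_open') (use V q False in auto)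
        then show ?thesis by (rule eventually_mono) (use V in auto)
      qed
      ultimately show ?thesis by (rule Lim_transform_eventually)
    qed
    have eq: "\<Psi> q = g q" if "q \<in> U \<inter> V" for q
      unfolding \<Psi>_def using lim[OF that] by (intro tendsto_Lim) auto
    have "\<Psi> holomorphic_on (U \<inter> V)"
      using holomorphic_on_subset[OF U(3)] by (rule holomorphic_transform) (auto simp: eq)
    then have "\<Psi> analytic_on {p}" unfolding analytic_at using U V by blast
    then show ?thesis using eq[of p] lim[of p] U V g by auto
  qed
  have "\<Psi> holomorphic_on UNIV"
    using loc by (intro analytic_imp_holomorphic) (metis analytic_on_analytic_at)
  then obtain h where h: "h holomorphic_on UNIV" "\<And>z. z \<in> UNIV \<Longrightarrow> \<Psi> z = exp (h z)"
    using contractible_imp_holomorphic_log[of \<Psi> UNIV] loc by (auto simp: convex_imp_contractible)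
  show ?thesis
  proof (rule that[OF h(1)])
    fix p c assume "f \<midarrow>p\<rightarrow> c"
    with loc[of p] have "c = \<Psi> p" by (metis LIM_unique)
    then show "c = exp (h p)" using h(2) by simp
  qed
qed

text \<open>Pigeonhole principle: the \<open>card S + 1\<close> candidates
  \<open>r0 + k / (card S + 1)\<close> are so far apart that each point of \<open>S\<close> is too
  close to at most one of them.\<close>

lemma exists_radius_avoiding:
  fixes S :: "real set"
  assumes "finite S"
  obtains r where "r0 \<le> r" "r \<le> r0 + 1" "\<And>x. x \<in> S \<Longrightarrow> 1 / (2 * (real (card S) + 1)) \<le> \<bar>x - r\<bar>"
proof (rule ccontr)
  note outer = that
  assume neg': "\<not> thesis"
  have neg: "\<exists>x\<in>S. \<bar>x - r\<bar> < 1 / (2 * (real (card S) + 1))" if r: "r0 \<le> r" "r \<le> r0 + 1" for r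
  proof (rule ccontr)
    assume "\<not> ?thesis"
    then have "\<And>x. x \<in> S \<Longrightarrow> 1 / (2 * (real (card S) + 1)) \<le> \<bar>x - r\<bar>" by (meson not_le_imp_less)
    with neg' outer[OF r] show False by blast
  qed
  define N where "N = card S"
  define p where "p = (\<lambda>k::nat. r0 + real k / (real N + 1))"
  have "\<forall>k\<in>{..N}. \<exists>x\<in>S. \<bar>x - p k\<bar> < 1 / (2 * (real N + 1))"
    unfolding N_def[symmetric] using neg by (auto simp: p_def N_def divide_le_eq)
  then obtain f where f: "\<And>k. k \<le> N \<Longrightarrow> f k \<in> S" "\<And>k. k \<le> N \<Longrightarrow> \<bar>f k - p k\<bar> < 1 / (2 * (real N + 1))"
    by (metis atMost_iff)
  have "inj_on f {..N}"
  proof (rule inj_onI)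
    fix j k assume jk: "j \<in> {..N}" "k \<in> {..N}" "f j = f k"
    have "\<bar>p j - p k\<bar> < 1 / (2 * (real N + 1)) + 1 / (2 * (real N + 1))"
      using f(2)[of j] f(2)[of k] jk by auto
    also have "\<dots> = 1 / (real N + 1)" by (simp add: field_simps)
    finally have "\<bar>p j - p k\<bar> * (real N + 1) < 1" by (simp add: pos_less_divide_eq)
    moreover have "p j - p k = (real j - real k) / (real N + 1)" by (simp add: p_def diff_divide_distrib)
    ultimately have "\<bar>real j - real k\<bar> < 1" by simp
    then show "j = k" by linarith
  qed
  then have "card {..N} \<le> card S" using f(1) assms by (intro card_inj_on_le) auto
  then show False by (simp add: N_def)
qed

section \<open>Comparison of a meromorphic function with its canonical product\<close>

context canonical_divisor
begin

definition mprod :: "int \<Rightarrow> complex \<Rightarrow> complex" where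
  "mprod k s = (s - \<sigma>) powi k * cprod s"

lemma monomial_near_elem:
  assumes "\<rho> \<in> Z"
  shows "monomial_near (elem \<rho>) p (if \<rho> = p then 1 else 0)"
proof (cases "\<rho> = p")
  case True
  have ne: "p \<noteq> \<sigma>" using neq_sigma assms True by auto
  define G where "G = (\<lambda>s. - exp (\<Sum>k=1..m. ((s - \<sigma>) / (p - \<sigma>)) ^ k / of_nat k) / (p - \<sigma>))"
  have "G analytic_on {p}" unfolding G_def using ne by (auto intro!: analytic_intros)
  moreover have "elem \<rho> s = (s - p) powi 1 * G s" for s
    unfolding elem_def True weierstrass_factor_def G_def using ne by (simp add: field_simps)
  ultimately show ?thesis unfolding monomial_near_def using True ne
    by (intro exI[of _ G]) (auto simp: G_def)
next
  case False
  have "elem \<rho> analytic_on {p}" unfolding elem_def[abs_def] using neq_sigma[OF assms] by (auto intro!: analytic_intros)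
  then show ?thesis using False elem_eq_0_iff[OF assms, of p] by (auto intro!: monomial_nearI_analytic)
qed

lemma monomial_near_mprod:
  "monomial_near (mprod k) p (if p = \<sigma> then k else if p \<in> Z then n p else 0)"
proof -
  define R where "R = norm (p - \<sigma>) + 1"
  have R: "R > 0" "p \<in> ball \<sigma> R" unfolding R_def by (auto simp: dist_norm norm_minus_commute intro: add_nonneg_pos)
  have 1: "monomial_near (\<lambda>s. (s - \<sigma>) powi k) p (if p = \<sigma> then k else 0)"
  proof (cases "p = \<sigma>")
    case True
    then show ?thesis using monomial_near_powi[OF monomial_near_ident[of p], of k] by simp
  next
    case False
    then show ?thesis by (auto intro!: monomial_nearI_analytic analytic_intros)
  qed
  have 2: "monomial_near (head_prod R) p (\<Sum>\<rho>\<in>head R. (if \<rho> = p then 1 else 0) * n \<rho>)"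
    unfolding head_prod_def[abs_def]
    by (intro monomial_near_prod finite_head monomial_near_powi monomial_near_elem) (use head_subset in auto)
  have "(\<Sum>\<rho>\<in>head R. (if \<rho> = p then 1 else 0) * n \<rho>) = (\<Sum>\<rho>\<in>head R. (if \<rho> = p then n \<rho> else 0))"
    by (intro sum.cong) auto
  also have "\<dots> = (if p \<in> head R then n p else 0)"
    by (simp add: finite_head)
  also have "p \<in> head R \<longleftrightarrow> p \<in> Z"
    by (auto simp: head_def R_def)
  finally have 2: "monomial_near (head_prod R) p (if p \<in> Z then n p else 0)" using 2 by simp
  have "tail_sum R analytic_on {p}"
    using analytic_tail_sum[OF R(1)] R(2) analytic_on_subset by blast
  then have 3: "monomial_near (\<lambda>s. exp (tail_sum R s)) p 0"
    by (intro monomial_nearI_analytic) (auto intro: analytic_intros)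
  have "eventually (\<lambda>s. s \<in> ball \<sigma> R) (at p)"
    by (rule eventually_at_in_open') (use R in auto)
  then have ev: "eventually (\<lambda>s. (s - \<sigma>) powi k * (head_prod R s * exp (tail_sum R s)) = mprod k s) (at p)"
    by (rule eventually_mono) (auto simp: mprod_def cprod_eq[of _ R] dist_norm norm_minus_commute)
  have "(if p = \<sigma> then k else 0) + ((if p \<in> Z then n p else 0) + 0) = (if p = \<sigma> then k else if p \<in> Z then n p else 0)"
    using sigma by auto
  then show ?thesis
    using monomial_near_cong[OF monomial_near_mult[OF 1 monomial_near_mult[OF 2 3]] ev] by simp
qed

lemma cprod_nonzero: "s \<notin> Z \<Longrightarrow> cprod s \<noteq> 0"
  using has_logderiv_cprod[of s] unfolding has_logderiv_def by blast

lemma isCont_cprod: "s \<notin> Z \<Longrightarrow> isCont cprod s"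
  using has_logderiv_cprod[of s] DERIV_isCont unfolding has_logderiv_def by blast

lemma cprod_zero:
  assumes "s \<in> Z"
  shows "cprod s = 0"
proof -
  define R where "R = norm (s - \<sigma>)"
  have "s \<in> head R" using assms by (simp add: head_def R_def)
  then have "head_prod R s = 0"
    unfolding head_prod_def using assms finite_head nz[OF assms]
    by (intro prod_zero) (auto simp: elem_eq_0_iff intro!: bexI[of _ s])
  then show ?thesis using cprod_eq[of s R] by (simp add: R_def)
qed

text \<open>The quotient of \<open>F\<close> by \<open>mprod k\<close> has order 0 everywhere, so it
  is \<open>exp h\<close> up to removable singularities. Where \<open>mprod k\<close> does not
  vanish the identity follows by continuity; elsewhere it reads \<open>0 = 0\<close>, by
  \<open>zero\<close> and \<open>zero'\<close> and because integer powers of 0 with nonzero exponent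
  are 0.\<close>

theorem factorization_exists:
  assumes F: "F nicely_meromorphic_on UNIV" and mF: "\<And>p. monomial_near F p (if p = \<sigma> then k else if p \<in> Z then n p else 0)"
    and zero: "\<And>p. \<not> is_pole F p \<Longrightarrow> p \<in> Z \<Longrightarrow> F p = 0"
    and zero': "\<not> is_pole F \<sigma> \<Longrightarrow> k \<noteq> 0 \<Longrightarrow> F \<sigma> = 0"
  obtains h where "h holomorphic_on UNIV" "\<And>s. \<not> is_pole F s \<Longrightarrow> F s = mprod k s * exp (h s)"
proof -
  have "monomial_near (\<lambda>s. F s * mprod k s powi (-1)) p 0" for p
    using monomial_near_mult[OF mF[of p] monomial_near_powi[OF monomial_near_mprod[of k p], of "-1"]] by simp
  from monomial_near_0_imp_exp[OF this] obtain h where h: "h holomorphic_on UNIV"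
    "\<And>p c. (\<lambda>s. F s * mprod k s powi (-1)) \<midarrow>p\<rightarrow> c \<Longrightarrow> c = exp (h p)" by blast
  show ?thesis
  proof (rule that[OF h(1)])
    fix s assume s: "\<not> is_pole F s"
    show "F s = mprod k s * exp (h s)"
    proof (cases "s \<in> Z \<or> (s = \<sigma> \<and> k \<noteq> 0)")
      case True
      then show ?thesis using zero[OF s] zero' s by (auto simp: mprod_def cprod_zero)
    next
      case False
      then have nz: "mprod k s \<noteq> 0" by (auto simp: mprod_def cprod_nonzero)
      have "isCont (\<lambda>s. (s - \<sigma>) powi k) s"
      proof (cases "k = 0")
        case False
        with \<open>\<not> (s \<in> Z \<or> s = \<sigma> \<and> k \<noteq> 0)\<close> show ?thesis by (intro continuous_intros) auto
      qed auto
      then have "isCont (mprod k) s"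
        unfolding mprod_def[abs_def] using False by (intro isCont_mult isCont_cprod) auto
      moreover have "isCont F s"
        using nicely_meromorphic_on_imp_analytic_at[OF F UNIV_I s] analytic_at_imp_isCont by blast
      ultimately have "isCont (\<lambda>s. F s * mprod k s powi (-1)) s"
        using nz by (intro continuous_intros) auto
      then have "F s * mprod k s powi (-1) = exp (h s)"
        unfolding isCont_def by (rule h(2))
      then show ?thesis using nz by (simp add: field_simps)
    qed
  qed
qed

text \<open>\<open>Re h\<close> is the logarithm of \<open>norm F\<close> minus that of the product.
  On suitable circles the first has a mean bounded by \<open>nev_m\<close>, and the second is
  bounded below by a negative multiple of a power of the radius.\<close>

theorem factorization_polynomial:
  assumes F: "F nicely_meromorphic_on UNIV" and poles: "\<And>p. is_pole F p \<Longrightarrow> p \<in> insert \<sigma> Z"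
    and h: "h holomorphic_on UNIV" "\<And>s. \<not> is_pole F s \<Longrightarrow> F s = mprod k s * exp (h s)"
    and growth: "eventually (\<lambda>r. nev_m F r \<le> r ^ A) at_top"
  obtains Q where "\<And>s. h s = poly Q s"
proof -
  \<comment> \<open>In \<open>cprod_lower_bound\<close> the exponent contains
    \<open>R ^ Suc m\<close> and \<open>R / \<delta>\<close>, and \<open>1 / \<delta>\<close> is
    again of size \<open>R ^ Suc m\<close>: altogether \<open>1 + 2 * Suc m\<close> powers of
    \<open>R\<close>. The factor \<open>2 ^ D\<close> in \<open>C1\<close> comes from
    \<open>R \<le> 2 * r\<close>.\<close>
  define D where "D = 2 * m + 3"
  define K where "K = (real m + 2) * 2 ^ Suc m"
  define C1 where "C1 = K * total * (2 * (total + 1)) * 2 ^ D"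
  define C where "C = 2 * pi + 2 * pi * C1 + 4 * pi * \<bar>of_int k\<bar>"
  have K: "K \<ge> 0" by (simp add: K_def)
  have C1: "C1 \<ge> 0" unfolding C1_def using K total_nonneg by simp
  obtain rA where rA: "\<And>r. r \<ge> rA \<Longrightarrow> nev_m F r \<le> r ^ A"
    using growth unfolding eventually_at_top_linorder by blast
  have "\<exists>r\<ge>r0. \<exists>I. I \<le> C * r ^ (A + D) \<and> ((\<lambda>t. max 0 (Re (h (of_real r * cis t)))) has_integral I) {0..2 * pi}" for r0
  proof -
    \<comment> \<open>The summand \<open>norm \<sigma> + 3\<close> keeps the circle at distance at
      least 1 from \<sigma> and makes \<open>R \<le> 2 * r1\<close> true.\<close>
    define r1 where "r1 = max (max r0 rA) (norm \<sigma> + 3)"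
    have r1: "r1 \<ge> r0" "r1 \<ge> rA" "r1 \<ge> norm \<sigma> + 3" "r1 \<ge> 3"
      using norm_ge_zero[of \<sigma>] unfolding r1_def by (auto simp: le_max_iff_disj)
    define R where "R = r1 + 3 + norm \<sigma>"
    have R: "R \<ge> 1" "R \<le> 2 * r1" using r1 norm_ge_zero[of \<sigma>] unfolding R_def by linarith+
    \<comment> \<open>The radius will be at most \<open>r1 + 1\<close>, so points beyond
      \<open>r1 + 2\<close> have distance at least 1 from the circle and need not be
      avoided.\<close>
    define Z' where "Z' = {\<rho>\<in>Z. norm \<rho> \<le> r1 + 2}"
    have Z'R: "norm (\<rho> - \<sigma>) \<le> R" if "\<rho> \<in> Z'" for \<rho>
      using that norm_triangle_ineq4[of \<rho> \<sigma>] by (auto simp: Z'_def R_def)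
    have "Z' \<subseteq> head R"
      using Z'R R by (force simp: head_def Z'_def)
    then have finZ': "finite Z'" using finite_head finite_subset by blast
    define S where "S = norm ` Z'"
    have "card S \<le> card Z'" unfolding S_def by (rule card_image_le[OF finZ'])
    moreover have "real (card Z') \<le> total * R ^ Suc m"
      by (rule card_ball_le[OF finZ']) (use Z'R R in \<open>auto simp: Z'_def\<close>)
    ultimately have cS: "real (card S) \<le> total * R ^ Suc m" by linarith
    obtain r where r: "r1 \<le> r" "r \<le> r1 + 1" "\<And>x. x \<in> S \<Longrightarrow> 1 / (2 * (real (card S) + 1)) \<le> \<bar>x - r\<bar>"
      using exists_radius_avoiding[of S r1] finZ' unfolding S_def by blast
    define \<delta> where "\<delta> = 1 / (2 * (real (card S) + 1))"
    have \<delta>: "0 < \<delta>" "\<delta> \<le> 1" unfolding \<delta>_def by (auto simp: divide_le_eq)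
    have far: "\<delta> \<le> norm (s - \<rho>)" if s: "norm s = r" and \<rho>: "\<rho> \<in> Z" for s \<rho>
    proof -
      have "\<delta> \<le> \<bar>norm \<rho> - r\<bar>"
      proof (cases "norm \<rho> \<le> r1 + 2")
        case True
        then show ?thesis using r(3)[of "norm \<rho>"] \<rho> unfolding \<delta>_def by (auto simp: S_def Z'_def)
      next
        case False
        then show ?thesis using r \<delta> by auto
      qed
      also have "\<dots> \<le> norm (\<rho> - s)" using norm_triangle_ineq3[of \<rho> s] s by simp
      finally show ?thesis by (simp add: norm_minus_commute)
    qed
    \<comment> \<open>The first term bounds the canonical product, the second the factor
      \<open>(s - \<sigma>) powi k\<close>, through
      \<open>exp (- (2 * r)) \<le> norm (s - \<sigma>) \<le> exp (2 * r)\<close>.\<close>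
    define B where "B = C1 * r ^ D + 2 * r * \<bar>of_int k\<bar>"
    have r': "r \<ge> 1" "r \<ge> r0" "r \<ge> rA" using r r1 by auto
    have B: "B \<ge> 0" unfolding B_def using C1 r' by simp
    have nopole: "\<not> is_pole F s" if s: "norm s = r" for s
    proof
      assume "is_pole F s"
      then have "s = \<sigma> \<or> s \<in> Z" using poles by auto
      then show False using far[OF s, of s] \<delta> s r1 r by auto
    qed
    have bound: "max 0 (Re (h s)) \<le> ln (max 1 (norm (F s))) + B" if s: "norm s = r" for s
    proof -
      have sR: "norm (s - \<sigma>) \<le> R" using norm_triangle_ineq4[of s \<sigma>] s r by (simp add: R_def)
      have "exp (- (K * (R / \<delta>) * R ^ Suc m * total)) \<le> norm (cprod s)"
        unfolding K_def by (rule cprod_lower_bound[OF sR R(1) \<delta>]) (rule far[OF s])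
      moreover have "K * (R / \<delta>) * R ^ Suc m * total \<le> C1 * r ^ D"
      proof -
        have "1 / \<delta> = 2 * (real (card S) + 1)" by (simp add: \<delta>_def)
        also have "\<dots> \<le> 2 * (total * R ^ Suc m + R ^ Suc m)"
          using cS one_le_power[OF R(1), of "Suc m"] by simp
        also have "\<dots> = 2 * (total + 1) * R ^ Suc m" by (simp add: algebra_simps)
        finally have "K * (R * (1 / \<delta>)) * R ^ Suc m * total \<le> K * (R * (2 * (total + 1) * R ^ Suc m)) * R ^ Suc m * total"
          using K R total_nonneg by (intro mult_right_mono mult_left_mono) auto
        also have "\<dots> = K * total * (2 * (total + 1)) * R ^ D"
        proof -
          have "R ^ D = R * R ^ Suc m * R ^ Suc m"
            unfolding D_def by (simp add: power_add[symmetric] mult_2 numeral_3_eq_3 flip: power_Suc)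
          then show ?thesis by (simp only: mult_ac)
        qed
        also have "\<dots> \<le> K * total * (2 * (total + 1)) * (2 * r) ^ D"
          using K R total_nonneg r by (intro mult_left_mono power_mono) auto
        also have "\<dots> = C1 * r ^ D" by (simp add: C1_def power_mult_distrib)
        finally show ?thesis by simp
      qed
      ultimately have c: "exp (- (C1 * r ^ D)) \<le> norm (cprod s)"
        by (meson exp_le_cancel_iff neg_le_iff_le order_trans)
      have "norm (s - \<sigma>) \<le> 2 * r" using sR R r by simp
      also have "\<dots> \<le> exp (2 * r)" using exp_ge_add_one_self[of "2 * r"] by linarith
      finally have up: "norm (s - \<sigma>) \<le> exp (2 * r)" .
      have "1 \<le> norm (s - \<sigma>)" using norm_triangle_ineq2[of s \<sigma>] s r1 r by simp
      moreover have "exp (- (2 * r)) \<le> 1" using r' by simp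
      ultimately have lo: "exp (- (2 * r)) \<le> norm (s - \<sigma>)" by linarith
      have pw: "exp (- (2 * r * \<bar>of_int k\<bar>)) \<le> norm ((s - \<sigma>) powi k)"
        by (rule norm_powi_lower[OF lo up])
      have "exp (- B) \<le> norm (mprod k s)"
        unfolding mprod_def norm_mult
        using mult_mono[OF pw c] by (simp add: B_def add.commute flip: exp_add)
      then have "exp (- B) * exp (Re (h s)) \<le> norm (F s)"
        unfolding h(2)[OF nopole[OF s]] norm_mult norm_exp_eq_Re by (intro mult_right_mono) auto
      then have le: "exp (Re (h s) - B) \<le> norm (F s)" by (simp add: exp_diff exp_minus field_simps)
      have "Re (h s) - B = ln (exp (Re (h s) - B))" by simp
      also have "\<dots> \<le> ln (max 1 (norm (F s)))"
        using le by (subst ln_le_cancel_iff) auto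
      finally show ?thesis using B by auto
    qed
    have circ: "norm (of_real r * cis t) = r" for t using r' by (simp add: norm_mult)
    have contF: "continuous_on {0..2 * pi} (\<lambda>t. F (of_real r * cis t))"
    proof (intro continuous_at_imp_continuous_on ballI)
      fix t
      have "isCont F (of_real r * cis t)"
        using nicely_meromorphic_on_imp_analytic_at[OF F UNIV_I nopole[OF circ]] analytic_at_imp_isCont by blast
      moreover have "continuous_on UNIV (\<lambda>t. of_real r * cis t)" by (intro continuous_intros)
      then have "isCont (\<lambda>t. of_real r * cis t) t" by (simp add: continuous_on_eq_continuous_at)
      ultimately show "isCont (\<lambda>t. F (of_real r * cis t)) t" by (rule isCont_o2[rotated])
    qed
    define G where "G = (\<lambda>t. ln (max 1 (norm (F (of_real r * cis t)))))"
    have contG: "continuous_on {0..2 * pi} G" unfolding G_def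
      by (intro continuous_intros contF) auto
    have "set_integrable lborel {0..2 * pi} G"
      using borel_integrable_atLeastAtMost'[OF contG] .
    from set_borel_integral_eq_integral(2)[OF this]
    have nev: "nev_m F r = integral {0..2 * pi} G / (2 * pi)"
      unfolding nev_m_def G_def by simp
    have conth: "continuous_on {0..2 * pi} (\<lambda>t. max 0 (Re (h (of_real r * cis t))))"
      by (intro continuous_intros continuous_on_compose2[OF holomorphic_on_imp_continuous_on[OF h(1)]]) auto
    let ?I = "integral {0..2 * pi} (\<lambda>t. max 0 (Re (h (of_real r * cis t))))"
    have "?I \<le> integral {0..2 * pi} (\<lambda>t. G t + B)"
      by (rule integral_le) (use bound[OF circ] conth contG in \<open>auto intro!: integrable_continuous_interval continuous_intros simp: G_def\<close>)
    also have "\<dots> = integral {0..2 * pi} G + 2 * pi * B"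
      by (subst integral_add) (use contG in \<open>auto intro!: integrable_continuous_interval\<close>)
    also have "integral {0..2 * pi} G = 2 * pi * nev_m F r" using nev by simp
    also have "2 * pi * nev_m F r + 2 * pi * B \<le> 2 * pi * r ^ A + 2 * pi * B"
      using rA[of r] r' by simp
    also have "\<dots> \<le> 2 * pi * r ^ (A + D) + (2 * pi * C1 * r ^ (A + D) + 4 * pi * \<bar>of_int k\<bar> * r ^ (A + D))"
    proof -
      have p: "r ^ A \<le> r ^ (A + D)" "r ^ D \<le> r ^ (A + D)" "r ^ 1 \<le> r ^ (A + D)"
        using r' by (intro power_increasing; simp add: D_def)+
      have "2 * pi * B = 2 * pi * C1 * r ^ D + 4 * pi * \<bar>of_int k\<bar> * r ^ 1" by (simp add: B_def algebra_simps)
      also have "\<dots> \<le> 2 * pi * C1 * r ^ (A + D) + 4 * pi * \<bar>of_int k\<bar> * r ^ (A + D)"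
        using p C1 by (intro add_mono mult_left_mono) auto
      finally show ?thesis using p by (intro add_mono mult_left_mono) auto
    qed
    also have "\<dots> = C * r ^ (A + D)" by (simp add: C_def algebra_simps)
    finally have "?I \<le> C * r ^ (A + D)" .
    moreover have "((\<lambda>t. max 0 (Re (h (of_real r * cis t)))) has_integral ?I) {0..2 * pi}"
      by (rule integrable_integral[OF integrable_continuous_interval[OF conth]])
    ultimately show ?thesis using r' by blast
  qed
  from entire_polynomial_if_mean_bound[OF h(1) this] that show ?thesis by blast
qed

end


section \<open>Hadamard factorization of functions of finite order\<close>

lemma nicely_meromorphic_at:
  assumes "F nicely_meromorphic_on UNIV"
  shows "isolated_singularity_at F p" "not_essential F p"
proof -
  have "F meromorphic_on {p}" using assms meromorphic_on_subset unfolding nicely_meromorphic_on_def by blast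
  then show "isolated_singularity_at F p" "not_essential F p"
    using meromorphic_on_isolated_singularity meromorphic_on_not_essential by blast+
qed

lemma nonconst_frequently_nonzero:
  assumes F: "F nicely_meromorphic_on UNIV" and nc: "\<not> F constant_on UNIV"
  shows "frequently (\<lambda>w. F w \<noteq> 0) (at p)"
proof -
  have "\<not> (\<forall>x\<in>UNIV. F x = 0)" using nc unfolding constant_on_def by auto
  then have "\<forall>\<^sub>\<approx>x\<in>UNIV. F x \<noteq> 0"
    using nicely_meromorphic_imp_constant_or_avoid[OF F open_UNIV connected_UNIV, of 0] by blast
  then have "eventually (\<lambda>w. F w \<noteq> 0) (at p)"
    by (simp add: eventually_cosparse_open_eq)
  then show ?thesis by (rule eventually_frequently[rotated]) simp
qed

lemma monomial_near_zorder:
  assumes F: "F nicely_meromorphic_on UNIV" and nc: "\<not> F constant_on UNIV"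
  shows "monomial_near F p (zorder F p)"
proof -
  obtain r where r: "zor_poly F p p \<noteq> 0" "r > 0" "zor_poly F p holomorphic_on cball p r"
    "\<And>w. w \<in> cball p r - {p} \<Longrightarrow> F w = zor_poly F p w * (w - p) powi zorder F p"
    using zorder_exist[OF nicely_meromorphic_at[OF F] nonconst_frequently_nonzero[OF F nc], of p] by blast
  have "zor_poly F p analytic_on {p}"
    unfolding analytic_at using r(2) holomorphic_on_subset[OF r(3) ball_subset_cball] by (intro exI[of _ "ball p r"]) auto
  moreover have "eventually (\<lambda>w. w \<in> ball p r - {p}) (at p)"
    using r(2) by (intro eventually_at_in_open) auto
  then have "eventually (\<lambda>s. F s = (s - p) powi zorder F p * zor_poly F p s) (at p)"
    by (rule eventually_mono) (simp add: r(4) mult.commute)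
  ultimately show ?thesis unfolding monomial_near_def using r(1) by blast
qed

lemma is_pole_imp_divisor:
  assumes "F nicely_meromorphic_on UNIV" "is_pole F p"
  shows "zorder F p < 0" "p \<in> divisor F"
  using isolated_pole_imp_neg_zorder[OF nicely_meromorphic_at(1)[OF assms(1)] assms(2)] by (auto simp: divisor_def)

lemma divisor_not_pole_imp_zero:
  assumes F: "F nicely_meromorphic_on UNIV" and "\<not> is_pole F p" "p \<in> divisor F"
  shows "F p = 0"
proof (rule ccontr)
  assume "F p \<noteq> 0"
  then have "zorder F p = 0"
    using nicely_meromorphic_on_imp_analytic_at[OF F UNIV_I assms(2)] by (intro zorder_eq_0I)
  then show False using assms(3) by (simp add: divisor_def)
qed

text \<open>Moving the centre from 0 to \<sigma> changes finitely many terms arbitrarily and all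
  others by a factor of at most \<open>2 ^ d\<close>, since
  \<open>norm (\<rho> - \<sigma>) \<ge> norm \<rho> / 2\<close> as soon as
  \<open>norm \<rho> > 2 * norm \<sigma>\<close>.\<close>

lemma canonical_divisor_if_convergence_exponent:
  assumes conv: "convergence_exponent F d" and d: "d \<ge> 1"
  shows "canonical_divisor (divisor F - {\<sigma>}) (zorder F) \<sigma> (d - 1)"
proof -
  have Sd: "Suc (d - 1) = d" using d by simp
  have s0: "(\<lambda>\<rho>. real_of_int \<bar>zorder F \<rho>\<bar> / norm \<rho> ^ d) summable_on (divisor F - {0})"
    using conv unfolding convergence_exponent_def divisor_summable_def by simp
  interpret c0: canonical_divisor "divisor F - {0}" "zorder F" 0 "d - 1"
    by unfold_locales (use s0 in \<open>auto simp only: Sd divisor_def diff_zero mem_Collect_eq\<close>)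
  define A where "A = {\<rho>\<in>divisor F - {\<sigma>}. norm \<rho> \<le> 2 * norm \<sigma>}"
  define B where "B = {\<rho>\<in>divisor F - {\<sigma>}. norm \<rho> > 2 * norm \<sigma>}"
  \<comment> \<open>The divisor may contain 0, which the locale centred at 0 excludes.\<close>
  have "A \<subseteq> insert 0 (c0.head (norm \<sigma>))" by (auto simp: A_def c0.head_def)
  then have "finite A" using c0.finite_head finite_subset by blast
  let ?f = "\<lambda>\<rho>. real_of_int \<bar>zorder F \<rho>\<bar> / norm (\<rho> - \<sigma>) ^ d"
  have "(\<lambda>\<rho>. 2 ^ d * (real_of_int \<bar>zorder F \<rho>\<bar> / norm \<rho> ^ d)) summable_on B"
    by (intro summable_on_cmult_right summable_on_subset_banach[OF s0]) (auto simp: B_def)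
  then have "?f summable_on B"
  proof (rule summable_on_comparison_test)
    fix \<rho> assume "\<rho> \<in> B"
    then have \<rho>: "norm \<rho> > 2 * norm \<sigma>" by (simp add: B_def)
    have "norm \<rho> / 2 \<le> norm (\<rho> - \<sigma>)" using \<rho> norm_triangle_ineq2[of \<rho> \<sigma>] by simp
    moreover have n0: "norm \<rho> > 0" using \<rho> norm_ge_zero[of \<sigma>] by linarith
    ultimately have "?f \<rho> \<le> real_of_int \<bar>zorder F \<rho>\<bar> / (norm \<rho> / 2) ^ d"
      by (intro divide_left_mono power_mono mult_pos_pos zero_less_power) auto
    then show "?f \<rho> \<le> 2 ^ d * (real_of_int \<bar>zorder F \<rho>\<bar> / norm \<rho> ^ d)"
      by (simp add: power_divide mult.commute)
  qed auto
  moreover have "?f summable_on A" using \<open>finite A\<close> by (rule summable_on_finite)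
  moreover have "A \<inter> B = {}" "A \<union> B = divisor F - {\<sigma>}" by (auto simp: A_def B_def)
  ultimately have "?f summable_on (divisor F - {\<sigma>})"
    by (metis summable_on_Un_disjoint)
  then show ?thesis
    by unfold_locales (auto simp only: Sd divisor_def mem_Collect_eq)
qed

text \<open>For \<open>r \<ge> 1\<close> the counting term is nonnegative, so \<open>nev_m\<close>
  inherits the bound on \<open>nev_T\<close>. Finiteness of the poles in a disc matters because a
  sum over an infinite set is 0 by convention, which would destroy the monotonicity of
  \<open>nev_n\<close>.\<close>

lemma finite_order_imp_nev_m_bound:
  assumes F: "F nicely_meromorphic_on UNIV" and fin: "\<And>t. finite {z. is_pole F z \<and> norm z \<le> t}"
    and ord: "finite_order F"
  obtains A where "eventually (\<lambda>r. nev_m F r \<le> r ^ A) at_top"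
proof -
  have pos: "0 \<le> real_of_int (- zorder F z)" if "is_pole F z" for z
    using is_pole_imp_divisor(1)[OF F that] by simp
  have mono: "nev_n F s \<le> nev_n F t" if "s \<le> t" for s t
    unfolding nev_n_def by (rule sum_mono2) (use fin that pos in auto)
  have n0: "nev_n F t \<ge> 0" for t
    unfolding nev_n_def by (rule sum_nonneg) (use pos in auto)
  have N: "nev_N F r \<ge> 0" if "r \<ge> 1" for r
  proof -
    have "0 \<le> (LBINT t:{0<..r}. (nev_n F t - nev_n F 0) / t)"
      unfolding set_lebesgue_integral_def
      by (rule integral_nonneg_AE, rule AE_I2) (auto simp: indicator_def intro!: divide_nonneg_nonneg mono)
    then show ?thesis unfolding nev_N_def using that n0[of 0] by (intro add_nonneg_nonneg mult_nonneg_nonneg) auto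
  qed
  from ord obtain A :: nat where A: "meromorphic_order F < ereal (real A)"
    unfolding finite_order_def using less_PInf_Ex_of_nat[of "meromorphic_order F"] by auto
  have "eventually (\<lambda>r. ereal (ln (max 1 (nev_T F r)) / ln r) < ereal (real A)) at_top"
    using A unfolding meromorphic_order_def by (rule Limsup_lessD)
  then have "eventually (\<lambda>r. nev_m F r \<le> r ^ A) at_top"
    using eventually_gt_at_top[of 1]
  proof eventually_elim
    case (elim r)
    then have "ln (max 1 (nev_T F r)) < real A * ln r" by (simp add: divide_less_eq)
    also have "\<dots> = ln (r ^ A)" using elim by (simp add: ln_realpow)
    finally have "max 1 (nev_T F r) < r ^ A" using elim by (subst (asm) ln_less_cancel_iff) auto
    moreover have "nev_m F r \<le> nev_T F r" using N[of r] elim by (simp add: nev_T_def)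
    ultimately show ?case by auto
  qed
  then show ?thesis by (rule that)
qed

text \<open>\<open>hadamard_poly\<close> is defined by choice, so this existence result is what
  gives the genus and the coefficients their meaning.\<close>

lemma hadamard_poly_spec:
  assumes F: "F nicely_meromorphic_on UNIV" and nc: "\<not> F constant_on UNIV"
    and ord: "finite_order F" and conv: "convergence_exponent F d" and d: "d \<ge> 1"
  shows "hadamard_factorization F \<sigma> (d - 1) (hadamard_poly F \<sigma> d)"
proof -
  interpret canonical_divisor "divisor F - {\<sigma>}" "zorder F" \<sigma> "d - 1"
    by (rule canonical_divisor_if_convergence_exponent[OF conv d])
  let ?k = "zorder F \<sigma>"
  obtain h where h: "h holomorphic_on UNIV" "\<And>s. \<not> is_pole F s \<Longrightarrow> F s = mprod ?k s * exp (h s)"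
  proof (rule factorization_exists[OF F, of ?k])
    show "monomial_near F p (if p = \<sigma> then ?k else if p \<in> divisor F - {\<sigma>} then zorder F p else 0)" for p
      using monomial_near_zorder[OF F nc, of p] by (auto simp: divisor_def)
    show "F p = 0" if "\<not> is_pole F p" "p \<in> divisor F - {\<sigma>}" for p
      using divisor_not_pole_imp_zero[OF F that(1)] that by simp
    show "F \<sigma> = 0" if "\<not> is_pole F \<sigma>" "?k \<noteq> 0"
      using divisor_not_pole_imp_zero[OF F that(1)] that by (simp add: divisor_def)
  qed (use that in blast)
  have poles: "p \<in> insert \<sigma> (divisor F - {\<sigma>})" if "is_pole F p" for p
    using is_pole_imp_divisor[OF F that] by auto
  have "finite {z. is_pole F z \<and> norm z \<le> t}" for t
  proof (rule finite_subset)
    show "finite (insert \<sigma> (head (\<bar>t\<bar> + norm \<sigma>)))" using finite_head by simp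
    show "{z. is_pole F z \<and> norm z \<le> t} \<subseteq> insert \<sigma> (head (\<bar>t\<bar> + norm \<sigma>))"
    proof
      fix z assume z: "z \<in> {z. is_pole F z \<and> norm z \<le> t}"
      have "norm (z - \<sigma>) \<le> norm z + norm \<sigma>" by (rule norm_triangle_ineq4)
      moreover have "norm z \<le> t" "0 \<le> norm z" "0 \<le> norm \<sigma>" using z by auto
      ultimately have "norm (z - \<sigma>) \<le> 2 * (\<bar>t\<bar> + norm \<sigma>)" by argo
      then show "z \<in> insert \<sigma> (head (\<bar>t\<bar> + norm \<sigma>))" using poles[of z] z by (auto simp: head_def)
    qed
  qed
  then obtain A where A: "eventually (\<lambda>r. nev_m F r \<le> r ^ A) at_top"
    using finite_order_imp_nev_m_bound[OF F _ ord] by blast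
  obtain Q where Q: "\<And>s. h s = poly Q s"
    using factorization_polynomial[OF F poles h A] by blast
  have "hadamard_factorization F \<sigma> (d - 1) Q"
    unfolding hadamard_factorization_def
  proof (intro allI impI)
    fix s assume s: "\<not> is_pole F s"
    have "((\<lambda>X. (s - \<sigma>) powi zorder F \<sigma> * exp (poly Q s) * (\<Prod>\<rho>\<in>X. elem \<rho> s powi zorder F \<rho>))
       \<longlongrightarrow> (s - \<sigma>) powi zorder F \<sigma> * exp (poly Q s) * cprod s) (finite_subsets_at_top (divisor F - {\<sigma>}))"
      by (intro tendsto_mult tendsto_const tendsto_cprod)
    moreover have "(s - \<sigma>) powi zorder F \<sigma> * exp (poly Q s) * cprod s = F s"
      unfolding h(2)[OF s] Q mprod_def by (simp only: mult_ac)
    ultimately show "((\<lambda>X. (s - \<sigma>) powi zorder F \<sigma> * exp (poly Q s) *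
                (\<Prod>\<rho>\<in>X. weierstrass_factor (d - 1) ((s - \<sigma>) / (\<rho> - \<sigma>)) powi zorder F \<rho>))
          \<longlongrightarrow> F s) (finite_subsets_at_top (divisor F - {\<sigma>}))"
      by (simp only: elem_def)
  qed
  then show ?thesis unfolding hadamard_poly_def by (rule someI)
qed

lemma hadamard_has_logderiv:
  assumes F: "F nicely_meromorphic_on UNIV" and conv: "convergence_exponent F d" and d: "d \<ge> 1"
    and had: "hadamard_factorization F \<sigma> (d - 1) Q" and s: "s \<notin> divisor F" "s \<noteq> \<sigma>"
  obtains J where
    "((\<lambda>\<rho>. of_int (zorder F \<rho>) * ((s - \<sigma>) ^ (d - 1) / ((s - \<rho>) * (\<rho> - \<sigma>) ^ (d - 1)))) has_sum J) (divisor F - {\<sigma>})"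
    "has_logderiv F (of_int (zorder F \<sigma>) / (s - \<sigma>) + poly (pderiv Q) s + J) s"
proof -
  interpret canonical_divisor "divisor F - {\<sigma>}" "zorder F" \<sigma> "d - 1"
    by (rule canonical_divisor_if_convergence_exponent[OF conv d])
  let ?Z = "divisor F - {\<sigma>}"
  have eq: "(x - \<sigma>) powi zorder F \<sigma> * exp (poly Q x) * cprod x = F x" if "x \<notin> divisor F" for x
  proof -
    have "\<not> is_pole F x" using is_pole_imp_divisor(2)[OF F] that by blast
    then have "((\<lambda>X. (x - \<sigma>) powi zorder F \<sigma> * exp (poly Q x) * (\<Prod>\<rho>\<in>X. elem \<rho> x powi zorder F \<rho>))
       \<longlongrightarrow> F x) (finite_subsets_at_top ?Z)"
      using had unfolding hadamard_factorization_def elem_def by blast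
    moreover have "((\<lambda>X. (x - \<sigma>) powi zorder F \<sigma> * exp (poly Q x) * (\<Prod>\<rho>\<in>X. elem \<rho> x powi zorder F \<rho>))
       \<longlongrightarrow> (x - \<sigma>) powi zorder F \<sigma> * exp (poly Q x) * cprod x) (finite_subsets_at_top ?Z)"
      by (intro tendsto_mult tendsto_const tendsto_cprod)
    ultimately show ?thesis using tendsto_unique[OF finite_subsets_at_top_neq_bot] by blast
  qed
  from has_logderiv_cprod[of s] s obtain J where
    J: "((\<lambda>\<rho>. of_int (zorder F \<rho>) * elem_ld \<rho> s) has_sum J) ?Z" "has_logderiv cprod J s" by blast
  have "has_logderiv (\<lambda>x. x - \<sigma>) (1 / (s - \<sigma>)) s"
    using s by (auto simp: has_logderiv_def intro!: derivative_eq_intros)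
  from has_logderiv_powi[OF this, of "zorder F \<sigma>"]
  have "has_logderiv (\<lambda>x. (x - \<sigma>) powi zorder F \<sigma>) (of_int (zorder F \<sigma>) / (s - \<sigma>)) s" by simp
  moreover have "has_logderiv (\<lambda>x. exp (poly Q x)) (poly (pderiv Q) s) s"
    by (rule has_logderiv_exp[OF poly_DERIV])
  ultimately have "has_logderiv (\<lambda>x. (x - \<sigma>) powi zorder F \<sigma> * exp (poly Q x) * cprod x)
     (of_int (zorder F \<sigma>) / (s - \<sigma>) + poly (pderiv Q) s + J) s"
    by (intro has_logderiv_mult J)
  \<comment> \<open>The factorization is an identity off the divisor; differentiating it at
    \<open>s\<close> requires an open set, which exists because the divisor has no limit
    points.\<close>
  moreover have "open (- (?Z \<union> {\<sigma>}))"
  proof -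
    have "closed ?Z" using not_islimpt_Z by (auto simp: closed_limpt)
    then show ?thesis by (intro open_Compl closed_Un) auto
  qed
  ultimately have "has_logderiv F (of_int (zorder F \<sigma>) / (s - \<sigma>) + poly (pderiv Q) s + J) s"
    by (rule has_logderiv_transform) (use s eq in auto)
  with J(1) show ?thesis by (intro that) (simp_all only: elem_ld_def)
qed


section \<open>The logarithmic derivative of a Dirichlet series\<close>

lemma dirichlet_data_facts:
  assumes "dirichlet_data I a lam"
  obtains c l0 where "l0 > 0" "\<And>n. n \<in> I \<Longrightarrow> l0 \<le> lam n"
    "(\<lambda>n. norm (a n) * exp (- (lam n * c))) summable_on I"
proof -
  from assms obtain c where c: "\<And>s. Re s > c \<Longrightarrow> (\<lambda>n. norm (a n * exp (- (of_real (lam n) * s)))) summable_on I"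
    unfolding dirichlet_data_def by blast
  \<comment> \<open>The frequencies increase, so the first one bounds them all from below; if there
    are no terms any positive value serves.\<close>
  define l0 where "l0 = (if I = {} then 1 else lam 1)"
  have I: "n \<ge> 1" "1 \<in> I" if "n \<in> I" for n
    using assms that unfolding dirichlet_data_def by auto
  have pos: "\<And>n. n \<in> I \<Longrightarrow> lam n > 0" and mono: "strict_mono_on I lam"
    using assms unfolding dirichlet_data_def by auto
  show ?thesis
  proof (rule that[of l0 "c + 1"])
    show "l0 > 0" unfolding l0_def using pos I by auto
    show "l0 \<le> lam n" if "n \<in> I" for n
    proof -
      have "lam 1 \<le> lam n"
        using strict_mono_onD[OF mono I(2)[OF that] that] I(1)[OF that] by (cases "n = 1") auto
      then show ?thesis using that by (auto simp: l0_def)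
    qed
    have "(\<lambda>n. norm (a n * exp (- (of_real (lam n) * of_real (c + 1))))) summable_on I"
      by (rule c) simp
    then show "(\<lambda>n. norm (a n) * exp (- (lam n * (c + 1)))) summable_on I"
      by (simp add: norm_mult norm_exp_eq_Re)
  qed
qed

theorem dirichlet_logderiv:
  assumes "dirichlet_data I a lam"
  obtains c where "\<And>s. Re s > c \<Longrightarrow> \<exists>L. has_logderiv (dirichlet_sum I a lam) L s \<and>
     ((\<lambda>k. of_real (mi_freq lam k) * log_coeff a k * exp (- (of_real (mi_freq lam k) * s))) has_sum L) (Lam I)"
proof -
  obtain c l0 where l0: "l0 > 0" "\<And>n. n \<in> I \<Longrightarrow> l0 \<le> lam n"
    and summ: "(\<lambda>n. norm (a n) * exp (- (lam n * c))) summable_on I"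
    using dirichlet_data_facts[OF assms] by blast
  define M where "M = (\<lambda>n. norm (a n) * exp (- (lam n * c)))"
  define S where "S = infsum M I"
  have S: "S \<ge> 0" unfolding S_def M_def by (intro infsum_nonneg) auto
  \<comment> \<open>Moving to the right by \<open>x\<close> shrinks every term by at least
    \<open>exp (- (l0 * x))\<close>. At this abscissa the sum of the norms is at most
    \<open>S / (S + 1) < 1\<close>.\<close>
  define c' where "c' = c + ln (S + 1) / l0"
  have cc': "c \<le> c'" unfolding c'_def using S l0 by (simp add: ln_ge_zero)
  let ?t = "\<lambda>n s. a n * exp (- (of_real (lam n) * s))"
  have nt: "norm (?t n s) = norm (a n) * exp (- (lam n * Re s))" for n s
    by (simp add: norm_mult norm_exp_eq_Re)
  have le: "norm (?t n s) \<le> M n * exp (- (l0 * (Re s - c)))" if "n \<in> I" "Re s \<ge> c" for n s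
  proof -
    have "l0 * (Re s - c) \<le> lam n * (Re s - c)" using that l0(2) by (intro mult_right_mono) auto
    then have "exp (- (lam n * Re s)) \<le> exp (- (lam n * c)) * exp (- (l0 * (Re s - c)))"
      by (simp add: algebra_simps flip: exp_add)
    then have "norm (a n) * exp (- (lam n * Re s)) \<le> norm (a n) * (exp (- (lam n * c)) * exp (- (l0 * (Re s - c))))"
      by (rule mult_left_mono) auto
    then show ?thesis unfolding nt M_def by (simp add: mult.assoc)
  qed
  have le': "norm (?t n s) \<le> M n" if "n \<in> I" "Re s \<ge> c" for n s
  proof -
    have "exp (- (l0 * (Re s - c))) \<le> 1" using l0(1) that by simp
    then have "M n * exp (- (l0 * (Re s - c))) \<le> M n * 1" by (intro mult_left_mono) (auto simp: M_def)
    then show ?thesis using le[OF that] by simp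
  qed
  have M: "M summable_on I" using summ by (simp add: M_def)
  define g where "g = (\<lambda>s. \<Sum>\<^sub>\<infinity>n\<in>I. ?t n s)"
  have unif: "uniform_limit {s. Re s \<ge> c} (\<lambda>X s. \<Sum>n\<in>X. ?t n s) g (finite_subsets_at_top I)"
    unfolding g_def by (rule Weierstrass_m_test_general[OF _ M]) (use le' in auto)
  show ?thesis
  proof (rule that)
    fix s assume s: "Re s > c'"
    define r where "r = Re s - c'"
    have r: "r > 0" using s by (simp add: r_def)
    have sub: "cball s r \<subseteq> {s. Re s \<ge> c}"
    proof
      fix x assume "x \<in> cball s r"
      then have "Re s - Re x \<le> r" using complex_Re_le_cmod[of "s - x"] by (simp add: dist_norm)
      then show "x \<in> {s. Re s \<ge> c}" using cc' by (simp add: r_def)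
    qed
    have d: "(?t n has_field_derivative - (of_real (lam n) * ?t n w)) (at w)" for n w
      by (auto intro!: derivative_eq_intros)
    have ev: "eventually (\<lambda>X. continuous_on (cball s r) (\<lambda>s. \<Sum>n\<in>X. ?t n s) \<and>
       (\<forall>w\<in>ball s r. ((\<lambda>s. \<Sum>n\<in>X. ?t n s) has_field_derivative (\<Sum>n\<in>X. - (of_real (lam n) * ?t n w))) (at w)))
       (finite_subsets_at_top I)"
      by (intro always_eventually allI conjI ballI DERIV_sum d) (auto intro!: continuous_intros)
    obtain g' where g': "\<And>w. w \<in> ball s r \<Longrightarrow> (g has_field_derivative g' w) (at w) \<and>
        ((\<lambda>X. \<Sum>n\<in>X. - (of_real (lam n) * ?t n w)) \<longlongrightarrow> g' w) (finite_subsets_at_top I)"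
      by (rule has_complex_derivative_uniform_limit[OF ev uniform_limit_on_subset[OF unif sub] _ r]) auto
    have gd: "(g has_field_derivative g' s) (at s)"
      and "((\<lambda>n. - (of_real (lam n) * ?t n s)) has_sum g' s) I"
      using g'[of s] r by (auto simp: has_sum_def)
    then have Y: "((\<lambda>n. of_real (lam n) * ?t n s) has_sum (- g' s)) I"
      using has_sum_uminusI by fastforce
    have sc: "Re s \<ge> c" using s cc' by simp
    have nsum: "(\<lambda>n. norm (?t n s)) summable_on I"
      by (rule summable_on_comparison_test[OF M]) (use le'[OF _ sc] in auto)
    have X: "((\<lambda>n. ?t n s) has_sum g s) I"
      unfolding g_def by (rule has_sum_infsum[OF abs_summable_summable[OF nsum]])
    have small: "infsum (\<lambda>n. norm (?t n s)) I < 1"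
    proof -
      have "infsum (\<lambda>n. norm (?t n s)) I \<le> infsum (\<lambda>n. M n * exp (- (l0 * (Re s - c)))) I"
        by (intro infsum_mono nsum summable_on_cmult_left M le[OF _ sc])
      also have "\<dots> = S * exp (- (l0 * (Re s - c)))"
        unfolding S_def by (rule infsum_cmult_left) (rule M)
      also have "\<dots> \<le> S * exp (- ln (S + 1))"
      proof (intro mult_left_mono)
        have "ln (S + 1) = l0 * (c' - c)" using l0 by (simp add: c'_def)
        also have "\<dots> \<le> l0 * (Re s - c)" using s l0 by simp
        finally show "exp (- (l0 * (Re s - c))) \<le> exp (- ln (S + 1))" by simp
      qed (rule S)
      also have "\<dots> = S / (S + 1)" using S by (simp add: exp_minus inverse_eq_divide)
      also have "\<dots> < 1" using S by simp
      finally show ?thesis .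
    qed
    \<comment> \<open>Here \<open>Y = - g' s\<close>, because differentiating a term brings down
      \<open>- lam n\<close>; the two signs cancel.\<close>
    have "((\<lambda>k. of_real (mi_freq lam k) * log_coeff (\<lambda>n. ?t n s) k) has_sum (- (- g' s / (1 + g s)))) (Lam I)"
      by (rule has_sum_log_coeff[OF X Y _ small]) (use l0 in force)
    then have L: "((\<lambda>k. of_real (mi_freq lam k) * log_coeff a k * exp (- (of_real (mi_freq lam k) * s))) has_sum (g' s / (1 + g s))) (Lam I)"
      by (subst has_sum_cong[where g="\<lambda>k. of_real (mi_freq lam k) * log_coeff (\<lambda>n. ?t n s) k"])
         (auto simp: log_coeff_twist)
    have ds: "dirichlet_sum I a lam = (\<lambda>s. 1 + g s)" by (auto simp: dirichlet_sum_def g_def)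
    have "norm (g s) \<le> infsum (\<lambda>n. norm (?t n s)) I"
      by (rule norm_has_sum_bound[OF has_sum_infsum[OF nsum] X])
    with small have "norm (g s) < 1" by simp
    then have "1 + g s \<noteq> 0" by (metis add_eq_0_iff norm_minus_cancel norm_one less_irrefl)
    then have "has_logderiv (dirichlet_sum I a lam) (g' s / (1 + g s)) s"
      unfolding ds has_logderiv_def using gd by (auto intro!: derivative_eq_intros)
    with L show "\<exists>L. has_logderiv (dirichlet_sum I a lam) L s \<and>
     ((\<lambda>k. of_real (mi_freq lam k) * log_coeff a k * exp (- (of_real (mi_freq lam k) * s))) has_sum L) (Lam I)"
      by blast
  qed
qed


section \<open>The one-sided formula\<close>

lemma norm_exp_sum_le:
  assumes "\<And>j. j \<le> n \<Longrightarrow> B \<le> Re (w j)" "t \<ge> 0"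
  shows "norm (exp_sum n c w t) \<le> (\<Sum>j\<le>n. norm (c j)) * exp (- B * t)"
  unfolding exp_sum_def sum_distrib_right
proof (rule sum_norm_le)
  fix j assume "j \<in> {..n}"
  then have "B * t \<le> Re (w j) * t" using assms by (intro mult_right_mono) auto
  then show "norm (c j * exp (- w j * of_real t)) \<le> norm (c j) * exp (- B * t)"
    by (simp add: norm_mult norm_exp_eq_Re mult_left_mono)
qed

text \<open>\<open>exp_sum_dense\<close> with error 1 suffices, since an exponential sum with
  exponents of real part at least \<open>B\<close> has the required decay itself.\<close>

lemma smooth_compact_decay:
  assumes "smooth_fun \<psi>" "\<And>t. t > M \<Longrightarrow> \<psi> t = 0" "B \<ge> 1"
  obtains C where "\<And>i t. i \<le> N \<Longrightarrow> t \<ge> 0 \<Longrightarrow> norm ((vderiv ^^ i) \<psi> t) \<le> C * exp (- B * t)"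
proof -
  obtain n c where E: "\<And>i t. i \<le> N \<Longrightarrow> t \<ge> 0 \<Longrightarrow>
     norm ((vderiv ^^ i) \<psi> t - (vderiv ^^ i) (exp_sum n c (\<lambda>j. of_real (B + real j))) t) \<le> 1 * exp (- B * t)"
    using exp_sum_dense[OF assms zero_less_one] by metis
  define D where "D = (\<lambda>i. \<Sum>j\<le>n. norm (c j * (- of_real (B + real j)) ^ i))"
  show ?thesis
  proof (rule that)
    fix i t assume it: "i \<le> N" "(t::real) \<ge> 0"
    let ?E = "(vderiv ^^ i) (exp_sum n c (\<lambda>j. of_real (B + real j))) t"
    have "norm ?E \<le> D i * exp (- B * t)"
      unfolding vderiv_exp_sum D_def by (rule norm_exp_sum_le) (use it in auto)
    also have "\<dots> \<le> (\<Sum>i\<le>N. D i) * exp (- B * t)"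
      using it by (intro mult_right_mono member_le_sum) (auto simp: D_def intro: sum_nonneg)
    finally have "norm ?E \<le> (\<Sum>i\<le>N. D i) * exp (- B * t)" .
    then show "norm ((vderiv ^^ i) \<psi> t) \<le> (1 + (\<Sum>i\<le>N. D i)) * exp (- B * t)"
      using E[OF it] norm_triangle_sub[of "(vderiv ^^ i) \<psi> t" ?E] by (simp add: distrib_right)
  qed
qed

text \<open>This replaces the uniqueness theorem for Laplace transforms of distributions.\<close>

lemma functional_eq_0_if_exp_sum_eq_0:
  fixes T :: "(real \<Rightarrow> complex) \<Rightarrow> complex"
  assumes \<psi>: "smooth_fun \<psi>" "\<And>t. t > M \<Longrightarrow> \<psi> t = 0" and B: "B \<ge> 1"
    and zero: "\<And>n c. T (exp_sum n c (\<lambda>j. of_real (B + real j))) = 0"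
    and cont: "\<And>n c \<eta>. \<eta> > 0 \<Longrightarrow> (\<And>i t. i \<le> N \<Longrightarrow> t \<ge> 0 \<Longrightarrow>
        norm ((vderiv ^^ i) \<psi> t - (vderiv ^^ i) (exp_sum n c (\<lambda>j. of_real (B + real j))) t) \<le> \<eta> * exp (- B * t)) \<Longrightarrow>
        norm (T \<psi> - T (exp_sum n c (\<lambda>j. of_real (B + real j)))) \<le> C * \<eta>"
  shows "T \<psi> = 0"
proof -
  have "norm (T \<psi>) \<le> C * \<eta>" if \<eta>: "\<eta> > 0" for \<eta>
  proof -
    obtain n c where "\<And>i t. i \<le> N \<Longrightarrow> t \<ge> 0 \<Longrightarrow>
     norm ((vderiv ^^ i) \<psi> t - (vderiv ^^ i) (exp_sum n c (\<lambda>j. of_real (B + real j))) t) \<le> \<eta> * exp (- B * t)"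
    proof (rule exp_sum_dense[OF \<psi> B \<eta>, where N=N])
      fix n c
      assume *: "\<And>i t. i \<le> N \<Longrightarrow> t \<ge> 0 \<Longrightarrow>
        norm ((vderiv ^^ i) \<psi> t - (vderiv ^^ i) (exp_sum n c (\<lambda>j. of_real (B + real j))) t) \<le> \<eta> * exp (- B * t)"
      show thesis by (rule that) (rule *)
    qed
    from cont[OF \<eta> this] show ?thesis unfolding zero by simp
  qed
  then have le: "norm (T \<psi>) \<le> \<bar>C\<bar> * \<eta>" if "\<eta> > 0" for \<eta>
    using that mult_right_mono[OF abs_ge_self[of C], of \<eta>] by (meson less_imp_le order_trans)
  have "norm (T \<psi>) \<le> e" if "e > 0" for e
  proof -
    have "norm (T \<psi>) \<le> \<bar>C\<bar> * (e / (\<bar>C\<bar> + 1))" using that by (intro le) auto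
    also have "\<dots> \<le> e" using that by (simp add: divide_le_eq)
    finally show ?thesis .
  qed
  then have "norm (T \<psi>) \<le> 0" by (rule field_le_epsilon[of _ 0, simplified])
  then show ?thesis by simp
qed

lemma has_sum_sum_finite:
  fixes f :: "'a \<Rightarrow> 'b \<Rightarrow> complex"
  assumes "finite X" "\<And>x. x \<in> X \<Longrightarrow> (f x has_sum s x) A"
  shows "((\<lambda>k. \<Sum>x\<in>X. f x k) has_sum (\<Sum>x\<in>X. s x)) A"
  using assms by (induction rule: finite_induct) (auto intro: has_sum_add)

text \<open>The Laplace transform of \<open>p(D) \<delta>\<^sub>0\<close> is \<open>p\<close>
  itself: the signs in \<open>poly_jet\<close> cancel those from differentiating
  \<open>exp (- w t)\<close>.\<close>

lemma poly_jet_exp_sum: "poly_jet p (exp_sum n c w) = (\<Sum>j\<le>n. c j * poly p (w j))"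
proof -
  have "poly_jet p (exp_sum n c w) = (\<Sum>i\<le>degree p. \<Sum>j\<le>n. c j * (coeff p i * w j ^ i))"
    unfolding poly_jet_def vderiv_exp_sum exp_sum_def sum_distrib_left
  proof (intro sum.cong refl)
    fix i j
    have "(-1) ^ i * (- w j) ^ i = w j ^ i" by (simp flip: power_mult_distrib)
    then show "coeff p i * (- 1) ^ i * (c j * (- w j) ^ i * exp (- w j * complex_of_real 0)) = c j * (coeff p i * w j ^ i)"
      by (simp add: mult_ac)
  qed
  also have "\<dots> = (\<Sum>j\<le>n. c j * poly p (w j))"
    by (subst sum.swap) (simp add: poly_altdef sum_distrib_left)
  finally show ?thesis .
qed

lemma mi_freq_nonneg:
  assumes "dirichlet_data I a lam" "k \<in> Lam I"
  shows "mi_freq lam k \<ge> 0"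
  unfolding mi_freq_def
proof (rule sum_nonneg)
  fix n assume "n \<in> mi_support k"
  then have "n \<in> I" "0 \<le> k n" using assms(2) by (auto simp: Lam_def)
  moreover have "0 < lam n" using assms(1) \<open>n \<in> I\<close> by (auto simp: dirichlet_data_def)
  ultimately show "0 \<le> lam n * real_of_int (k n)" by simp
qed

text \<open>Passing to \<open>\<psi> = exp (\<sigma> t) \<phi>\<close> removes the exponential from
  \<open>newton_W\<close> and makes \<open>q = s - \<sigma>\<close> the Laplace variable. No support
  condition is imposed on the left, since all terms see only the half-line. The form with
  \<open>has_sum\<close> also gives the summability needed to add the reflected identity.\<close>

lemma newton_W_eq:
  fixes f :: "complex \<Rightarrow> complex" and \<sigma> :: complex
  assumes data: "dirichlet_data I a lam" and ext: "meromorphic_extension I a lam f"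
    and nc: "\<not> f constant_on UNIV" and ord: "finite_order f"
    and conv: "convergence_exponent f d" and d: "d \<ge> 1"
    and \<phi>: "smooth_fun \<phi>" "\<And>t. t > R \<Longrightarrow> \<phi> t = 0"
  defines "Q \<equiv> hadamard_poly f \<sigma> d"
  shows "((\<lambda>k. of_real (mi_freq lam k) * log_coeff a k * \<phi> (mi_freq lam k)) has_sum
           (newton_W f d \<sigma> \<phi> - poly_jet (- pderiv Q) \<phi>)) (Lam I)"
proof -
  define Z where "Z = divisor f - {\<sigma>}"
  define n0 where "n0 = zorder f \<sigma>"
  define b where "b = (\<lambda>\<rho>. of_int (zorder f \<rho>) / (\<rho> - \<sigma>) ^ d)"
  define w where "w = (\<lambda>\<rho>. \<rho> - \<sigma>)"
  define \<beta> where "\<beta> = (\<lambda>k. of_real (mi_freq lam k) * log_coeff a k)"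
  have F: "f nicely_meromorphic_on UNIV" using ext by (simp add: meromorphic_extension_def)
  interpret canonical_divisor "divisor f - {\<sigma>}" "zorder f" \<sigma> "d - 1"
    by (rule canonical_divisor_if_convergence_exponent[OF conv d])
  have had: "hadamard_factorization f \<sigma> (d - 1) Q"
    unfolding Q_def by (rule hadamard_poly_spec[OF F nc ord conv d])
  obtain c1 where c1: "\<And>s. Re s > c1 \<Longrightarrow> f s = dirichlet_sum I a lam s"
    using ext unfolding meromorphic_extension_def by blast
  obtain c2 where c2: "\<And>s. Re s > c2 \<Longrightarrow> \<exists>L. has_logderiv (dirichlet_sum I a lam) L s \<and>
     ((\<lambda>k. of_real (mi_freq lam k) * log_coeff a k * exp (- (of_real (mi_freq lam k) * s))) has_sum L) (Lam I)"
    using dirichlet_logderiv[OF data] by blast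
  define C0 where "C0 = max c1 c2"
  have ld: "\<exists>L. has_logderiv f L s \<and> ((\<lambda>k. \<beta> k * exp (- (of_real (mi_freq lam k) * s))) has_sum L) (Lam I)"
    if s: "Re s > C0" for s
  proof -
    from c2[of s] s obtain L where L: "has_logderiv (dirichlet_sum I a lam) L s"
      "((\<lambda>k. \<beta> k * exp (- (of_real (mi_freq lam k) * s))) has_sum L) (Lam I)" unfolding C0_def \<beta>_def by auto
    have "has_logderiv f L s"
      by (rule has_logderiv_transform[OF L(1) open_halfspace_Re_gt[of c1]]) (use s c1 in \<open>auto simp: C0_def\<close>)
    with L show ?thesis by blast
  qed
  have nodiv: "s \<notin> divisor f" if s: "Re s > C0" for s
  proof -
    have "f holomorphic_on {s. Re s > C0}"
      unfolding holomorphic_on_open[OF open_halfspace_Re_gt] using ld by (auto simp: has_logderiv_def)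
    then have "f analytic_on {s}"
      unfolding analytic_at using s open_halfspace_Re_gt[of C0] by blast
    moreover have "f s \<noteq> 0" using ld[OF s] by (auto simp: has_logderiv_def)
    ultimately show ?thesis by (simp add: divisor_def zorder_eq_0I)
  qed
  \<comment> \<open>\<open>C0 - Re \<sigma>\<close> bounds the exponents
    \<open>Re (w \<rho>)\<close>; the lower limit 1 lets \<open>exp (M * t)\<close> also dominate
    \<open>t ^ d / fact d\<close>.\<close>
  define M where "M = max 1 (C0 - Re \<sigma>)"
  have M: "M \<ge> 1" "M \<ge> 0" "C0 - Re \<sigma> \<le> M" by (auto simp: M_def)
  have wM: "Re (w \<rho>) \<le> M" if "\<rho> \<in> Z" for \<rho>
  proof -
    have "Re \<rho> \<le> C0" using nodiv[of \<rho>] that by (auto simp: Z_def not_less[symmetric])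
    then show ?thesis using M(3) by (simp add: w_def)
  qed
  have Sd: "Suc (d - 1) = d" using d by simp
  have bs: "(\<lambda>\<rho>. norm (b \<rho>)) summable_on Z"
    using summ unfolding Sd Z_def b_def by (simp add: norm_divide norm_power)
  note US = bs wM M(2)
  define U where "U = exp_series Z b w"
  \<comment> \<open>\<open>K - K(0)\<close> on the half-line. The polynomial term contributes
    nothing to \<open>K(0)\<close> because \<open>d \<ge> 1\<close>.\<close>
  define G where "G = (\<lambda>t. of_int n0 * (of_real t ^ d / fact d) + U t)"
  have K: "newton_K f d \<sigma> t - newton_K f d \<sigma> 0 = G t" if t: "t \<ge> 0" for t
  proof -
    have Kt: "newton_K f d \<sigma> t = of_int n0 * (of_real t ^ d / fact d) + (\<Sum>\<^sub>\<infinity>\<rho>\<in>Z. b \<rho> * exp (w \<rho> * of_real t))" if "t \<ge> 0" for t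
      using that unfolding newton_K_def Z_def b_def w_def n0_def by simp
    have sb: "(b has_sum infsum b Z) Z" using abs_summable_summable[OF bs] by (rule has_sum_infsum)
    have "((\<lambda>\<rho>. b \<rho> * (exp (w \<rho> * of_real t) - 1) + b \<rho>) has_sum (U t + infsum b Z)) Z"
      unfolding U_def by (intro has_sum_add sb has_sum_exp_series[OF US t])
    then have "((\<lambda>\<rho>. b \<rho> * exp (w \<rho> * of_real t)) has_sum (U t + infsum b Z)) Z"
      by (simp add: algebra_simps)
    then have "(\<Sum>\<^sub>\<infinity>\<rho>\<in>Z. b \<rho> * exp (w \<rho> * of_real t)) = U t + infsum b Z" by (rule infsumI)
    then show ?thesis using Kt[OF t] Kt[of 0] d by (simp add: G_def)
  qed
  define Cg where "Cg = \<bar>of_int n0\<bar> + infsum (\<lambda>\<rho>. norm (b \<rho>)) Z * 2"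
  have G_bound: "norm (G t) \<le> Cg * exp (M * t)" if t: "t \<ge> 0" for t
  proof -
    have "t ^ d / fact d \<le> exp t" by (rule power_le_exp[OF t])
    also have "exp t \<le> exp (M * t)" using mult_right_mono[OF M(1) t] by simp
    finally have te: "t ^ d / fact d \<le> exp (M * t)" .
    have "norm (of_int n0 * (of_real t ^ d / fact d :: complex)) \<le> \<bar>of_int n0\<bar> * exp (M * t)"
      using t mult_left_mono[OF te, of "\<bar>of_int n0\<bar>"] by (simp add: norm_mult norm_divide norm_power)
    moreover have "norm (U t) \<le> infsum (\<lambda>\<rho>. norm (b \<rho>)) Z * 2 * exp (M * t)"
      unfolding U_def by (rule norm_exp_series_le[OF US t])
    ultimately show ?thesis unfolding G_def Cg_def distrib_right by (rule order_trans[OF norm_triangle_ineq add_mono])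
  qed
  have G_cont: "continuous_on {0..} G"
    unfolding G_def U_def by (intro continuous_intros continuous_exp_series[OF US]) auto
  \<comment> \<open>One more than the growth rate of \<open>G\<close>, so that \<open>G\<close>
    times a function of decay \<open>exp (- B * t)\<close> is integrable. The choice also places
    \<open>q + \<sigma>\<close> in the half-plane of the Dirichlet series whenever
    \<open>Re q \<ge> B\<close>.\<close>
  define B where "B = M + 1"
  have B: "B \<ge> 1" "B - M = 1" "B + Re \<sigma> > C0" using M by (auto simp: B_def)
  define p where "p = (- pderiv Q) \<circ>\<^sub>p [:\<sigma>, 1:]"
  define \<psi> where "\<psi> = (\<lambda>t. exp (\<sigma> * of_real t) * \<phi> t)"
  have \<psi>: "smooth_fun \<psi>" "\<And>t. t > R \<Longrightarrow> \<psi> t = 0"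
    unfolding \<psi>_def using smooth_fun_exp_mult[OF \<phi>(1)] \<phi>(2) by auto
  \<comment> \<open>The integral uses the derivative of order \<open>d\<close>, the jet at 0 those
    up to the degree of \<open>p\<close>.\<close>
  define N where "N = max d (degree p)"
  define T1 where "T1 = (\<lambda>u. (-1) ^ d * (LBINT t:{0..}. G t * (vderiv ^^ d) u t))"
  define \<gamma> where "\<gamma> = (\<lambda>k. \<beta> k * exp (- (of_real (mi_freq lam k) * \<sigma>)))"
  define T2 where "T2 = (\<lambda>u. poly_jet p u + (\<Sum>\<^sub>\<infinity>k\<in>Lam I. \<gamma> k * u (mi_freq lam k)))"
  have W: "newton_W f d \<sigma> \<phi> = T1 \<psi>"
  proof -
    have "newton_W f d \<sigma> \<phi> = (-1) ^ d * (LBINT t. (newton_K f d \<sigma> t - newton_K f d \<sigma> 0) * indicator {0..} t * (vderiv ^^ d) \<psi> t)"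
      by (simp add: newton_W_def distr_mult_def distr_deriv_funpow distr_of_fun_def \<psi>_def)
    also have "(LBINT t. (newton_K f d \<sigma> t - newton_K f d \<sigma> 0) * indicator {0..} t * (vderiv ^^ d) \<psi> t) = (LBINT t:{0..}. G t * (vderiv ^^ d) \<psi> t)"
      unfolding set_lebesgue_integral_def
      by (intro Bochner_Integration.integral_cong) (auto simp: indicator_def K)
    finally show ?thesis by (simp add: T1_def)
  qed
  have int_bound: "set_integrable lborel {0..} (\<lambda>t. G t * v t)" "norm (LBINT t:{0..}. G t * v t) \<le> Cg * C"
    if v: "continuous_on {0..} v" "\<And>t. t \<ge> 0 \<Longrightarrow> norm (v t) \<le> C * exp (- B * t)" for v :: "real \<Rightarrow> complex" and C
  proof -
    have c: "continuous_on {0..} (\<lambda>t. G t * v t)" by (intro continuous_on_mult G_cont v(1))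
    have e: "norm (G t * v t) \<le> Cg * C * exp (- (1 * t))" if t: "t \<ge> 0" for t
    proof -
      have "norm (G t * v t) \<le> (Cg * exp (M * t)) * (C * exp (- B * t))"
        unfolding norm_mult by (intro mult_mono G_bound[OF t] v(2)[OF t] norm_ge_zero order_trans[OF norm_ge_zero G_bound[OF t]])
      also have "\<dots> = Cg * C * (exp (M * t) * exp (- B * t))" by (simp only: mult_ac)
      also have "exp (M * t) * exp (- B * t) = exp (- (1 * t))" by (simp add: B_def algebra_simps flip: exp_add)
      finally show ?thesis .
    qed
    show "set_integrable lborel {0..} (\<lambda>t. G t * v t)"
      by (rule exp_decay_integral(1)[OF c zero_less_one e])
    show "norm (LBINT t:{0..}. G t * v t) \<le> Cg * C"
      using exp_decay_integral(2)[OF c zero_less_one e] by simp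
  qed
  have exp_bound: "norm (exp (- q * of_real t)) \<le> 1 * exp (- B * t)" if "Re q \<ge> B" "t \<ge> 0" for q :: complex and t :: real
    using mult_right_mono[OF that] by (simp add: norm_exp_eq_Re)
  have sumL: "((\<lambda>k. \<beta> k * exp (- (of_real (mi_freq lam k) * \<sigma>)) * exp (- q * of_real (mi_freq lam k))) has_sum
      (q ^ d * (LBINT t:{0..}. G t * exp (- q * of_real t)) - poly p q)) (Lam I)" if q: "Re q \<ge> B" for q
  proof -
    define s where "s = q + \<sigma>"
    have qM: "Re q > M" "Re q > 0" "q \<noteq> 0" using q B M by auto
    have s: "Re s > C0" using q B by (simp add: s_def)
    obtain L where L: "has_logderiv f L s" "((\<lambda>k. \<beta> k * exp (- (of_real (mi_freq lam k) * s))) has_sum L) (Lam I)"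
      using ld[OF s] by blast
    have "s \<noteq> \<sigma>" using qM by (simp add: s_def)
    then obtain J where J: "((\<lambda>\<rho>. of_int (zorder f \<rho>) * ((s - \<sigma>) ^ (d - 1) / ((s - \<rho>) * (\<rho> - \<sigma>) ^ (d - 1)))) has_sum J) Z"
      "has_logderiv f (of_int (zorder f \<sigma>) / (s - \<sigma>) + poly (pderiv Q) s + J) s"
      using hadamard_has_logderiv[OF F conv d had nodiv[OF s]] unfolding Z_def by blast
    have LJ: "L = of_int n0 / q + poly (pderiv Q) s + J"
      using has_logderiv_unique[OF L(1) J(2)] by (simp add: n0_def s_def)
    have "((\<lambda>\<rho>. q ^ d * (b \<rho> * (1 / (q - w \<rho>) - 1 / q))) has_sum (q ^ d * (LBINT t:{0..}. U t * exp (- (q * of_real t))))) Z"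
      unfolding U_def by (intro has_sum_cmult_right laplace_exp_series[OF US qM(1)])
    \<comment> \<open>The difference \<open>1 / (q - w \<rho>) - 1 / q\<close> equals
      \<open>w \<rho> / ((q - w \<rho>) * q)\<close>. The extra factor \<open>w \<rho> / q\<close>
      lowers the powers of \<open>q\<close> and of \<open>w \<rho>\<close> from \<open>d\<close> to
      \<open>d - 1\<close>, which gives \<open>elem_ld\<close>.\<close>
    moreover have "q ^ d * (b \<rho> * (1 / (q - w \<rho>) - 1 / q)) = of_int (zorder f \<rho>) * ((s - \<sigma>) ^ (d - 1) / ((s - \<rho>) * (\<rho> - \<sigma>) ^ (d - 1)))"
      if \<rho>: "\<rho> \<in> Z" for \<rho>
    proof -
      have wn: "w \<rho> \<noteq> 0" using \<rho> by (auto simp: Z_def w_def)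
      have qw: "q - w \<rho> \<noteq> 0" using wM[OF \<rho>] qM(1) by auto
      obtain m where m: "d = Suc m" using d by (cases d) auto
      have "1 / (q - w \<rho>) - 1 / q = w \<rho> / ((q - w \<rho>) * q)"
        using qw qM(3) by (simp add: field_simps)
      then have "q ^ d * (b \<rho> * (1 / (q - w \<rho>) - 1 / q)) = q ^ d * (of_int (zorder f \<rho>) / w \<rho> ^ d * (w \<rho> / ((q - w \<rho>) * q)))"
        by (simp add: b_def w_def)
      also have "\<dots> = of_int (zorder f \<rho>) * (q ^ m / ((q - w \<rho>) * w \<rho> ^ m))"
        using wn qw qM(3) by (simp add: m mult_ac)
      also have "\<dots> = of_int (zorder f \<rho>) * ((s - \<sigma>) ^ (d - 1) / ((s - \<rho>) * (\<rho> - \<sigma>) ^ (d - 1)))"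
      proof -
        have "q - w \<rho> = s - \<rho>" "q = s - \<sigma>" by (simp_all add: s_def w_def)
        then show ?thesis by (simp only: m w_def diff_Suc_1)
      qed
      finally show ?thesis .
    qed
    ultimately have "((\<lambda>\<rho>. of_int (zorder f \<rho>) * ((s - \<sigma>) ^ (d - 1) / ((s - \<rho>) * (\<rho> - \<sigma>) ^ (d - 1)))) has_sum
        (q ^ d * (LBINT t:{0..}. U t * exp (- (q * of_real t))))) Z"
      by (subst has_sum_cong[OF sym]) auto
    with J(1) have JU: "J = q ^ d * (LBINT t:{0..}. U t * exp (- (q * of_real t)))" by (rule has_sum_unique)
    have iU: "set_integrable lborel {0..} (\<lambda>t. U t * exp (- (q * of_real t)))"
    proof -
      have "set_integrable lborel {0..} (\<lambda>t. G t * exp (- q * of_real t))"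
        by (rule int_bound(1)[OF _ exp_bound[OF q]]) (auto intro!: continuous_intros)
      moreover have "set_integrable lborel {0..} (\<lambda>t. of_int n0 * (of_real t ^ d / fact d * exp (- (q * of_real t))))"
        by (intro set_integrable_mult_right set_integrable_power_exp qM)
      ultimately have "set_integrable lborel {0..} (\<lambda>t. G t * exp (- q * of_real t) - of_int n0 * (of_real t ^ d / fact d * exp (- (q * of_real t))))"
        by (rule set_integral_diff)
      then show ?thesis by (simp add: G_def algebra_simps)
    qed
    have "(LBINT t:{0..}. G t * exp (- q * of_real t)) =
        (LBINT t:{0..}. of_int n0 * (of_real t ^ d / fact d * exp (- (q * of_real t))) + U t * exp (- (q * of_real t)))"
      by (simp add: G_def algebra_simps)
    also have "\<dots> = of_int n0 * (1 / q ^ Suc d) + (LBINT t:{0..}. U t * exp (- (q * of_real t)))"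
      by (subst set_integral_add(2)[OF _ iU])
         (intro set_integrable_mult_right set_integrable_power_exp qM,
          simp only: set_integral_mult_right laplace_power[OF qM(2)])
    finally have "q ^ d * (LBINT t:{0..}. G t * exp (- q * of_real t)) = of_int n0 / q + J"
      unfolding JU using qM(3) by (simp add: distrib_left)
    moreover have "poly p q = - poly (pderiv Q) s" by (simp add: p_def poly_pcompose s_def add.commute)
    ultimately have "L = q ^ d * (LBINT t:{0..}. G t * exp (- q * of_real t)) - poly p q"
      using LJ by simp
    moreover have "\<beta> k * exp (- (of_real (mi_freq lam k) * \<sigma>)) * exp (- q * of_real (mi_freq lam k)) = \<beta> k * exp (- (of_real (mi_freq lam k) * s))" for k
      by (simp add: s_def mult.assoc algebra_simps flip: exp_add)
    ultimately show ?thesis using L(2) by (simp only:)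
  qed
  define S where "S = infsum (\<lambda>k. norm (\<gamma> k) * exp (- B * mi_freq lam k)) (Lam I)"
  \<comment> \<open>Unconditional summability of complex numbers is absolute, so \<open>sumL\<close>
    at the single point \<open>q = B\<close> yields the weighted summability.\<close>
  have \<gamma>s: "(\<lambda>k. norm (\<gamma> k) * exp (- B * mi_freq lam k)) summable_on Lam I"
    using has_sum_imp_summable[OF sumL[of "of_real B"]]
    unfolding summable_on_iff_abs_summable_on_complex
    by (simp add: \<gamma>_def norm_mult norm_exp_eq_Re)
  have freq_bound: "(\<lambda>k. \<gamma> k * u (mi_freq lam k)) summable_on Lam I"
      "norm (\<Sum>\<^sub>\<infinity>k\<in>Lam I. \<gamma> k * u (mi_freq lam k)) \<le> S * C"
    if u: "\<And>t. t \<ge> 0 \<Longrightarrow> norm (u t) \<le> C * exp (- B * t)" for u :: "real \<Rightarrow> complex" and C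
  proof -
    have le: "norm (\<gamma> k * u (mi_freq lam k)) \<le> norm (\<gamma> k) * exp (- B * mi_freq lam k) * C" if k: "k \<in> Lam I" for k
      using mult_left_mono[OF u[OF mi_freq_nonneg[OF data k]], of "norm (\<gamma> k)"] by (simp add: norm_mult mult_ac)
    have cs: "((\<lambda>k. norm (\<gamma> k) * exp (- B * mi_freq lam k) * C) has_sum (S * C)) (Lam I)"
      unfolding S_def by (intro has_sum_cmult_left has_sum_infsum \<gamma>s)
    show s: "(\<lambda>k. \<gamma> k * u (mi_freq lam k)) summable_on Lam I"
      by (rule abs_summable_summable, rule summable_on_comparison_test[OF has_sum_imp_summable[OF cs]]) (use le in auto)
    show "norm (\<Sum>\<^sub>\<infinity>k\<in>Lam I. \<gamma> k * u (mi_freq lam k)) \<le> S * C"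
      by (rule norm_infsum_le[OF has_sum_infsum[OF s] cs le])
  qed
  obtain C\<psi> where C\<psi>: "\<And>i t. i \<le> N \<Longrightarrow> t \<ge> 0 \<Longrightarrow> norm ((vderiv ^^ i) \<psi> t) \<le> C\<psi> * exp (- B * t)"
    using smooth_compact_decay[OF \<psi> B(1)] by metis
  have sum\<psi>: "(\<lambda>k. \<gamma> k * \<psi> (mi_freq lam k)) summable_on Lam I"
    by (rule freq_bound(1)) (use C\<psi>[of 0] in auto)
  \<comment> \<open>On exponential sums the functionals agree by \<open>sumL\<close> and
    \<open>poly_jet_exp_sum\<close>. Both are continuous for the weighted bounds on \<open>N\<close>
    derivatives: \<open>T1\<close> by \<open>int_bound\<close>, \<open>T2\<close> by
    \<open>norm_poly_jet_le\<close> and \<open>freq_bound\<close>.\<close>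
  have "T1 \<psi> - T2 \<psi> = 0"
  proof (rule functional_eq_0_if_exp_sum_eq_0[OF \<psi> B(1), where N=N])
    fix n c
    define v where "v = (\<lambda>j::nat. complex_of_real (B + real j))"
    have v: "Re (v j) \<ge> B" for j by (simp add: v_def)
    have e: "set_integrable lborel {0..} (\<lambda>t. G t * exp (- v j * of_real t))" for j
      by (rule int_bound(1)[OF _ exp_bound[OF v]]) (auto intro!: continuous_intros)
    have "(LBINT t:{0..}. G t * (vderiv ^^ d) (exp_sum n c v) t) =
        (LBINT t:{0..}. \<Sum>j\<le>n. c j * (- v j) ^ d * (G t * exp (- v j * of_real t)))"
      unfolding vderiv_exp_sum exp_sum_def by (simp add: sum_distrib_left mult_ac)
    also have "\<dots> = (\<Sum>j\<le>n. c j * (- v j) ^ d * (LBINT t:{0..}. G t * exp (- v j * of_real t)))"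
      by (subst set_integral_sum(2)) (simp_all only: finite_atMost e set_integrable_mult_right set_integral_mult_right)
    finally have "T1 (exp_sum n c v) = (\<Sum>j\<le>n. c j * (v j ^ d * (LBINT t:{0..}. G t * exp (- v j * of_real t))))"
      unfolding T1_def sum_distrib_left
    proof (simp only: sum_distrib_left, intro sum.cong refl)
      fix j
      have "(-1) ^ d * (- v j) ^ d = v j ^ d" by (simp flip: power_mult_distrib)
      then show "(- 1) ^ d * (c j * (- v j) ^ d * x) = c j * (v j ^ d * x)" for x by (simp add: mult_ac)
    qed
    moreover have "T2 (exp_sum n c v) = (\<Sum>j\<le>n. c j * (v j ^ d * (LBINT t:{0..}. G t * exp (- v j * of_real t))))"
    proof -
      have "((\<lambda>k. \<Sum>j\<le>n. c j * (\<gamma> k * exp (- v j * of_real (mi_freq lam k)))) has_sum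
          (\<Sum>j\<le>n. c j * (v j ^ d * (LBINT t:{0..}. G t * exp (- v j * of_real t)) - poly p (v j)))) (Lam I)"
        unfolding \<gamma>_def by (intro has_sum_sum_finite has_sum_cmult_right sumL v finite_atMost)
      then have "(\<Sum>\<^sub>\<infinity>k\<in>Lam I. \<gamma> k * exp_sum n c v (mi_freq lam k)) =
          (\<Sum>j\<le>n. c j * (v j ^ d * (LBINT t:{0..}. G t * exp (- v j * of_real t)) - poly p (v j)))"
        unfolding exp_sum_def sum_distrib_left by (intro infsumI) (simp add: mult_ac)
      then show ?thesis
        unfolding T2_def poly_jet_exp_sum by (simp add: sum.distrib[symmetric] algebra_simps)
    qed
    ultimately show "T1 (exp_sum n c (\<lambda>j. of_real (B + real j))) - T2 (exp_sum n c (\<lambda>j. of_real (B + real j))) = 0"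
      unfolding v_def by simp
  next
    fix n c \<eta>
    define E where "E = exp_sum n c (\<lambda>j. of_real (B + real j))"
    assume \<eta>: "\<eta> > 0" and "\<And>i t. i \<le> N \<Longrightarrow> t \<ge> 0 \<Longrightarrow>
        norm ((vderiv ^^ i) \<psi> t - (vderiv ^^ i) (exp_sum n c (\<lambda>j. of_real (B + real j))) t) \<le> \<eta> * exp (- B * t)"
    then have close: "norm ((vderiv ^^ i) \<psi> t - (vderiv ^^ i) E t) \<le> \<eta> * exp (- B * t)" if "i \<le> N" "t \<ge> 0" for i t
      using that by (simp add: E_def)
    have smE: "smooth_fun E" unfolding E_def by (rule smooth_fun_exp_sum)
    have Eb: "norm ((vderiv ^^ i) E t) \<le> (C\<psi> + \<eta>) * exp (- B * t)" if "i \<le> N" "t \<ge> 0" for i t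
      using close[OF that] C\<psi>[OF that] norm_triangle_sub[of "(vderiv ^^ i) E t" "(vderiv ^^ i) \<psi> t"]
      by (simp add: distrib_right norm_minus_commute)
    have dN: "d \<le> N" by (simp add: N_def)
    have "T1 \<psi> - T1 E = (-1) ^ d * (LBINT t:{0..}. G t * ((vderiv ^^ d) \<psi> t - (vderiv ^^ d) E t))"
      unfolding T1_def right_diff_distrib
      by (subst set_integral_diff(2)[OF int_bound(1) int_bound(1)])
         (use smooth_fun_continuous \<psi>(1) smE C\<psi>[OF dN] Eb[OF dN] in \<open>auto simp: right_diff_distrib\<close>)
    moreover have "norm (LBINT t:{0..}. G t * ((vderiv ^^ d) \<psi> t - (vderiv ^^ d) E t)) \<le> Cg * \<eta>"
      by (rule int_bound(2)[OF _ close[OF dN]]) (intro continuous_on_diff smooth_fun_continuous \<psi> smE)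
    ultimately have 1: "norm (T1 \<psi> - T1 E) \<le> Cg * \<eta>" by (simp add: norm_mult norm_power)
    have sumE: "(\<lambda>k. \<gamma> k * E (mi_freq lam k)) summable_on Lam I"
      by (rule freq_bound(1)) (use Eb[of 0] in auto)
    have "T2 \<psi> - T2 E = poly_jet p (\<lambda>t. \<psi> t - E t) + (\<Sum>\<^sub>\<infinity>k\<in>Lam I. \<gamma> k * (\<psi> (mi_freq lam k) - E (mi_freq lam k)))"
    proof -
      have "poly_jet p (\<lambda>t. \<psi> t - E t) = poly_jet p \<psi> - poly_jet p E"
        using poly_jet_lincomb[OF \<psi>(1) smE, of p 1 "-1"] by simp
      moreover have "(\<Sum>\<^sub>\<infinity>k\<in>Lam I. \<gamma> k * (\<psi> (mi_freq lam k) - E (mi_freq lam k))) =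
         (\<Sum>\<^sub>\<infinity>k\<in>Lam I. \<gamma> k * \<psi> (mi_freq lam k)) - (\<Sum>\<^sub>\<infinity>k\<in>Lam I. \<gamma> k * E (mi_freq lam k))"
      proof (rule infsumI)
        have "((\<lambda>k. \<gamma> k * \<psi> (mi_freq lam k) + - (\<gamma> k * E (mi_freq lam k))) has_sum
          ((\<Sum>\<^sub>\<infinity>k\<in>Lam I. \<gamma> k * \<psi> (mi_freq lam k)) + - (\<Sum>\<^sub>\<infinity>k\<in>Lam I. \<gamma> k * E (mi_freq lam k)))) (Lam I)"
          by (intro has_sum_add has_sum_uminusI has_sum_infsum sum\<psi> sumE)
        then show "((\<lambda>k. \<gamma> k * (\<psi> (mi_freq lam k) - E (mi_freq lam k))) has_sum
          ((\<Sum>\<^sub>\<infinity>k\<in>Lam I. \<gamma> k * \<psi> (mi_freq lam k)) - (\<Sum>\<^sub>\<infinity>k\<in>Lam I. \<gamma> k * E (mi_freq lam k)))) (Lam I)"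
          by (simp add: right_diff_distrib)
      qed
      ultimately show ?thesis unfolding T2_def by simp
    qed
    also have "norm \<dots> \<le> (\<Sum>j\<le>degree p. norm (coeff p j)) * \<eta> + S * \<eta>"
    proof (rule order_trans[OF norm_triangle_ineq], rule add_mono)
      show "norm (poly_jet p (\<lambda>t. \<psi> t - E t)) \<le> (\<Sum>j\<le>degree p. norm (coeff p j)) * \<eta>"
        by (rule norm_poly_jet_le) (use close[of _ 0] in \<open>auto simp: vderiv_diff[OF \<psi>(1) smE] N_def\<close>)
      show "norm (\<Sum>\<^sub>\<infinity>k\<in>Lam I. \<gamma> k * (\<psi> (mi_freq lam k) - E (mi_freq lam k))) \<le> S * \<eta>"
        by (rule freq_bound(2)[of "\<lambda>t. \<psi> t - E t"]) (use close[of 0] in auto)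
    qed
    finally have 2: "norm (T2 \<psi> - T2 E) \<le> (\<Sum>j\<le>degree p. norm (coeff p j)) * \<eta> + S * \<eta>" .
    have "T1 \<psi> - T2 \<psi> - (T1 E - T2 E) = (T1 \<psi> - T1 E) - (T2 \<psi> - T2 E)" by simp
    also have "norm \<dots> \<le> Cg * \<eta> + ((\<Sum>j\<le>degree p. norm (coeff p j)) * \<eta> + S * \<eta>)"
      by (rule order_trans[OF norm_triangle_ineq4 add_mono[OF 1 2]])
    also have "\<dots> = (Cg + (\<Sum>j\<le>degree p. norm (coeff p j)) + S) * \<eta>" by (simp add: distrib_right)
    finally show "norm (T1 \<psi> - T2 \<psi> - (T1 (exp_sum n c (\<lambda>j. of_real (B + real j))) - T2 (exp_sum n c (\<lambda>j. of_real (B + real j)))))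
       \<le> (Cg + (\<Sum>j\<le>degree p. norm (coeff p j)) + S) * \<eta>"
      unfolding E_def .
  qed
  then have T12: "T1 \<psi> = T2 \<psi>" by simp
  have \<gamma>\<psi>: "\<gamma> k * \<psi> (mi_freq lam k) = \<beta> k * \<phi> (mi_freq lam k)" for k
    unfolding \<gamma>_def \<psi>_def by (simp add: exp_minus mult.commute[of \<sigma>])
  have "((\<lambda>k. \<beta> k * \<phi> (mi_freq lam k)) has_sum (\<Sum>\<^sub>\<infinity>k\<in>Lam I. \<gamma> k * \<psi> (mi_freq lam k))) (Lam I)"
    using has_sum_infsum[OF sum\<psi>] by (simp add: \<gamma>\<psi>)
  also have "(\<Sum>\<^sub>\<infinity>k\<in>Lam I. \<gamma> k * \<psi> (mi_freq lam k)) = newton_W f d \<sigma> \<phi> - poly_jet (- pderiv Q) \<phi>"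
    unfolding W T12 T2_def using poly_jet_exp_shift[OF \<phi>(1), of "- pderiv Q" \<sigma>]
    by (simp add: p_def \<psi>_def)
  finally show ?thesis by (simp add: \<beta>_def)
qed


section \<open>Symmetrization\<close>

lemma test_function_smooth:
  assumes "test_function \<phi>"
  shows "smooth_fun \<phi>"
  using assms by (simp add: test_function_def smooth_fun_def)

lemma test_function_vanish:
  assumes "test_function \<phi>"
  obtains R where "\<And>t. \<bar>t\<bar> > R \<Longrightarrow> \<phi> t = 0"
proof -
  have "bounded (closure {t. \<phi> t \<noteq> 0})"
    using assms compact_imp_bounded by (auto simp: test_function_def)
  then have "bounded {t. \<phi> t \<noteq> 0}" using bounded_subset closure_subset by blast
  then obtain R where "\<And>t. \<phi> t \<noteq> 0 \<Longrightarrow> \<bar>t\<bar> \<le> R" unfolding bounded_real by blast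
  then show ?thesis by (intro that[of R]) force
qed

text \<open>Reflection multiplies the \<open>j\<close>-th derivative at 0 by
  \<open>(-1) ^ j\<close>, so even orders double and odd ones cancel. The range of \<open>l\<close>
  is taken in the reals and is empty for \<open>g = 0\<close>, whereas the natural number
  \<open>g - 1\<close> would be 0; a nonzero constant \<open>p\<close> is therefore ruled out by the
  hypothesis \<open>g\<close>.\<close>

lemma poly_jet_reflect:
  assumes "smooth_fun \<phi>" and deg: "degree p \<le> g - 1 \<or> p = 0" and g: "p \<noteq> 0 \<Longrightarrow> g \<ge> 1"
  shows "poly_jet p \<phi> + poly_jet p (\<lambda>t. \<phi> (- t)) =
    2 * (\<Sum>l\<in>{l::nat. real l \<le> (real g - 1) / 2}. coeff p (2 * l) * (distr_deriv ^^ (2 * l)) (dirac 0) \<phi>)"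
proof -
  let ?c = "\<lambda>j. coeff p j * (vderiv ^^ j) \<phi> 0"
  have "poly_jet p \<phi> + poly_jet p (\<lambda>t. \<phi> (- t)) = (\<Sum>j\<le>degree p. ((-1) ^ j + 1) * ?c j)"
    unfolding poly_jet_def vderiv_reflect[OF assms(1)] sum.distrib[symmetric]
    by (intro sum.cong) (auto simp: algebra_simps simp flip: power_mult_distrib)
  also have "\<dots> = (\<Sum>j\<in>{j. j \<le> degree p \<and> even j}. 2 * ?c j)"
    by (rule sum.mono_neutral_cong_right) auto
  also have "\<dots> = (\<Sum>l\<in>{l. 2 * l \<le> degree p}. 2 * ?c (2 * l))"
    by (rule sum.reindex_bij_witness[of _ "\<lambda>l. 2 * l" "\<lambda>j. j div 2"]) auto
  also have "\<dots> = (\<Sum>l\<in>{l::nat. real l \<le> (real g - 1) / 2}. 2 * ?c (2 * l))"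
  proof (cases "p = 0")
    case False
    show ?thesis
    proof (rule sum.mono_neutral_left)
      have "{l::nat. real l \<le> (real g - 1) / 2} \<subseteq> {..g}" by auto
      then show "finite {l::nat. real l \<le> (real g - 1) / 2}" by (rule finite_subset) simp
      show "{l. 2 * l \<le> degree p} \<subseteq> {l::nat. real l \<le> (real g - 1) / 2}"
        using deg g False by auto
      \<comment> \<open>The genus may exceed the degree of \<open>p\<close> by more than 1; the
        surplus coefficients are 0.\<close>
      show "\<forall>l\<in>{l::nat. real l \<le> (real g - 1) / 2} - {l. 2 * l \<le> degree p}. 2 * ?c (2 * l) = 0"
        by (auto simp: coeff_eq_0)
    qed
  qed simp
  also have "\<dots> = 2 * (\<Sum>l\<in>{l::nat. real l \<le> (real g - 1) / 2}. coeff p (2 * l) * (distr_deriv ^^ (2 * l)) (dirac 0) \<phi>)"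
    by (simp add: sum_distrib_left distr_deriv_funpow dirac_def mult.assoc)
  finally show ?thesis .
qed

text \<open>Only the zero multi-index has both signs, and \<open>1 \<le> mi_norm k\<close> excludes
  it. This makes \<open>mi_abs\<close> unambiguous and splits the sum over frequencies into two
  halves.\<close>

lemma Lam_disjoint_neg: "Lam I \<inter> mi_neg ` Lam I = {}"
proof -
  have False if k: "k \<in> Lam I" "mi_neg k \<in> Lam I" for k
  proof -
    have "k n = 0" for n
    proof -
      have "0 \<le> k n" "0 \<le> - k n" using k by (auto simp: Lam_def mi_neg_def)
      then show ?thesis by simp
    qed
    then have "mi_norm k = 0" by (simp add: mi_norm_def mi_support_def)
    then show False using k by (simp add: Lam_def)
  qed
  then show ?thesis by blast
qed

lemma mi_freq_neg: "mi_freq lam (mi_neg k) = - mi_freq lam k"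
  by (simp add: mi_freq_def mi_support_def mi_neg_def sum_negf)

lemma frequency_distr_eq:
  assumes pos: "((\<lambda>k. of_real (mi_freq lam k) * log_coeff a k * \<phi> (mi_freq lam k)) has_sum x) (Lam I)"
    and neg: "((\<lambda>k. of_real (mi_freq lam k) * log_coeff a k * \<phi> (- mi_freq lam k)) has_sum y) (Lam I)"
  shows "frequency_distr I a lam \<phi> = x + y"
proof -
  let ?g = "\<lambda>k. of_real (mi_freq lam (mi_abs I k)) * log_coeff a (mi_abs I k) * \<phi> (mi_freq lam k)"
  have "(?g has_sum x) (Lam I)"
    using pos by (subst has_sum_cong) (auto simp: mi_abs_def)
  moreover have "(?g has_sum y) (mi_neg ` Lam I)"
  proof -
    have "inj_on mi_neg (Lam I)" by (rule inj_onI) (auto simp: mi_neg_def fun_eq_iff)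
    moreover have "mi_abs I (mi_neg k) = k" if "k \<in> Lam I" for k
      using Lam_disjoint_neg[of I] that by (auto simp: mi_abs_def mi_neg_def[of "mi_neg k"]) (auto simp: mi_neg_def)
    ultimately show ?thesis
      using neg by (subst has_sum_reindex) (auto simp: o_def mi_freq_neg cong: has_sum_cong)
  qed
  ultimately have "(?g has_sum (x + y)) (Lam I \<union> mi_neg ` Lam I)"
    by (rule has_sum_Un_disjoint[OF _ _ Lam_disjoint_neg])
  then show ?thesis unfolding frequency_distr_def dirac_def by (rule infsumI)
qed

theorem theorem4p3:
  fixes I :: "nat set" and a :: "nat \<Rightarrow> complex" and lam :: "nat \<Rightarrow> real"
    and f :: "complex \<Rightarrow> complex" and d :: nat and \<sigma> :: complex
  assumes "dirichlet_data I a lam"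
    and "meromorphic_extension I a lam f"
    and "\<not> f constant_on UNIV"
    and "finite_order f"
    and "convergence_exponent f d"
    and "d \<ge> 1"
  shows "distr_eq (newton_W_sym f d \<sigma>)
     (\<lambda>\<phi>. 2 * (\<Sum>l\<in>{l::nat. real l \<le> (real (genus f \<sigma> d) - 1) / 2}.
                  hadamard_coeff f \<sigma> d (2 * l) * (distr_deriv ^^ (2 * l)) (dirac 0) \<phi>)
           + frequency_distr I a lam \<phi>)"
  unfolding distr_eq_def
proof (intro allI impI)
  fix \<phi> assume tf: "test_function \<phi>"
  let ?Q = "hadamard_poly f \<sigma> d" and ?\<phi>' = "\<lambda>t. \<phi> (- t)"
  note sm = test_function_smooth[OF tf]
  obtain R where R: "\<And>t. \<bar>t\<bar> > R \<Longrightarrow> \<phi> t = 0" using test_function_vanish[OF tf] by blast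
  have van: "\<phi> t = 0" "?\<phi>' t = 0" if "t > R" for t
    using R[of t] R[of "- t"] that by auto
  note 1 = newton_W_eq[OF assms sm van(1)]
  note 2 = newton_W_eq[OF assms smooth_fun_reflect[OF sm] van(2)]
  have g: "genus f \<sigma> d \<ge> degree ?Q" by (simp add: genus_def)
  have deg: "degree (- pderiv ?Q) \<le> genus f \<sigma> d - 1"
    using g by (simp add: degree_pderiv diff_le_mono)
  \<comment> \<open>Truncated subtraction makes \<open>deg\<close> too weak when the genus is 0; a
    nonzero derivative forces \<open>?Q\<close> to have positive degree.\<close>
  have pos: "genus f \<sigma> d \<ge> 1" if "- pderiv ?Q \<noteq> 0"
  proof -
    have "degree ?Q \<noteq> 0" using that by (auto simp: pderiv_eq_0_iff)
    then show ?thesis using g by simp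
  qed
  have "newton_W_sym f d \<sigma> \<phi> = newton_W f d \<sigma> \<phi> + newton_W f d \<sigma> ?\<phi>'"
    by (simp add: newton_W_sym_def distr_reflect_def)
  also have "\<dots> = (poly_jet (- pderiv ?Q) \<phi> + poly_jet (- pderiv ?Q) ?\<phi>') + frequency_distr I a lam \<phi>"
  proof -
    have "frequency_distr I a lam \<phi> = (newton_W f d \<sigma> \<phi> - poly_jet (- pderiv ?Q) \<phi>) +
        (newton_W f d \<sigma> ?\<phi>' - poly_jet (- pderiv ?Q) ?\<phi>')"
      by (rule frequency_distr_eq[OF 1 2])
    then show ?thesis by simp
  qed
  also have "poly_jet (- pderiv ?Q) \<phi> + poly_jet (- pderiv ?Q) ?\<phi>' =
      2 * (\<Sum>l\<in>{l::nat. real l \<le> (real (genus f \<sigma> d) - 1) / 2}.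
        coeff (- pderiv ?Q) (2 * l) * (distr_deriv ^^ (2 * l)) (dirac 0) \<phi>)"
    by (rule poly_jet_reflect[OF sm disjI1[OF deg] pos])
  finally show "newton_W_sym f d \<sigma> \<phi> = 2 * (\<Sum>l\<in>{l::nat. real l \<le> (real (genus f \<sigma> d) - 1) / 2}.
                  hadamard_coeff f \<sigma> d (2 * l) * (distr_deriv ^^ (2 * l)) (dirac 0) \<phi>)
           + frequency_distr I a lam \<phi>"
    by (simp only: hadamard_coeff_def)
qed

end
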